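(* There is no planar cover $G$ of $K_{1,2,2,2}$, with covering projection $\pi$, such that for every vertex $v$ of $G$ with $\pi(v)$ equal to the apex vertex, the subgraph of $G$ induced by the closed neighbourhood $N[v]$ is isomorphic to the wheel graph $W_7$.
   Context: All graphs are finite, simple and undirected. $K_{1,2,2,2}$ is the octahedron $K_{2,2,2}$ together with an extra vertex (the apex vertex, the unique vertex of degree $6$) adjacent to all six octahedral vertices. A graph $G$ is a cover of $K$ if there is an onto map $\pi: V(G)\to V(K)$ mapping the neighbours of each vertex $v$ bijectively onto the neighbours of $\pi(v)$; it is planar if $G$ is a planar graph. $N[v]$ denotes the set consisting of $v$ and all its neighbours. $W_7$ denotes the wheel graph on $7$ vertices (a $6$-cycle together with a vertex adjacent to all six cycle vertices). *)

theory Defs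
  imports
    "Graph_Theory.Pair_Digraph"
    "Graph_Theory.Digraph_Isomorphism"
    "HOL-Analysis.Analysis"
begin

text \<open>
  Finite simple undirected graphs are symmetric loop-free digraphs without parallel arcs,
  i.e. values satisfying \<^const>\<open>pair_graph\<close>; an edge between u and v is represented by
  the two arcs (u, v) and (v, u).
\<close>

hide_const (open) Digraph_Component.connected

definition neighbours :: "'a pair_pre_digraph \<Rightarrow> 'a \<Rightarrow> 'a set" where
  "neighbours G v = {w. (v, w) \<in> parcs G}"

definition closed_neighbourhood :: "'a pair_pre_digraph \<Rightarrow> 'a \<Rightarrow> 'a set" where
  "closed_neighbourhood G v = insert v (neighbours G v)"

definition covering_projection ::
    "'a pair_pre_digraph \<Rightarrow> 'b pair_pre_digraph \<Rightarrow> ('a \<Rightarrow> 'b) \<Rightarrow> bool" where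
  "covering_projection G K \<pi> \<longleftrightarrow>
     \<pi> ` pverts G = pverts K \<and>
     (\<forall>v\<in>pverts G. bij_betw \<pi> (neighbours G v) (neighbours K (\<pi> v)))"

definition arc_interior :: "(real \<Rightarrow> complex) \<Rightarrow> complex set" where
  "arc_interior g = path_image g - {pathstart g, pathfinish g}"

text \<open>
  The arc drawing an edge is indexed by the two-element set of its ends, so that both
  orientations of an edge share one arc.
\<close>

definition plane_drawing ::
    "'a pair_pre_digraph \<Rightarrow> ('a \<Rightarrow> complex) \<Rightarrow> ('a set \<Rightarrow> real \<Rightarrow> complex) \<Rightarrow> bool" where
  "plane_drawing G p \<gamma> \<longleftrightarrow>
     inj_on p (pverts G) \<and>
     (\<forall>(u, v)\<in>parcs G.
        arc (\<gamma> {u, v}) \<and>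
        {pathstart (\<gamma> {u, v}), pathfinish (\<gamma> {u, v})} = {p u, p v} \<and>
        arc_interior (\<gamma> {u, v}) \<inter> p ` pverts G = {} \<and>
        (\<forall>(x, y)\<in>parcs G. {x, y} \<noteq> {u, v} \<longrightarrow>
           arc_interior (\<gamma> {u, v}) \<inter> path_image (\<gamma> {x, y}) = {}))"

definition planar :: "'a pair_pre_digraph \<Rightarrow> bool" where
  "planar G \<longleftrightarrow> (\<exists>p \<gamma>. plane_drawing G p \<gamma>)"

text \<open>The extra vertex of \<open>add_apex H\<close> is \<^const>\<open>None\<close>.\<close>

definition add_apex :: "'a pair_pre_digraph \<Rightarrow> 'a option pair_pre_digraph" where
  "add_apex H =
     \<lparr> pverts = insert None (Some ` pverts H),
       parcs = {(Some u, Some v) | u v. (u, v) \<in> parcs H}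
             \<union> {(None, Some v) | v. v \<in> pverts H}
             \<union> {(Some v, None) | v. v \<in> pverts H} \<rparr>"

text \<open>
  The octahedron is the complete tripartite graph whose parts are the pairs
  \<open>{(i, False), (i, True)}\<close> for \<open>i < 3\<close>.
\<close>

definition octahedron :: "(nat \<times> bool) pair_pre_digraph" where
  "octahedron =
     \<lparr> pverts = {..<3} \<times> UNIV,
       parcs = {((i, b), (j, c)) | i b j c. i < 3 \<and> j < 3 \<and> i \<noteq> j} \<rparr>"

definition K1222 :: "(nat \<times> bool) option pair_pre_digraph" where
  "K1222 = add_apex octahedron"

definition cycle_graph :: "nat \<Rightarrow> nat pair_pre_digraph" where
  "cycle_graph n =
     \<lparr> pverts = {..<n},
       parcs = {(i, j). i < n \<and> j < n \<and> (j = Suc i mod n \<or> i = Suc j mod n)} \<rparr>"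

definition W7 :: "nat option pair_pre_digraph" where
  "W7 = add_apex (cycle_graph 6)"

lemma pair_graph_iff:
  "pair_graph H \<longleftrightarrow>
     finite (pverts H) \<and> parcs H \<subseteq> pverts H \<times> pverts H \<and> sym (parcs H) \<and> irrefl (parcs H)"
proof
  assume "pair_graph H"
  then interpret pair_graph H .
  show "finite (pverts H) \<and> parcs H \<subseteq> pverts H \<times> pverts H \<and> sym (parcs H) \<and> irrefl (parcs H)"
    using pair_finite_verts in_arcsD1 in_arcsD2 arcs_symmetric no_loops'
    by (auto simp: sym_def irrefl_def) blast
next
  assume *: "finite (pverts H) \<and> parcs H \<subseteq> pverts H \<times> pverts H \<and> sym (parcs H) \<and> irrefl (parcs H)"
  then have "finite (parcs H)"
    by (meson finite_SigmaI finite_subset)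
  with * show "pair_graph H"
    by unfold_locales (auto simp: symmetric_def irrefl_def)
qed

lemma pair_graph_add_apex: "pair_graph H \<Longrightarrow> pair_graph (add_apex H)"
  by (auto simp: pair_graph_iff add_apex_def sym_def irrefl_def)

lemma pair_graph_K1222: "pair_graph K1222"
  unfolding K1222_def
  by (rule pair_graph_add_apex) (auto simp: pair_graph_iff octahedron_def sym_def irrefl_def)

lemma pair_graph_W7: "pair_graph W7"
proof -
  have "i \<noteq> Suc i mod 6" for i :: nat
    by presburger
  then have "irrefl (parcs (cycle_graph 6))"
    by (auto simp: irrefl_def cycle_graph_def)
  then have "pair_graph (cycle_graph 6)"
    by (auto simp: pair_graph_iff cycle_graph_def sym_def)
  then show ?thesis
    unfolding W7_def by (rule pair_graph_add_apex)
qed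

lemma K1222_degree_6_iff:
  assumes "x \<in> pverts K1222"
  shows "card (neighbours K1222 x) = 6 \<longleftrightarrow> x = None"
proof (cases x)
  case None
  have "neighbours K1222 None = Some ` ({..<3} \<times> UNIV)"
    by (auto simp: neighbours_def K1222_def add_apex_def octahedron_def)
  then show ?thesis
    using None by (simp add: card_image card_cartesian_product)
next
  case (Some y)
  obtain i b where y: "y = (i, b)" by fastforce
  have i: "i < 3"
    using assms by (auto simp: Some y K1222_def add_apex_def octahedron_def)
  have "neighbours K1222 x = insert None (Some ` (({..<3} - {i}) \<times> UNIV))"
    using i by (auto simp: Some y neighbours_def K1222_def add_apex_def octahedron_def)
  then have "card (neighbours K1222 x) = 5"
    using i by (simp add: card_insert_if card_image card_cartesian_product image_iff)
  then show ?thesis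
    using Some by simp
qed

end

theory Submission
  imports Defs "HOL-Complex_Analysis.Winding_Numbers"
begin

text \<open>
  A component of the cover is 2-connected, so its faces are bounded by cycles and Euler's formula
  holds; moreover it stays connected when a triangle is removed, so the six triangles of every wheel
  are faces. Contract each of the n wheels to a point. The result is a plane multigraph with n
  vertices of degree 12, hence with 5n + 2 faces. Distribute the weight 1 of each of these
  faces equally over its corners. A wheel has 12 corners, six at the rim vertices and six
  at the rim edges, and to contradict Euler's formula it suffices that a wheel receives at most 5.
  Only digons give more than 1/3 to a corner. The labels in the octahedron restrict how digons can
  follow each other around a wheel: there are at most 8, and if there are 7 or 8 then at least 2,
  respectively 4, of the remaining corners lie on faces of length at least 4.
\<close>

section \<open>Theta graphs in the plane\<close>

text \<open>Six corners of weight 1/2 and six of weight 1/3 add up to exactly 5, so six digons do no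
  harm. A seventh adds 1/6, paid for by two corners of weight at most 1/4, each saving 1/12; an
  eighth doubles the debt. The bound 5 has no slack: the contradiction comes from the 2 in Euler's
  formula. The rim of a wheel carries each octahedral label once, so it is a lift of a Hamiltonian
  cycle of the octahedron. There are two kinds: all opposite rim vertices carry opposite labels, or
  only one such pair does, the poles. The first kind allows at most six digons; the second is where
  longer faces must be found. The drawing is an arbitrary topological one, so faces are components
  of its complement. That they are bounded by cycles is shown by growing the graph from a triangle
  by ears; each ear reduces to the three faces of a theta graph. Connectivity after removing a
  triangle uses no planarity, only a comparison of fibre sizes of the covering map.\<close>

lemma components_eqI:
  fixes S :: "'a::real_normed_vector set"
  assumes "\<Union>\<C> = S" "\<And>C. C \<in> \<C> \<Longrightarrow> open C \<and> connected C \<and> C \<noteq> {}"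
    "\<And>C D. C \<in> \<C> \<Longrightarrow> D \<in> \<C> \<Longrightarrow> C \<noteq> D \<Longrightarrow> C \<inter> D = {}"
  shows "components S = \<C>"
proof -
  have sub: "C \<in> components S" if C: "C \<in> \<C>" for C
  proof -
    have "C \<subseteq> S" using C assms(1) by auto
    obtain x where x: "x \<in> C" using assms(2)[OF C] by auto
    let ?K = "connected_component_set S x"
    have 1: "C \<subseteq> ?K" using C x assms(2) \<open>C \<subseteq> S\<close> by (simp add: connected_component_maximal)
    have "?K \<subseteq> C"
    proof (rule ccontr)
      assume n: "\<not> ?K \<subseteq> C"
      have "connected ?K" by simp
      moreover have "open C" "open (\<Union>(\<C> - {C}))" using assms(2) C by auto
      moreover have "?K \<subseteq> C \<union> \<Union>(\<C> - {C})"
        using connected_component_subset[of S x] assms(1) by auto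
      moreover have "C \<inter> \<Union>(\<C> - {C}) \<inter> ?K = {}" using assms(3) C by blast
      moreover have "C \<inter> ?K \<noteq> {}" using x 1 by auto
      moreover have "\<Union>(\<C> - {C}) \<inter> ?K \<noteq> {}" using n \<open>?K \<subseteq> C \<union> \<Union>(\<C> - {C})\<close> by auto
      ultimately show False using connectedD by blast
    qed
    with 1 have "C = ?K" by auto
    then show ?thesis using x \<open>C \<subseteq> S\<close> by (auto simp: components_def)
  qed
  moreover have "K \<in> \<C>" if K: "K \<in> components S" for K
  proof -
    obtain x where "x \<in> K" using in_components_nonempty[OF K] by auto
    then obtain C where C: "C \<in> \<C>" "x \<in> C" using in_components_subset[OF K] assms(1) by auto
    have "C \<in> components S" by (rule sub[OF C(1)])
    then have "C = K" using K \<open>x \<in> K\<close> C(2) components_nonoverlap by blast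
    then show ?thesis using C by auto
  qed
  ultimately show ?thesis by auto
qed

text \<open>A connected set avoiding \<open>X\<close> cannot leave \<open>D\<close> without meeting
  its frontier, which lies in \<open>X\<close>. This is how a side of a single closed curve is
  recognised as a face of a larger drawing.\<close>

lemma in_components_Compl:
  fixes D :: "'a::real_normed_vector set"
  assumes "connected D" "D \<noteq> {}" "frontier D \<subseteq> X" "D \<inter> X = {}"
  shows "D \<in> components (- X)"
proof -
  obtain x where x: "x \<in> D" using assms by auto
  let ?K = "connected_component_set (- X) x"
  have 1: "D \<subseteq> ?K" using assms x by (intro connected_component_maximal) auto
  have "?K \<inter> frontier D = {}" using connected_component_subset[of "-X" x] assms(3) by blast
  moreover have "?K \<inter> D \<noteq> {}" using x 1 by auto
  ultimately have "?K - D = {}" using connected_Int_frontier[of ?K D] connected_connected_component by blast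
  with 1 have "D = ?K" by auto
  then show ?thesis using x assms by (auto simp: components_def)
qed

lemma simple_path_arc_union:
  assumes "arc c1" "arc c2" "pathstart c1 = a" "pathfinish c1 = b"
    "pathstart c2 = a" "pathfinish c2 = b" "path_image c1 \<inter> path_image c2 = {a,b}"
  shows "simple_path (c1 +++ reversepath c2)" "pathfinish (c1 +++ reversepath c2) = pathstart (c1 +++ reversepath c2)"
    "path_image (c1 +++ reversepath c2) = path_image c1 \<union> path_image c2"
  using assms by (auto intro!: simple_path_join_loop arc_reversepath simp: path_image_join)

lemma Jordan_arcs:
  fixes c1 c2 :: "real \<Rightarrow> complex"
  assumes "arc c1" "arc c2" "pathstart c1 = a" "pathfinish c1 = b"
    "pathstart c2 = a" "pathfinish c2 = b" "path_image c1 \<inter> path_image c2 = {a,b}"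
  defines "I \<equiv> inside (path_image c1 \<union> path_image c2)" and "E \<equiv> outside (path_image c1 \<union> path_image c2)"
  shows "I \<noteq> {}" "open I" "connected I" "E \<noteq> {}" "open E" "connected E" "I \<inter> E = {}"
    "I \<union> E = - (path_image c1 \<union> path_image c2)" "frontier I = path_image c1 \<union> path_image c2"
    "frontier E = path_image c1 \<union> path_image c2"
  using Jordan_inside_outside[OF simple_path_arc_union(1,2)[OF assms(1-7)]]
  unfolding simple_path_arc_union(3)[OF assms(1-7)] I_def E_def by auto

text \<open>The loop that follows \<open>c1\<close> and returns along \<open>c2\<close> has the
  difference of the two numbers as winding number, which is nonzero exactly inside. Lying outside
  thus becomes an equation, and the equations for several arcs with the same ends can be
  combined.\<close>

lemma winding_number_arcs:
  assumes "arc c1" "arc c2" "pathstart c1 = a" "pathfinish c1 = b"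
    "pathstart c2 = a" "pathfinish c2 = b" "path_image c1 \<inter> path_image c2 = {a,b}"
    "z \<notin> path_image c1 \<union> path_image c2"
  shows "winding_number c1 z \<noteq> winding_number c2 z \<longleftrightarrow> z \<in> inside (path_image c1 \<union> path_image c2)"
proof -
  let ?g = "c1 +++ reversepath c2"
  note sp = simple_path_arc_union[OF assms(1-7)]
  have "winding_number ?g z = winding_number c1 z + winding_number (reversepath c2) z"
    using assms by (intro winding_number_join) (auto simp: arc_imp_path)
  also have "winding_number (reversepath c2) z = - winding_number c2 z"
    using assms by (intro winding_number_reversepath) (auto simp: arc_imp_path)
  finally have w: "winding_number ?g z = winding_number c1 z - winding_number c2 z" by simp
  have "winding_number ?g z \<noteq> 0 \<longleftrightarrow> z \<in> inside (path_image ?g)"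
  proof
    assume "z \<in> inside (path_image ?g)"
    then show "winding_number ?g z \<noteq> 0"
      using simple_closed_path_abs_winding_number_inside[OF sp(1)] by fastforce
  next
    assume "winding_number ?g z \<noteq> 0"
    then show "z \<in> inside (path_image ?g)"
      using winding_number_zero_in_outside[of ?g z] sp assms(8) simple_path_imp_path
      by (metis ComplI UnE inside_Un_outside)
  qed
  with w sp(3) show ?thesis by auto
qed

lemma arc_interior_nonempty:
  assumes "arc c"
  shows "path_image c - {pathstart c, pathfinish c} \<noteq> {}"
proof -
  have "infinite (path_image c)"
  proof
    assume f: "finite (path_image c)"
    have "inj_on c {0..1}" using assms by (simp add: arc_def)
    then have "finite {0..1::real}" using f finite_imageD unfolding path_image_def by blast
    then show False by (simp add: infinite_Icc)
  qed
  then show ?thesis by (metis Diff_eq_empty_iff finite.emptyI finite.insertI finite_subset)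
qed

locale theta =
  fixes c1 c2 c3 :: "real \<Rightarrow> complex" and a b :: complex
  assumes arcs: "arc c1" "arc c2" "arc c3"
    and ends: "pathstart c1 = a" "pathfinish c1 = b" "pathstart c2 = a" "pathfinish c2 = b"
      "pathstart c3 = a" "pathfinish c3 = b"
    and meet: "path_image c1 \<inter> path_image c2 = {a,b}" "path_image c1 \<inter> path_image c3 = {a,b}"
      "path_image c2 \<inter> path_image c3 = {a,b}"
begin

definition has_three_faces :: bool where
  "has_three_faces \<longleftrightarrow> (\<exists>D12 D13 D23.
     components (- (path_image c1 \<union> path_image c2 \<union> path_image c3)) = {D12, D13, D23} \<and>
     frontier D12 = path_image c1 \<union> path_image c2 \<and>
     frontier D13 = path_image c1 \<union> path_image c3 \<and>
     frontier D23 = path_image c2 \<union> path_image c3)"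

text \<open>The third arc cuts the inside of the closed curve formed by the other two into two
  pieces, and their outside is untouched. By \<open>some_arc_inside\<close> every theta graph has
  this shape after renaming its arcs.\<close>

lemma inside_case:
  assumes "path_image c3 \<inter> inside (path_image c1 \<union> path_image c2) \<noteq> {}"
  shows has_three_faces
proof -
  let ?I = "\<lambda>c d. inside (path_image c \<union> path_image d)"
  have ab: "a \<noteq> b" using arcs(1) ends arc_distinct_ends by blast
  have sp: "simple_path c1" "simple_path c2" "simple_path c3" using arcs arc_imp_simple_path by auto
  obtain s: "?I c1 c3 \<inter> ?I c2 c3 = {}" "?I c1 c3 \<union> ?I c2 c3 \<union> (path_image c3 - {a,b}) = ?I c1 c2"
    by (rule split_inside_simple_closed_curve[OF sp(1) ends(1,2) sp(2) ends(3,4) sp(3) ends(5,6) ab meet(1,2,3) assms])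
  note J12 = Jordan_arcs[OF arcs(1,2) ends(1-4) meet(1)]
  note J13 = Jordan_arcs[OF arcs(1,3) ends(1,2,5,6) meet(2)]
  note J23 = Jordan_arcs[OF arcs(2,3) ends(3-6) meet(3)]
  have disj: "outside (path_image c1 \<union> path_image c2) \<inter> ?I c1 c3 = {}"
    "outside (path_image c1 \<union> path_image c2) \<inter> ?I c2 c3 = {}"
    using J12(7) s(2) by blast+
  have "components (- (path_image c1 \<union> path_image c2 \<union> path_image c3)) =
      {outside (path_image c1 \<union> path_image c2), ?I c1 c3, ?I c2 c3}"
  proof (rule components_eqI)
    have "{a,b} \<subseteq> path_image c1" using meet by auto
    moreover have "(?I c1 c3 \<union> ?I c2 c3) \<inter> path_image c3 = {}" using J13(8) J23(8) by blast
    moreover have "(?I c1 c3 \<union> ?I c2 c3) \<inter> (path_image c1 \<union> path_image c2) = {}" using s(2) J12(8) by blast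
    moreover have "outside (path_image c1 \<union> path_image c2) \<inter> (path_image c1 \<union> path_image c2) = {}"
      using J12(8) by blast
    moreover have "outside (path_image c1 \<union> path_image c2) \<inter> path_image c3 = {}"
    proof -
      have "path_image c3 - {a,b} \<subseteq> ?I c1 c2" using s(2) by auto
      then show ?thesis using J12(7) calculation(1,4) by blast
    qed
    moreover have "- (path_image c1 \<union> path_image c2) = ?I c1 c3 \<union> ?I c2 c3 \<union> (path_image c3 - {a,b}) \<union> outside (path_image c1 \<union> path_image c2)"
      using s(2) J12(8) by blast
    ultimately show "\<Union> {outside (path_image c1 \<union> path_image c2), ?I c1 c3, ?I c2 c3} =
      - (path_image c1 \<union> path_image c2 \<union> path_image c3)" by auto
  next
    show "open C \<and> connected C \<and> C \<noteq> {}" if "C \<in> {outside (path_image c1 \<union> path_image c2), ?I c1 c3, ?I c2 c3}" for C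
      using that J12 J13 J23 by auto
  next
    show "C \<inter> D = {}" if "C \<in> {outside (path_image c1 \<union> path_image c2), ?I c1 c3, ?I c2 c3}"
      "D \<in> {outside (path_image c1 \<union> path_image c2), ?I c1 c3, ?I c2 c3}" "C \<noteq> D" for C D
      using that s(1) disj by (metis Int_commute insertE empty_iff)
  qed
  then show ?thesis unfolding has_three_faces_def using J12(10) J13(9) J23(9) by blast
qed

text \<open>
  The three winding number differences sum to zero, so no point lies inside exactly one of the
  three closed curves.
\<close>

lemma some_arc_inside:
  "path_image c3 \<inter> inside (path_image c1 \<union> path_image c2) \<noteq> {} \<or>
   path_image c2 \<inter> inside (path_image c1 \<union> path_image c3) \<noteq> {} \<or>
   path_image c1 \<inter> inside (path_image c2 \<union> path_image c3) \<noteq> {}"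
proof (rule ccontr)
  let ?I = "\<lambda>c d. inside (path_image c \<union> path_image d)"
  assume "\<not> ?thesis"
  then have n: "path_image c3 \<inter> ?I c1 c2 = {}" "path_image c2 \<inter> ?I c1 c3 = {}"
    "path_image c1 \<inter> ?I c2 c3 = {}" by simp_all
  note J12 = Jordan_arcs[OF arcs(1,2) ends(1-4) meet(1)]
  note J13 = Jordan_arcs[OF arcs(1,3) ends(1,2,5,6) meet(2)]
  note J23 = Jordan_arcs[OF arcs(2,3) ends(3-6) meet(3)]
  let ?X = "path_image c1 \<union> path_image c2 \<union> path_image c3"
  have nz: "?I c d \<inter> (path_image c \<union> path_image d) = {}" for c d :: "real \<Rightarrow> complex"
    by (rule inside_no_overlap)
  \<comment> \<open>If no arc enters them, the three insides are faces of the whole theta graph.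
    Their frontiers tell the first from the other two, so a point inside the first closed curve lies
    outside both others.\<close>
  have c12: "?I c1 c2 \<in> components (- ?X)" proof (rule in_components_Compl[OF J12(3,1)])
    show "frontier (?I c1 c2) \<subseteq> ?X" unfolding J12(9) by auto
    show "?I c1 c2 \<inter> ?X = {}" using n(1) nz[of c1 c2] by blast
  qed
  have c13: "?I c1 c3 \<in> components (- ?X)" proof (rule in_components_Compl[OF J13(3,1)])
    show "frontier (?I c1 c3) \<subseteq> ?X" unfolding J13(9) by auto
    show "?I c1 c3 \<inter> ?X = {}" using n(2) nz[of c1 c3] by blast
  qed
  have c23: "?I c2 c3 \<in> components (- ?X)" proof (rule in_components_Compl[OF J23(3,1)])
    show "frontier (?I c2 c3) \<subseteq> ?X" unfolding J23(9) by auto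
    show "?I c2 c3 \<inter> ?X = {}" using n(3) nz[of c2 c3] by blast
  qed
  obtain x where x: "x \<in> path_image c2" "x \<noteq> a" "x \<noteq> b" using arc_interior_nonempty[OF arcs(2)] ends by auto
  have x': "x \<notin> path_image c1 \<union> path_image c3" using meet x by auto
  obtain y where y: "y \<in> path_image c1" "y \<noteq> a" "y \<noteq> b" using arc_interior_nonempty[OF arcs(1)] ends by auto
  have y': "y \<notin> path_image c2 \<union> path_image c3" using meet y by auto
  have "x \<notin> frontier (?I c1 c3)" "y \<notin> frontier (?I c2 c3)" unfolding J13(9) J23(9) using x' y' by auto
  moreover have "x \<in> frontier (?I c1 c2)" "y \<in> frontier (?I c1 c2)" unfolding J12(9) using x y by auto
  ultimately have "?I c1 c2 \<noteq> ?I c1 c3" "?I c1 c2 \<noteq> ?I c2 c3" by metis+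
  then have d: "?I c1 c2 \<inter> ?I c1 c3 = {}" "?I c1 c2 \<inter> ?I c2 c3 = {}"
    using components_nonoverlap[OF c12 c13] components_nonoverlap[OF c12 c23] by simp_all
  obtain z where z: "z \<in> ?I c1 c2" using J12(1) by blast
  have zX: "z \<notin> ?X" using z in_components_subset[OF c12] by blast
  then have zn: "z \<notin> path_image c1 \<union> path_image c2" "z \<notin> path_image c1 \<union> path_image c3" "z \<notin> path_image c2 \<union> path_image c3"
    by simp_all
  have "z \<notin> ?I c1 c3" "z \<notin> ?I c2 c3" using z d by blast+
  then have "winding_number c1 z \<noteq> winding_number c2 z"
    "winding_number c1 z = winding_number c3 z" "winding_number c2 z = winding_number c3 z"
    using winding_number_arcs[OF arcs(1,2) ends(1-4) meet(1) zn(1)]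
      winding_number_arcs[OF arcs(1,3) ends(1,2,5,6) meet(2) zn(2)]
      winding_number_arcs[OF arcs(2,3) ends(3-6) meet(3) zn(3)] z by metis+
  then show False by simp
qed

lemma three_faces: has_three_faces
proof -
  interpret t132: theta c1 c3 c2 a b
    using arcs ends meet by unfold_locales auto
  interpret t231: theta c2 c3 c1 a b
    using arcs ends meet by unfold_locales auto
  from some_arc_inside consider
      "path_image c3 \<inter> inside (path_image c1 \<union> path_image c2) \<noteq> {}"
    | "path_image c2 \<inter> inside (path_image c1 \<union> path_image c3) \<noteq> {}"
    | "path_image c1 \<inter> inside (path_image c2 \<union> path_image c3) \<noteq> {}" by blast
  then show ?thesis
  proof cases
    case 1 then show ?thesis by (rule inside_case)
  next
    case 2
    from t132.inside_case[OF 2] show ?thesis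
      unfolding has_three_faces_def t132.has_three_faces_def
      by (metis Un_commute Un_left_commute insert_commute)
  next
    case 3
    from t231.inside_case[OF 3] obtain D23 D12 D13 where
      D: "components (- (path_image c2 \<union> path_image c3 \<union> path_image c1)) = {D23, D12, D13}"
      "frontier D23 = path_image c2 \<union> path_image c3"
      "frontier D12 = path_image c2 \<union> path_image c1" "frontier D13 = path_image c3 \<union> path_image c1"
      unfolding t231.has_three_faces_def by metis
    have "path_image c2 \<union> path_image c3 \<union> path_image c1 = path_image c1 \<union> path_image c2 \<union> path_image c3"
      "{D23, D12, D13} = {D12, D13, D23}" by auto
    with D show ?thesis unfolding has_three_faces_def by (metis Un_commute)
  qed
qed

end

section \<open>Paths, cycles and face systems\<close>

fun path_edges :: "'a list \<Rightarrow> 'a set set" where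
  "path_edges (x # y # zs) = insert {x, y} (path_edges (y # zs))"
| "path_edges _ = {}"

definition cycle_edges :: "'a list \<Rightarrow> 'a set set" where
  "cycle_edges xs = path_edges (xs @ [hd xs])"

definition is_cycle :: "'a set set \<Rightarrow> bool" where
  "is_cycle Z \<longleftrightarrow> (\<exists>xs. distinct xs \<and> 3 \<le> length xs \<and> Z = cycle_edges xs)"

definition incident :: "'a \<Rightarrow> 'a set set \<Rightarrow> 'a set set" where
  "incident v Z = {e \<in> Z. v \<in> e}"

lemma incident_Un: "incident v (A \<union> B) = incident v A \<union> incident v B"
  by (auto simp: incident_def)

lemma incident_empty_iff: "incident v Z = {} \<longleftrightarrow> v \<notin> \<Union>Z"
  by (auto simp: incident_def)

lemma finite_path_edges [simp]: "finite (path_edges xs)"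
  by (induction xs rule: path_edges.induct) auto

lemma path_edges_append: "path_edges (xs @ y # ys) = path_edges (xs @ [y]) \<union> path_edges (y # ys)"
  by (induction xs rule: path_edges.induct) auto

lemma path_edges_snoc2: "path_edges (xs @ [y, z]) = insert {y, z} (path_edges (xs @ [y]))"
  using path_edges_append[of xs y "[z]"] by simp

lemma path_edges_rev: "path_edges (rev xs) = path_edges xs"
  by (induction xs rule: path_edges.induct) (auto simp: path_edges_snoc2 insert_commute)

lemma path_edges_subset: "e \<in> path_edges xs \<Longrightarrow> e \<subseteq> set xs"
  by (induction xs rule: path_edges.induct) auto

lemma Union_path_edges: "2 \<le> length xs \<Longrightarrow> \<Union>(path_edges xs) = set xs"
proof (induction xs rule: path_edges.induct)
  case (1 x y zs)
  then show ?case by (cases zs) auto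
qed auto

lemma card_path_edges: "distinct xs \<Longrightarrow> card (path_edges xs) = length xs - 1"
proof (induction xs rule: path_edges.induct)
  case (1 x y zs)
  have "{x, y} \<notin> path_edges (y # zs)" using path_edges_subset[of "{x,y}" "y # zs"] 1 by auto
  then show ?case using 1 by simp
qed auto

lemma incident_path_first:
  assumes "distinct (x # y # zs)"
  shows "incident x (path_edges (x # y # zs)) = {{x, y}}"
  using assms path_edges_subset[of _ "y # zs"] by (auto simp: incident_def)

lemma incident_path_last:
  assumes "distinct (xs @ [y, x])"
  shows "incident x (path_edges (xs @ [y, x])) = {{x, y}}"
proof -
  have "distinct (x # y # rev xs)" using assms by auto
  from incident_path_first[OF this] show ?thesis
    using path_edges_rev[of "xs @ [y, x]"] by simp
qed

lemma incident_path_notin: "x \<notin> set xs \<Longrightarrow> incident x (path_edges xs) = {}"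
  using path_edges_subset by (fastforce simp: incident_def)

lemma path_edge_card: "distinct xs \<Longrightarrow> e \<in> path_edges xs \<Longrightarrow> card e = 2"
  by (induction xs rule: path_edges.induct) auto

text \<open>A cycle cut at two of its vertices: one path runs from \<open>u\<close> to
  \<open>v\<close> through \<open>as\<close>, the other back from \<open>v\<close> to
  \<open>u\<close> through \<open>bs\<close>. The condition \<open>as @ bs \<noteq> []\<close>
  excludes the degenerate case in which both paths are the single edge between \<open>u\<close> and
  \<open>v\<close>.\<close>

definition splits :: "'a set set \<Rightarrow> 'a \<Rightarrow> 'a list \<Rightarrow> 'a \<Rightarrow> 'a list \<Rightarrow> bool" where
  "splits Z u as v bs \<longleftrightarrow> distinct (u # as @ v # bs) \<and> as @ bs \<noteq> [] \<and>
     Z = path_edges (u # as @ [v]) \<union> path_edges (v # bs @ [u])"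

lemma cycle_edges_eq: "cycle_edges (u # as @ v # bs) = path_edges (u # as @ [v]) \<union> path_edges (v # bs @ [u])"
  using path_edges_append[of "u # as" v "bs @ [u]"] by (simp add: cycle_edges_def)

lemma splits_is_cycle: "splits Z u as v bs \<Longrightarrow> is_cycle Z"
  unfolding splits_def is_cycle_def
  by (intro exI[of _ "u # as @ v # bs"]) (auto simp: cycle_edges_eq Suc_le_eq)

lemma cycle_rotate: "cycle_edges (xs @ ys) = cycle_edges (ys @ xs)"
proof (cases "xs = [] \<or> ys = []")
  case False
  then obtain u as v bs where "xs = u # as" "ys = v # bs" by (meson neq_Nil_conv)
  then show ?thesis using cycle_edges_eq[of u as v bs] cycle_edges_eq[of v bs u as] by auto
qed auto

lemma Union_cycle_edges: "2 \<le> length xs \<Longrightarrow> \<Union>(cycle_edges xs) = set xs"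
  unfolding cycle_edges_def by (cases xs) (simp_all add: Union_path_edges insert_absorb)

lemma is_cycle_nonempty: "is_cycle Z \<Longrightarrow> Z \<noteq> {}"
  unfolding is_cycle_def using Union_cycle_edges
  by (metis Sup_empty eval_nat_numeral(3) le_trans lessI less_imp_le_nat list.size(3) not_numeral_le_zero set_empty)

lemma cycle_splits:
  assumes "is_cycle Z" "u \<in> \<Union>Z" "v \<in> \<Union>Z" "u \<noteq> v"
  obtains as bs where "splits Z u as v bs"
proof -
  obtain xs where xs: "distinct xs" "3 \<le> length xs" "Z = cycle_edges xs"
    using assms unfolding is_cycle_def by auto
  have U: "\<Union>Z = set xs" using Union_cycle_edges[of xs] xs by simp
  obtain p q where pq: "xs = p @ u # q" using assms(2) U by (metis split_list)
  have Z: "Z = cycle_edges (u # q @ p)" using xs(3) pq cycle_rotate[of p "u # q"] by simp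
  have d: "distinct (u # q @ p)" using xs(1) pq by auto
  have "v \<in> set (q @ p)" using assms(3,4) U pq by auto
  then obtain as bs where ab: "q @ p = as @ v # bs" by (metis split_list)
  have "length (as @ v # bs) \<ge> 2" unfolding ab[symmetric] using xs(2) pq by simp
  then have "as @ bs \<noteq> []" by auto
  then have "splits Z u as v bs" unfolding splits_def using d ab Z cycle_edges_eq[of u as v bs] by auto
  then show thesis by (rule that)
qed

text \<open>The paths share only the vertices \<open>u\<close> and \<open>v\<close>, so a common
  edge could only join these two. It would then be the first edge of both paths, leaving
  \<open>as\<close> and \<open>bs\<close> empty.\<close>

lemma splits_disjoint:
  assumes "splits Z u as v bs"
  shows "path_edges (u # as @ [v]) \<inter> path_edges (v # bs @ [u]) = {}"
proof (rule ccontr)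
  assume "\<not> ?thesis"
  then obtain e where e: "e \<in> path_edges (u # as @ [v])" "e \<in> path_edges (v # bs @ [u])" by blast
  have d: "distinct (u # as @ [v])" "distinct (v # bs @ [u])" "set as \<inter> set bs = {}" "u \<notin> set as \<union> set bs" "v \<notin> set as \<union> set bs" "u \<noteq> v"
    using assms unfolding splits_def by auto
  have c: "card e = 2" using path_edge_card[OF d(1) e(1)] .
  have "e \<subseteq> insert u (insert v (set as))" "e \<subseteq> insert u (insert v (set bs))"
    using path_edges_subset[OF e(1)] path_edges_subset[OF e(2)] by auto
  then have "e \<subseteq> {u, v}" using d(3) by blast
  moreover have "card e = card {u, v}" using c d(6) by simp
  ultimately have ee: "e = {u, v}" using card_subset_eq[of "{u, v}" e] by blast
  have "as = []"
  proof (rule ccontr)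
    assume "as \<noteq> []"
    then obtain y ys where y: "as = y # ys" by (meson neq_Nil_conv)
    then have "incident u (path_edges (u # as @ [v])) = {{u, y}}"
      using incident_path_first[of u y "ys @ [v]"] d(1) by simp
    moreover have "e \<in> incident u (path_edges (u # as @ [v]))" unfolding incident_def by (simp only: mem_Collect_eq e(1)) (simp add: ee)
    ultimately have "e \<in> {{u, y}}" by (simp only:)
    then have "{u, v} = {u, y}" unfolding ee by (simp only: singleton_iff)
    then have "v = y" using d(6) by (simp add: doubleton_eq_iff)
    then show False using d(5) y by simp
  qed
  moreover have "bs = []"
  proof (rule ccontr)
    assume "bs \<noteq> []"
    then obtain y ys where y: "bs = y # ys" by (meson neq_Nil_conv)
    then have "incident v (path_edges (v # bs @ [u])) = {{v, y}}"
      using incident_path_first[of v y "ys @ [u]"] d(2) by simp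
    moreover have "e \<in> incident v (path_edges (v # bs @ [u]))" unfolding incident_def by (simp only: mem_Collect_eq e(2)) (simp add: ee)
    ultimately have "e \<in> {{v, y}}" by (simp only:)
    then have "{u, v} = {v, y}" unfolding ee by (simp only: singleton_iff)
    then have "u = y" using d(6) by (simp add: doubleton_eq_iff)
    then show False using d(4) y by simp
  qed
  ultimately show False using assms by (simp add: splits_def)
qed

lemma incident_path_end:
  assumes "distinct (u # as @ [v])"
  shows "\<exists>w. incident u (path_edges (u # as @ [v])) = {{u, w}}" "\<exists>w. incident v (path_edges (u # as @ [v])) = {{v, w}}"
proof -
  show "\<exists>w. incident u (path_edges (u # as @ [v])) = {{u, w}}"
    using incident_path_first[of u v "[]"] incident_path_first[of u "hd as" "tl as @ [v]"] assms by (cases as) auto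
  show "\<exists>w. incident v (path_edges (u # as @ [v])) = {{v, w}}"
  proof (cases as rule: rev_cases)
    case Nil then show ?thesis using incident_path_last[of "[]" u v] assms by auto
  next
    case (snoc zs z) then show ?thesis using incident_path_last[of "u # zs" z v] assms by auto
  qed
qed

lemma cycle_incident:
  assumes "is_cycle Z" "v \<in> \<Union>Z"
  shows "card (incident v Z) = 2"
proof -
  have "\<exists>u\<in>\<Union>Z. u \<noteq> v"
  proof -
    obtain xs where xs: "distinct xs" "3 \<le> length xs" "Z = cycle_edges xs"
      using assms unfolding is_cycle_def by auto
    then have "card (\<Union>Z) \<ge> 3" using Union_cycle_edges[of xs] distinct_card by fastforce
    then have "\<not> \<Union>Z \<subseteq> {v}" using card_mono[of "{v}" "\<Union>Z"] by fastforce
    then show ?thesis by auto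
  qed
  then obtain u where "u \<in> \<Union>Z" "u \<noteq> v" by auto
  then obtain as bs where s: "splits Z v as u bs" using cycle_splits[OF assms(1,2)] by metis
  then have d: "distinct (v # as @ [u])" "distinct (u # bs @ [v])" by (auto simp: splits_def)
  obtain w where w: "incident v (path_edges (v # as @ [u])) = {{v, w}}" using incident_path_end(1)[OF d(1)] by auto
  obtain z where z: "incident v (path_edges (u # bs @ [v])) = {{v, z}}" using incident_path_end(2)[OF d(2)] by auto
  have "{v, w} \<noteq> {v, z}" using splits_disjoint[OF s] w z unfolding incident_def by blast
  moreover have "incident v Z = {{v, w}, {v, z}}" using s w z by (auto simp: splits_def incident_Un)
  ultimately show ?thesis by simp
qed

text \<open>
  A combinatorial closed surface with Euler characteristic 2, given by the boundary cycles of its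
  faces. The last condition says that the link of every vertex is connected, so that no vertex is
  a pinch point.
\<close>

definition face_system :: "'a set set \<Rightarrow> 'f set \<Rightarrow> ('f \<Rightarrow> 'a set set) \<Rightarrow> bool" where
  "face_system M F bd \<longleftrightarrow>
     finite F \<and> finite M \<and> (\<forall>e\<in>M. finite e) \<and>
     (\<forall>f\<in>F. is_cycle (bd f) \<and> bd f \<subseteq> M) \<and>
     (\<forall>e\<in>M. card {f \<in> F. e \<in> bd f} = 2) \<and>
     card F + card (\<Union>M) = card M + 2 \<and>
     (\<forall>v S. S \<subseteq> incident v M \<longrightarrow> S \<noteq> {} \<longrightarrow> S \<noteq> incident v M \<longrightarrow>
        (\<exists>f\<in>F. \<exists>d\<in>bd f. \<exists>e\<in>bd f. d \<in> S \<and> e \<in> incident v M \<and> e \<notin> S))"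

section \<open>Adding ears to a face system\<close>

lemma face_system_cycle:
  assumes "is_cycle Z" "C1 \<noteq> C2" "bd C1 = Z" "bd C2 = Z"
  shows "face_system Z {C1, C2} bd"
proof -
  obtain xs where xs: "distinct xs" "3 \<le> length xs" "Z = cycle_edges xs"
    using assms unfolding is_cycle_def by auto
  have U: "\<Union>Z = set xs" using Union_cycle_edges[of xs] xs by simp
  obtain u v ys where uv: "xs = u # v # ys" using xs(2) by (cases xs; cases "tl xs") auto
  have ys: "ys \<noteq> []" using xs(2) uv by auto
  have Z: "Z = path_edges [u, v] \<union> path_edges (v # ys @ [u])"
    using xs(3) uv cycle_edges_eq[of u "[]" v ys] by simp
  have "splits Z u [] v ys" using Z xs(1) uv ys by (auto simp: splits_def)
  from splits_disjoint[OF this] have "card Z = card (path_edges [u, v]) + card (path_edges (v # ys @ [u]))"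
    using Z by (simp add: card_Un_disjoint)
  moreover have "distinct (v # ys @ [u])" using xs(1) uv by auto
  ultimately have "card Z = length xs" using card_path_edges[of "v # ys @ [u]"] uv by simp
  moreover have "card (\<Union>Z) = length xs" using U distinct_card xs(1) by metis
  moreover have "finite Z" unfolding Z by simp
  moreover have "card {C1, C2} = 2" using assms by simp
  moreover have "finite e" if "e \<in> Z" for e using Union_upper[OF that] unfolding U by (rule finite_subset) simp
  moreover have "card {f \<in> {C1, C2}. e \<in> bd f} = 2" if "e \<in> Z" for e
  proof -
    have "{f \<in> {C1, C2}. e \<in> bd f} = {C1, C2}" using that assms by auto
    then show ?thesis using assms by simp
  qed
  ultimately show ?thesis unfolding face_system_def using assms
    by (auto simp: incident_def)
qed

text \<open>An ear with n inner vertices brings n vertices, n + 1 edges and one more face, so the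
  Euler count is preserved. In the link of an end of the ear, the adjacency of the two edges of
  \<open>bd C\<close> is subdivided by the new edge, which shares \<open>C1\<close> with one of them
  and \<open>C2\<close> with the other.\<close>

lemma face_system_ear:
  assumes fs: "face_system M F bd" and C: "C \<in> F"
    and s: "splits (bd C) u as v bs"
    and d: "distinct (u # ps @ [v])" "set ps \<inter> \<Union>M = {}" "path_edges (u # ps @ [v]) \<inter> M = {}"
    and new: "C1 \<notin> F - {C}" "C2 \<notin> F - {C}" "C1 \<noteq> C2"
    and bd': "bd' C1 = path_edges (u # as @ [v]) \<union> path_edges (u # ps @ [v])"
      "bd' C2 = path_edges (v # bs @ [u]) \<union> path_edges (u # ps @ [v])"
      "\<And>f. f \<in> F - {C} \<Longrightarrow> bd' f = bd f"
  shows "face_system (M \<union> path_edges (u # ps @ [v])) (F - {C} \<union> {C1, C2}) bd'"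
proof -
  let ?P = "path_edges (u # ps @ [v])" and ?Q1 = "path_edges (u # as @ [v])" and ?Q2 = "path_edges (v # bs @ [u])"
  let ?F = "F - {C} \<union> {C1, C2}"
  have fin: "finite F" "finite M" "\<And>e. e \<in> M \<Longrightarrow> finite e"
    and cyc: "\<And>f. f \<in> F \<Longrightarrow> is_cycle (bd f)" "\<And>f. f \<in> F \<Longrightarrow> bd f \<subseteq> M"
    and two: "\<And>e. e \<in> M \<Longrightarrow> card {f \<in> F. e \<in> bd f} = 2"
    and euler: "card F + card (\<Union>M) = card M + 2"
    and link: "\<And>v S. S \<subseteq> incident v M \<Longrightarrow> S \<noteq> {} \<Longrightarrow> S \<noteq> incident v M \<Longrightarrow>
        \<exists>f\<in>F. \<exists>d\<in>bd f. \<exists>e\<in>bd f. d \<in> S \<and> e \<in> incident v M \<and> e \<notin> S"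
    using fs unfolding face_system_def by auto
  have bdC: "bd C = ?Q1 \<union> ?Q2" "?Q1 \<inter> ?Q2 = {}" using s splits_disjoint[OF s] by (auto simp: splits_def)
  have dd: "distinct (u # as @ v # bs)" "as @ bs \<noteq> []" using s by (auto simp: splits_def)
  have QM: "?Q1 \<subseteq> M" "?Q2 \<subseteq> M" using cyc(2)[OF C] bdC by auto
  have UQ: "\<Union>?Q1 = set (u # as @ [v])" "\<Union>?Q2 = set (v # bs @ [u])" "\<Union>?P = set (u # ps @ [v])"
    by (rule Union_path_edges; simp)+
  have uvM: "u \<in> \<Union>M" "v \<in> \<Union>M" "set as \<subseteq> \<Union>M" "set bs \<subseteq> \<Union>M"
    using Union_mono[OF QM(1)] Union_mono[OF QM(2)] unfolding UQ by auto
  have PQ: "?P \<inter> ?Q1 = {}" "?P \<inter> ?Q2 = {}" using d(3) QM by auto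
  have cyc1: "is_cycle (bd' C1)"
  proof (rule splits_is_cycle)
    \<comment> \<open>If both were empty, the ear would be the edge from \<open>u\<close> to
      \<open>v\<close> that already belongs to \<open>bd C\<close>.\<close>
    have "ps @ as \<noteq> []"
    proof
      assume "ps @ as = []"
      then show False using PQ by auto
    qed
    moreover have "path_edges (v # rev ps @ [u]) = ?P" using path_edges_rev[of "u # ps @ [v]"] by simp
    moreover have "distinct (u # as @ v # rev ps)" using d(1,2) dd uvM by auto
    ultimately show "splits (bd' C1) u as v (rev ps)" unfolding splits_def bd'(1) by auto
  qed
  have cyc2: "is_cycle (bd' C2)"
  proof (rule splits_is_cycle)
    have "bs @ ps \<noteq> []"
    proof
      assume "bs @ ps = []"
      then show False using PQ by (auto simp: insert_commute)
    qed
    moreover have "distinct (v # bs @ u # ps)" using d(1,2) dd uvM by auto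
    ultimately show "splits (bd' C2) v bs u ps" unfolding splits_def bd'(2) by auto
  qed
  have sub: "bd' f \<subseteq> M \<union> ?P" "is_cycle (bd' f)" if "f \<in> ?F" for f
    using that cyc1 cyc2 cyc[of f] bd' QM by auto
  have cardF: "card ?F = card F + 1"
  proof -
    have "card ?F = card (F - {C}) + card {C1, C2}" by (intro card_Un_disjoint) (use new fin in auto)
    then show ?thesis using C fin(1) new(3) card_Suc_Diff1[OF fin(1) C] by simp
  qed
  have cardM: "card (M \<union> ?P) = card M + (length ps + 1)"
    using d(3) fin(2) card_path_edges[OF d(1)] by (subst card_Un_disjoint) auto
  have cardV: "card (\<Union>(M \<union> ?P)) = card (\<Union>M) + length ps"
  proof -
    have "\<Union>(M \<union> ?P) = \<Union>M \<union> set ps" using UQ(3) uvM by auto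
    moreover have "finite (\<Union>M)" using fin by auto
    ultimately show ?thesis using d(1,2) distinct_card[of ps] by (subst \<open>\<Union>(M \<union> ?P) = _\<close>, subst card_Un_disjoint) auto
  qed
  have two': "card {f \<in> ?F. e \<in> bd' f} = 2" if e: "e \<in> M \<union> ?P" for e
  proof (cases "e \<in> ?P")
    case True
    then have "e \<notin> M" using d(3) by auto
    have "{f \<in> ?F. e \<in> bd' f} = {C1, C2}"
    proof (intro equalityI subsetI)
      fix f assume "f \<in> {f \<in> ?F. e \<in> bd' f}"
      then show "f \<in> {C1, C2}" using bd'(3)[of f] cyc(2)[of f] \<open>e \<notin> M\<close> by auto
    qed (use True bd' in auto)
    then show ?thesis using new(3) by simp
  next
    case False
    then have eM: "e \<in> M" using e by auto
    let ?A = "{f \<in> F. e \<in> bd f}"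
    have finA: "finite ?A" using fin by auto
    show ?thesis
    proof (cases "e \<in> bd C")
      case False
      then have "{f \<in> ?F. e \<in> bd' f} = ?A" using bd' bdC \<open>e \<notin> ?P\<close> C new by auto
      then show ?thesis using two[OF eM] by simp
    next
      case True
      have CA: "C \<in> ?A" using True C by auto
      have cA: "card (?A - {C}) = 1" using two[OF eM] CA finA by simp
      have "\<exists>D. D \<in> {C1, C2} \<and> {f \<in> ?F. e \<in> bd' f} = insert D (?A - {C})"
      proof (cases "e \<in> ?Q1")
        case True
        then have "e \<notin> ?Q2" using bdC(2) by auto
        then have "{f \<in> ?F. e \<in> bd' f} = insert C1 (?A - {C})" using True bd' \<open>e \<notin> ?P\<close> new by auto
        then show ?thesis by auto
      next
        case False
        then have "e \<in> ?Q2" using True bdC(1) by auto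
        then have "{f \<in> ?F. e \<in> bd' f} = insert C2 (?A - {C})" using False bd' \<open>e \<notin> ?P\<close> new by auto
        then show ?thesis by auto
      qed
      then obtain D where D: "D \<in> {C1, C2}" "{f \<in> ?F. e \<in> bd' f} = insert D (?A - {C})" by blast
      have "D \<notin> ?A - {C}" using D(1) new by auto
      then show ?thesis unfolding D(2) using cA finA by simp
    qed
  qed
  have uv: "u \<noteq> v" using d(1) by auto
  have dQ: "distinct (u # as @ [v])" "distinct (v # bs @ [u])" using dd by auto
  have link': "\<exists>f\<in>?F. \<exists>d\<in>bd' f. \<exists>e\<in>bd' f. d \<in> S \<and> e \<in> incident x (M \<union> ?P) \<and> e \<notin> S"
    if S: "S \<subseteq> incident x (M \<union> ?P)" "S \<noteq> {}" "S \<noteq> incident x (M \<union> ?P)" for x S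
  proof -
    obtain d0 e0 where de0: "d0 \<in> S" "e0 \<in> incident x (M \<union> ?P)" "e0 \<notin> S" "d0 \<in> incident x (M \<union> ?P)"
      using S by blast
    have fin1: ?thesis if "D \<in> {C1, C2}" "d \<in> bd' D" "e \<in> bd' D" "d \<in> S" "e \<in> incident x (M \<union> ?P)" "e \<notin> S" for D d e
    proof -
      have "D \<in> ?F" using that(1) by (rule UnI2)
      then show ?thesis using that(2-6) by blast
    qed
    consider "x \<in> set ps" | "x \<notin> set (u # ps @ [v])" | "x = u \<or> x = v" by auto
    then show ?thesis
    proof cases
      case 1
      then have "x \<notin> \<Union>M" using d(2) by blast
      then have "incident x M = {}" by (simp add: incident_empty_iff)
      then have "incident x (M \<union> ?P) \<subseteq> ?P" unfolding incident_Un by (auto simp: incident_def)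
      then have "d0 \<in> bd' C1" "e0 \<in> bd' C1" unfolding bd'(1) using de0(2,4) by blast+
      then show ?thesis using de0 by (intro fin1[of C1 d0 e0]) simp_all
    next
      case 2
      then have inc: "incident x (M \<union> ?P) = incident x M" by (simp add: incident_Un incident_path_notin)
      obtain f d1 e1 where f: "f \<in> F" "d1 \<in> bd f" "e1 \<in> bd f" "d1 \<in> S" "e1 \<in> incident x M" "e1 \<notin> S"
        using link[of S x] S unfolding inc by blast
      show ?thesis
      proof (cases "f = C")
        case False
        then have "f \<in> ?F" "bd' f = bd f" using f(1) bd'(3) by auto
        then show ?thesis unfolding inc using f by blast
      next
        case True
        have x1: "x \<in> d1" "x \<in> e1" using f S(1) unfolding inc by (auto simp: incident_def)
        show ?thesis
        proof (cases "x \<in> set as")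
          case True
          then have "incident x ?Q2 = {}" using 2 dd by (intro incident_path_notin) auto
          then have "d1 \<notin> ?Q2" "e1 \<notin> ?Q2" using x1 unfolding incident_def by blast+
          then have "d1 \<in> bd' C1" "e1 \<in> bd' C1" using f(2,3) \<open>f = C\<close> bdC(1) unfolding bd'(1) by blast+
          then show ?thesis using f by (intro fin1[of C1 d1 e1]) (simp_all add: inc)
        next
          case False
          then have "incident x ?Q1 = {}" using 2 dd by (intro incident_path_notin) auto
          then have "d1 \<notin> ?Q1" "e1 \<notin> ?Q1" using x1 unfolding incident_def by blast+
          then have "d1 \<in> bd' C2" "e1 \<in> bd' C2" using f(2,3) \<open>f = C\<close> bdC(1) unfolding bd'(2) by blast+
          then show ?thesis using f by (intro fin1[of C2 d1 e1]) (simp_all add: inc)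
        qed
      qed
    next
      case 3
      obtain g e1 e2 where g: "incident x ?P = {g}" "incident x ?Q1 = {e1}" "incident x ?Q2 = {e2}"
      proof -
        have "\<exists>g. incident x ?P = {g}" using 3 incident_path_end[OF d(1)] by auto
        moreover have "\<exists>g. incident x ?Q1 = {g}" using 3 incident_path_end[OF dQ(1)] by auto
        moreover have "\<exists>g. incident x ?Q2 = {g}" using 3 incident_path_end[OF dQ(2)] by auto
        ultimately show thesis using that by auto
      qed
      have inc: "incident x (M \<union> ?P) = insert g (incident x M)" by (simp add: incident_Un g(1))
      have mem: "g \<in> incident x ?P" "e1 \<in> incident x ?Q1" "e2 \<in> incident x ?Q2" unfolding g by (rule singletonI)+
      then have gm: "g \<in> ?P" "e1 \<in> ?Q1" "e2 \<in> ?Q2" "x \<in> e1" "x \<in> e2" unfolding incident_def by blast+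
      have em: "e1 \<in> incident x M" "e2 \<in> incident x M" unfolding incident_def using gm QM by blast+
      have gM: "g \<notin> M" using gm d(3) by blast
      have b: "g \<in> bd' C1" "e1 \<in> bd' C1" "g \<in> bd' C2" "e2 \<in> bd' C2" unfolding bd' using gm by blast+
      have done1: ?thesis if "(g \<in> S) \<noteq> (e1 \<in> S)"
        using that fin1[of C1 g e1] fin1[of C1 e1 g] b em unfolding inc by blast
      have done2: ?thesis if "(g \<in> S) \<noteq> (e2 \<in> S)"
        using that fin1[of C2 g e2] fin1[of C2 e2 g] b em unfolding inc by blast
      show ?thesis
      proof (cases "S \<inter> incident x M = {} \<or> incident x M \<subseteq> S")
        case True
        \<comment> \<open>Here either \<open>S\<close> or its complement among the edges at
          \<open>x\<close> consists of the new edge \<open>g\<close> alone.\<close>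
        then have "(g \<in> S) \<noteq> (e1 \<in> S)" using de0 em unfolding inc by blast
        then show ?thesis by (rule done1)
      next
        case False
        then have "S \<inter> incident x M \<noteq> {}" "S \<inter> incident x M \<noteq> incident x M" by blast+
        then obtain f d1 c1 where f: "f \<in> F" "d1 \<in> bd f" "c1 \<in> bd f" "d1 \<in> S \<inter> incident x M" "c1 \<in> incident x M" "c1 \<notin> S \<inter> incident x M"
          using link[of "S \<inter> incident x M" x] by blast
        show ?thesis
        proof (cases "f = C")
          case False
          then have "f \<in> ?F" "bd' f = bd f" using f(1) bd'(3) by auto
          then show ?thesis unfolding inc using f by blast
        next
          case True
          have *: "e = e1 \<or> e = e2" if "e \<in> bd C" "e \<in> incident x M" for e
          proof -
            have "e \<in> incident x ?Q1 \<or> e \<in> incident x ?Q2" using that bdC(1) unfolding incident_def by blast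
            then show ?thesis unfolding g by simp
          qed
          \<comment> \<open>The only adjacency lost with \<open>C\<close> is that of
            \<open>e1\<close> and \<open>e2\<close>. Both are now adjacent to \<open>g\<close>, and
            \<open>S\<close> separates \<open>g\<close> from one of them.\<close>
          have "(e1 \<in> S) \<noteq> (e2 \<in> S)" using f *[of d1] *[of c1] True by blast
          then show ?thesis using done1 done2 by blast
        qed
      qed
    qed
  qed
  have "finite e" if "e \<in> ?P" for e using path_edges_subset[OF that] finite_subset by blast
  then show ?thesis unfolding face_system_def
  proof (intro conjI ballI allI impI)
    show "card ?F + card (\<Union>(M \<union> ?P)) = card (M \<union> ?P) + 2"
      using cardF cardM cardV euler by linarith
    show "finite ?F" "finite (M \<union> ?P)" using fin by auto
  next
    fix e assume "\<And>e. e \<in> ?P \<Longrightarrow> finite e" "e \<in> M \<union> ?P"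
    then show "finite e" using fin(3) by blast
  next
    fix f assume "f \<in> ?F"
    then show "is_cycle (bd' f)" "bd' f \<subseteq> M \<union> ?P" using sub by blast+
  next
    fix e assume "e \<in> M \<union> ?P"
    then show "card {f \<in> ?F. e \<in> bd' f} = 2" by (rule two')
  next
    fix x S assume "S \<subseteq> incident x (M \<union> ?P)" "S \<noteq> {}" "S \<noteq> incident x (M \<union> ?P)"
    then show "\<exists>f\<in>?F. \<exists>d\<in>bd' f. \<exists>e\<in>bd' f. d \<in> S \<and> e \<in> incident x (M \<union> ?P) \<and> e \<notin> S" by (rule link')
  qed
qed

text \<open>Counts oriented edges. Applied to all edges it gives the degree sum; applied to the
  external edges of one face it gives the number of ends among which the weight of that face is
  shared.\<close>

lemma card_darts:
  assumes "finite M" "\<And>e. e \<in> M \<Longrightarrow> \<exists>u v. e = {u, v} \<and> u \<noteq> v"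
  shows "finite {(v, x). {v, x} \<in> M}" "card {(v, x). {v, x} \<in> M} = 2 * card M"
proof -
  have one: "finite {(v, x). {v, x} = e} \<and> card {(v, x). {v, x} = e} = 2" if e: "e \<in> M" for e
  proof -
    obtain u v where uv: "e = {u, v}" "u \<noteq> v" using assms(2)[OF e] by auto
    have "{(a, b). {a, b} = e} = {(u, v), (v, u)}" unfolding uv(1) by (auto simp: doubleton_eq_iff)
    then show ?thesis using uv(2) by simp
  qed
  have eq: "{(v, x). {v, x} \<in> M} = (\<Union>e\<in>M. {(v, x). {v, x} = e})" by auto
  show "finite {(v, x). {v, x} \<in> M}" unfolding eq using assms(1) one by (intro finite_UN_I) simp_all
  have "card (\<Union>e\<in>M. {(v, x). {v, x} = e}) = (\<Sum>e\<in>M. card {(v, x). {v, x} = e})"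
    using assms(1) one by (intro card_UN_disjoint) auto
  also have "\<dots> = (\<Sum>e\<in>M. 2)" using one by (intro sum.cong) simp_all
  finally show "card {(v, x). {v, x} \<in> M} = 2 * card M" unfolding eq by simp
qed

section \<open>Faces of plane graphs\<close>

lemma arc_interior_subset: "arc_interior g \<subseteq> path_image g"
  by (auto simp: arc_interior_def)

lemma path_image_arc_interior:
  "path_image g = arc_interior g \<union> {pathstart g, pathfinish g}"
  by (auto simp: arc_interior_def)

lemma connected_arc_interior: "arc g \<Longrightarrow> connected (arc_interior g)"
  unfolding arc_interior_def by (simp add: arc_imp_simple_path connected_simple_path_endless)

text \<open>A connected set with more than one point has no isolated points, and removing the two
  ends destroys no limit point. It is used to pass from the interior of an edge to the vertices at
  its ends.\<close>

lemma closure_arc_interior: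
  assumes "arc g"
  shows "path_image g \<subseteq> closure (arc_interior g)"
proof
  fix x assume x: "x \<in> path_image g"
  have "connected (path_image g)" using assms by (simp add: connected_arc_image)
  moreover have "path_image g \<noteq> {y}" for y
    using arc_distinct_ends[OF assms] pathstart_in_path_image[of g] pathfinish_in_path_image[of g] by (metis singletonD)
  ultimately have "x islimpt path_image g" using x connected_imp_perfect by blast
  then have "x islimpt (insert (pathstart g) (insert (pathfinish g) (arc_interior g)))"
    unfolding path_image_arc_interior by (simp add: insert_commute Un_commute)
  then have "x islimpt arc_interior g" by (simp add: islimpt_insert)
  then show "x \<in> closure (arc_interior g)" by (simp add: closure_def)
qed

lemma connected_subset_component:
  fixes X :: "'a::topological_space set"
  assumes "C \<in> components S" "connected T" "T \<subseteq> S" "T \<inter> C \<noteq> {}"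
  shows "T \<subseteq> C"
  using assms by (metis Int_commute components_maximal)

lemma edge_meets_prefix: "e \<in> path_edges (qs @ [x]) \<Longrightarrow> e \<inter> set qs \<noteq> {}"
proof (induction qs)
  case (Cons q qs)
  then show ?case by (cases qs) auto
qed simp

text \<open>Connectivity is stated through vertex sets closed under adjacency, because it is always
  applied to show that some set of vertices is everything. The empty set counts as
  connected.\<close>

definition connected_on :: "'a set set \<Rightarrow> 'a set \<Rightarrow> bool" where
  "connected_on E W \<longleftrightarrow> (\<forall>S. S \<subseteq> W \<longrightarrow> S \<noteq> {} \<longrightarrow> (\<forall>x\<in>S. \<forall>y\<in>W. {x, y} \<in> E \<longrightarrow> y \<in> S) \<longrightarrow> S = W)"

lemma connected_onD:
  assumes "connected_on E W" "S \<subseteq> W" "S \<noteq> {}" "\<And>x y. x \<in> S \<Longrightarrow> y \<in> W \<Longrightarrow> {x, y} \<in> E \<Longrightarrow> y \<in> S"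
  shows "S = W"
  using assms unfolding connected_on_def by simp

locale plane_graph =
  fixes V :: "'a set" and E :: "'a set set" and p :: "'a \<Rightarrow> complex" and \<gamma> :: "'a set \<Rightarrow> real \<Rightarrow> complex"
  assumes fin: "finite V"
    and edge: "e \<in> E \<Longrightarrow> \<exists>u v. e = {u, v} \<and> u \<in> V \<and> v \<in> V \<and> u \<noteq> v"
    and inj: "inj_on p V"
    and arc: "e \<in> E \<Longrightarrow> arc (\<gamma> e)"
    and ends: "e \<in> E \<Longrightarrow> {pathstart (\<gamma> e), pathfinish (\<gamma> e)} = p ` e"
    and interior_vertices: "e \<in> E \<Longrightarrow> arc_interior (\<gamma> e) \<inter> p ` V = {}"
    and interior_arcs: "e \<in> E \<Longrightarrow> f \<in> E \<Longrightarrow> f \<noteq> e \<Longrightarrow> arc_interior (\<gamma> e) \<inter> path_image (\<gamma> f) = {}"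
begin

definition drawing :: "'a set set \<Rightarrow> complex set" where
  "drawing M = (\<Union>e\<in>M. path_image (\<gamma> e))"

lemma drawing_Un: "drawing (A \<union> B) = drawing A \<union> drawing B"
  by (auto simp: drawing_def)

lemma drawing_mono: "A \<subseteq> B \<Longrightarrow> drawing A \<subseteq> drawing B"
  by (auto simp: drawing_def)

lemma edge_subset: "e \<in> E \<Longrightarrow> e \<subseteq> V"
  using edge by blast

lemma finite_E: "finite E"
  using finite_subset[OF subsetI finite_Pow_iff[THEN iffD2, OF fin]] PowI[OF edge_subset] by simp

lemma image_eq: "e \<in> E \<Longrightarrow> path_image (\<gamma> e) = arc_interior (\<gamma> e) \<union> p ` e"
  using path_image_arc_interior[of "\<gamma> e"] ends[of e] by simp

lemma vertex_in_image: "e \<in> E \<Longrightarrow> x \<in> V \<Longrightarrow> p x \<in> path_image (\<gamma> e) \<longleftrightarrow> x \<in> e"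
  using interior_vertices[of e] inj_on_image_mem_iff[OF inj, of x e] edge_subset[of e]
  unfolding image_eq by blast

lemma vertex_in_drawing:
  assumes "M \<subseteq> E" "x \<in> V"
  shows "p x \<in> drawing M \<longleftrightarrow> x \<in> \<Union>M"
  using assms vertex_in_image unfolding drawing_def by blast

lemma image_meet:
  assumes "e \<in> E" "f \<in> E" "e \<noteq> f"
  shows "path_image (\<gamma> e) \<inter> path_image (\<gamma> f) = p ` (e \<inter> f)"
proof -
  have "p ` e \<inter> p ` f = p ` (e \<inter> f)"
    using inj edge_subset[OF assms(1)] edge_subset[OF assms(2)] by (metis inj_on_image_Int)
  moreover have "path_image (\<gamma> e) \<inter> path_image (\<gamma> f) = p ` e \<inter> p ` f"
    using interior_arcs[of e f] interior_arcs[of f e] image_eq[of e] image_eq[of f] assms by blast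
  ultimately show ?thesis by simp
qed

lemma drawing_meet:
  assumes "A \<subseteq> E" "B \<subseteq> E" "A \<inter> B = {}"
  shows "drawing A \<inter> drawing B = p ` (\<Union>A \<inter> \<Union>B)"
proof (intro equalityI subsetI)
  fix z assume "z \<in> drawing A \<inter> drawing B"
  then obtain e f where ef: "e \<in> A" "f \<in> B" "z \<in> path_image (\<gamma> e) \<inter> path_image (\<gamma> f)"
    unfolding drawing_def by blast
  then have "z \<in> p ` (e \<inter> f)" using image_meet[of e f] assms by blast
  then show "z \<in> p ` (\<Union>A \<inter> \<Union>B)" using ef by blast
next
  fix z assume "z \<in> p ` (\<Union>A \<inter> \<Union>B)"
  then obtain x e f where "z = p x" "x \<in> e" "e \<in> A" "x \<in> f" "f \<in> B" by blast
  then show "z \<in> drawing A \<inter> drawing B"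
    using assms(1,2) vertex_in_drawing[of A x] vertex_in_drawing[of B x] edge_subset[of e] by blast
qed

text \<open>An interior point of an edge lies on no other edge, so the point set of a drawing
  determines its edges. Hence the frontier of a face can be read back as a boundary cycle.\<close>

lemma drawing_inj:
  assumes "A \<subseteq> E" "B \<subseteq> E" "drawing A \<subseteq> drawing B"
  shows "A \<subseteq> B"
proof
  fix e assume e: "e \<in> A"
  then obtain z where z: "z \<in> arc_interior (\<gamma> e)"
    using arc_interior_nonempty[of "\<gamma> e"] arc[of e] assms(1) unfolding arc_interior_def by blast
  have "z \<in> path_image (\<gamma> e)" using z arc_interior_subset by blast
  then have "z \<in> drawing B" using e assms(3) unfolding drawing_def by blast
  then obtain f where f: "f \<in> B" "z \<in> path_image (\<gamma> f)" unfolding drawing_def by blast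
  have "f = e" using interior_arcs[of e f] z f e assms by blast
  then show "e \<in> B" using f by simp
qed

lemma compact_drawing: "M \<subseteq> E \<Longrightarrow> compact (drawing M)"
  unfolding drawing_def using finite_E arc by (intro compact_UN) (auto intro: finite_subset compact_arc_image)

lemma edge_arc:
  assumes "{x, y} \<in> E"
  obtains g where "arc g" "path_image g = path_image (\<gamma> {x, y})" "pathstart g = p x" "pathfinish g = p y"
proof -
  have e: "{pathstart (\<gamma> {x, y}), pathfinish (\<gamma> {x, y})} = {p x, p y}" using ends[OF assms] by simp
  then consider "pathstart (\<gamma> {x, y}) = p x \<and> pathfinish (\<gamma> {x, y}) = p y"
    | "pathstart (\<gamma> {x, y}) = p y \<and> pathfinish (\<gamma> {x, y}) = p x" by (auto simp: doubleton_eq_iff)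
  then show thesis
  proof cases
    case 1 then show thesis using that arc[OF assms] by blast
  next
    case 2 then show thesis using that[of "reversepath (\<gamma> {x, y})"] arc[OF assms] by (simp add: arc_reversepath)
  qed
qed

lemma path_arc:
  assumes "distinct (u # xs @ [v])" "path_edges (u # xs @ [v]) \<subseteq> E"
  shows "\<exists>g. arc g \<and> path_image g = drawing (path_edges (u # xs @ [v])) \<and> pathstart g = p u \<and> pathfinish g = p v"
  using assms
proof (induction xs arbitrary: u)
  case Nil
  then have "{u, v} \<in> E" by simp
  from edge_arc[OF this] obtain g where "arc g" "path_image g = path_image (\<gamma> {u, v})" "pathstart g = p u" "pathfinish g = p v" .
  then show ?case by (intro exI[of _ g]) (simp add: drawing_def)
next
  case (Cons y ys)
  have e: "{u, y} \<in> E" "path_edges (y # ys @ [v]) \<subseteq> E" using Cons.prems by auto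
  obtain g where g: "arc g" "path_image g = drawing (path_edges (y # ys @ [v]))" "pathstart g = p y" "pathfinish g = p v"
    using Cons.IH[of y] Cons.prems e by auto
  obtain h where h: "arc h" "path_image h = path_image (\<gamma> {u, y})" "pathstart h = p u" "pathfinish h = p y"
    by (rule edge_arc[OF e(1)])
  have "u \<notin> set (y # ys @ [v])" using Cons.prems by auto
  then have n: "{u, y} \<notin> path_edges (y # ys @ [v])" using path_edges_subset[of "{u, y}"] by blast
  have U: "\<Union>(path_edges (y # ys @ [v])) = set (y # ys @ [v])" by (rule Union_path_edges) simp
  have I: "\<Union>{{u, y}} \<inter> set (y # ys @ [v]) = {y}" using Cons.prems by auto
  have "{{u, y}} \<subseteq> E" "{{u, y}} \<inter> path_edges (y # ys @ [v]) = {}" using e(1) n by auto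
  from drawing_meet[OF this(1) e(2) this(2)] have "drawing {{u, y}} \<inter> drawing (path_edges (y # ys @ [v])) = {p y}"
    unfolding U I by simp
  then have "path_image h \<inter> path_image g = {p y}" using g h by (simp add: drawing_def)
  then have "arc (h +++ g)" using g h by (intro arc_join) auto
  moreover have "path_image (h +++ g) = drawing (path_edges (u # (y # ys) @ [v]))"
    using g h by (subst path_image_join) (auto simp: drawing_def)
  ultimately show ?case using g h by (intro exI[of _ "h +++ g"]) auto
qed

lemma cycle_arcs:
  assumes "splits Z u as v bs" "Z \<subseteq> E"
  obtains g h where "arc g" "arc h" "pathstart g = p u" "pathfinish g = p v" "pathstart h = p u" "pathfinish h = p v"
    "path_image g = drawing (path_edges (u # as @ [v]))" "path_image h = drawing (path_edges (v # bs @ [u]))"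
    "path_image g \<inter> path_image h = {p u, p v}" "path_image g \<union> path_image h = drawing Z"
proof -
  have d: "distinct (u # as @ v # bs)" "Z = path_edges (u # as @ [v]) \<union> path_edges (v # bs @ [u])"
    using assms(1) by (auto simp: splits_def)
  have r: "path_edges (u # rev bs @ [v]) = path_edges (v # bs @ [u])"
    using path_edges_rev[of "v # bs @ [u]"] by simp
  have "distinct (u # as @ [v])" using d(1) by auto
  moreover have "path_edges (u # as @ [v]) \<subseteq> E" using d(2) assms(2) by blast
  ultimately obtain g where g: "arc g" "pathstart g = p u" "pathfinish g = p v" "path_image g = drawing (path_edges (u # as @ [v]))"
    using path_arc[of u as v] by blast
  have "distinct (u # rev bs @ [v])" using d(1) by auto
  moreover have "path_edges (u # rev bs @ [v]) \<subseteq> E" unfolding r using d(2) assms(2) by blast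
  ultimately obtain h where h: "arc h" "pathstart h = p u" "pathfinish h = p v" "path_image h = drawing (path_edges (v # bs @ [u]))"
    using path_arc[of u "rev bs" v] unfolding r by blast
  have U: "\<Union>(path_edges (u # as @ [v])) = set (u # as @ [v])" "\<Union>(path_edges (v # bs @ [u])) = set (v # bs @ [u])"
    by (rule Union_path_edges; simp)+
  have I: "set (u # as @ [v]) \<inter> set (v # bs @ [u]) = {u, v}" using d(1) by auto
  have "path_edges (u # as @ [v]) \<subseteq> E" "path_edges (v # bs @ [u]) \<subseteq> E" using d(2) assms(2) by blast+
  from drawing_meet[OF this splits_disjoint[OF assms(1)]]
  have "path_image g \<inter> path_image h = {p u, p v}" unfolding g(4) h(4) U I by simp
  moreover have "path_image g \<union> path_image h = drawing Z" unfolding d(2) drawing_Un g(4) h(4) ..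
  ultimately show thesis by (rule that[OF g(1) h(1) g(2,3) h(2,3) g(4) h(4)])
qed

text \<open>The Jordan curve theorem with two interchangeable sides: which of them is bounded does
  not matter for faces, so inside and outside are hidden here.\<close>

lemma cycle_sides:
  assumes "is_cycle Z" "Z \<subseteq> E"
  obtains A B where "A \<inter> B = {}" "A \<union> B = - drawing Z" "open A" "open B" "connected A" "connected B"
    "A \<noteq> {}" "B \<noteq> {}" "frontier A = drawing Z" "frontier B = drawing Z" "components (- drawing Z) = {A, B}"
proof -
  obtain xs where xs: "distinct xs" "3 \<le> length xs" "Z = cycle_edges xs"
    using assms unfolding is_cycle_def by blast
  obtain u v ys where uv: "xs = u # v # ys" using xs(2) by (metis Suc_le_length_iff numeral_3_eq_3)
  have U: "\<Union>Z = set xs" using Union_cycle_edges[of xs] xs by simp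
  have "u \<in> \<Union>Z" "v \<in> \<Union>Z" "u \<noteq> v" using U uv xs(1) by auto
  then obtain as bs where s: "splits Z u as v bs" using cycle_splits[OF assms(1)] by metis
  obtain g h where gh: "arc g" "arc h" "pathstart g = p u" "pathfinish g = p v" "pathstart h = p u" "pathfinish h = p v"
    "path_image g \<inter> path_image h = {p u, p v}" "path_image g \<union> path_image h = drawing Z"
    using cycle_arcs[OF s assms(2)] by metis
  note J = Jordan_arcs[OF gh(1-7), unfolded gh(8)]
  have "components (- drawing Z) = {inside (drawing Z), outside (drawing Z)}"
  proof (rule components_eqI)
    show "\<Union>{inside (drawing Z), outside (drawing Z)} = - drawing Z" using J(8) by simp
    show "open C \<and> connected C \<and> C \<noteq> {}" if "C \<in> {inside (drawing Z), outside (drawing Z)}" for C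
      using that J(1-6) by auto
    show "C \<inter> D = {}" if "C \<in> {inside (drawing Z), outside (drawing Z)}"
      "D \<in> {inside (drawing Z), outside (drawing Z)}" "C \<noteq> D" for C D
      using that J(7) Int_commute[of "inside (drawing Z)" "outside (drawing Z)"] by (elim insertE emptyE; simp)
  qed
  then show thesis using that[of "inside (drawing Z)" "outside (drawing Z)"] J by metis
qed

section \<open>Faces of a plane graph grown by ears\<close>

text \<open>Couples combinatorics and topology: the faces of the face system are the actual
  components of the complement, and \<open>bd\<close> lists the edges whose drawing is the
  frontier.\<close>

definition good :: "'a set set \<Rightarrow> bool" where
  "good M \<longleftrightarrow> M \<subseteq> E \<and> (\<exists>bd. face_system M (components (- drawing M)) bd \<and>
     (\<forall>C\<in>components (- drawing M). frontier C = drawing (bd C)))"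

lemma good_cycle:
  assumes "is_cycle Z" "Z \<subseteq> E"
  shows "good Z"
proof -
  obtain A B where AB: "A \<inter> B = {}" "A \<union> B = - drawing Z" "open A" "open B" "connected A" "connected B"
    "A \<noteq> {}" "B \<noteq> {}" "frontier A = drawing Z" "frontier B = drawing Z" "components (- drawing Z) = {A, B}"
    by (rule cycle_sides[OF assms])
  have "A \<noteq> B" using AB(1,7) by blast
  then have "face_system Z {A, B} (\<lambda>_. Z)" using face_system_cycle[OF assms(1), of A B "\<lambda>_. Z"] by simp
  then show ?thesis unfolding good_def AB(11) using assms AB(9,10) by auto
qed

text \<open>The interior of the ear lies in a single face \<open>C\<close>, and both its ends lie on
  the boundary cycle of \<open>C\<close>. That cycle and the ear form a theta graph: one of its
  faces is the side of the cycle away from \<open>C\<close>, and the other two are what the ear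
  makes of \<open>C\<close>. All other faces are unchanged.\<close>

lemma good_ear:
  assumes "good M" "u \<in> \<Union>M" "v \<in> \<Union>M" "distinct (u # ps @ [v])" "path_edges (u # ps @ [v]) \<subseteq> E - M"
    "set ps \<inter> \<Union>M = {}"
  shows "good (M \<union> path_edges (u # ps @ [v]))"
proof -
  let ?P = "path_edges (u # ps @ [v])" and ?F = "components (- drawing M)"
  obtain bd where ME: "M \<subseteq> E" and fs: "face_system M ?F bd" and fr: "\<And>C. C \<in> ?F \<Longrightarrow> frontier C = drawing (bd C)"
    using assms(1) unfolding good_def by blast
  have "\<forall>f\<in>?F. is_cycle (bd f) \<and> bd f \<subseteq> M" using fs unfolding face_system_def by (elim conjE)
  then have cyc: "is_cycle (bd C)" "bd C \<subseteq> M" if "C \<in> ?F" for C using that by simp_all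
  have PE: "?P \<subseteq> E" using assms(5) by blast
  have uv: "u \<noteq> v" using assms(4) by auto
  have MV: "\<Union>M \<subseteq> V" using ME edge_subset by (meson Sup_least subsetD)
  have uvV: "u \<in> V" "v \<in> V" using assms(2,3) MV by (meson subsetD)+
  obtain g where g: "arc g" "path_image g = drawing ?P" "pathstart g = p u" "pathfinish g = p v"
    using path_arc[OF assms(4) PE] by blast
  have UP: "\<Union>?P = set (u # ps @ [v])" by (rule Union_path_edges) simp
  have UM: "\<Union>M \<inter> set (u # ps @ [v]) = {u, v}" using assms(2,3,6) by auto
  have "M \<inter> ?P = {}" using assms(5) by blast
  from drawing_meet[OF ME PE this] have MP: "drawing M \<inter> drawing ?P = {p u, p v}" unfolding UP UM by simp
  have Pint: "arc_interior g = drawing ?P - {p u, p v}" unfolding arc_interior_def g ..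
  have Pi: "arc_interior g \<noteq> {}" "connected (arc_interior g)"
    using arc_interior_nonempty[OF g(1)] connected_arc_interior[OF g(1)] by (simp_all add: arc_interior_def)
  have Pi3: "arc_interior g \<subseteq> - drawing M" unfolding Pint using MP by blast
  have "- drawing M \<noteq> {}" using Pi(1) Pi3 by blast
  with exists_component_superset[OF Pi3 _ Pi(2)] obtain C where C: "C \<in> ?F" "arc_interior g \<subseteq> C" by metis
  have oC: "open (- drawing M)" using compact_drawing[OF ME] by (simp add: compact_imp_closed open_Compl)
  have onC: "open D" if "D \<in> ?F" for D using open_components[OF oC that] .
  have DX: "D \<inter> drawing M = {}" if "D \<in> ?F" for D using in_components_subset[OF that] by blast
  \<comment> \<open>An end of the ear is a limit of interior points of the ear, hence of
    \<open>C\<close>, but as a vertex of \<open>M\<close> it is not in \<open>C\<close> itself; so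
    it lies on the frontier.\<close>
  have endfr: "x \<in> \<Union>(bd C)" if x: "x = u \<or> x = v" for x
  proof -
    have "p x \<in> path_image g" using x g(3,4) pathstart_in_path_image[of g] pathfinish_in_path_image[of g] by auto
    with closure_arc_interior[OF g(1)] have "p x \<in> closure (arc_interior g)" by (rule subsetD)
    with closure_mono[OF C(2)] have 1: "p x \<in> closure C" by (rule subsetD)
    have "p x \<in> drawing M \<inter> drawing ?P" unfolding MP using x by auto
    then have "p x \<notin> C" using DX[OF C(1)] by auto
    with 1 have "p x \<in> frontier C" unfolding frontier_def using interior_subset[of C] by auto
    then have 2: "p x \<in> drawing (bd C)" using fr[OF C(1)] by simp
    have "bd C \<subseteq> E" using cyc(2)[OF C(1)] ME by (rule subset_trans)
    moreover have "x \<in> V" using x uvV by auto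
    ultimately show ?thesis using vertex_in_drawing 2 by simp
  qed
  then have "u \<in> \<Union>(bd C)" "v \<in> \<Union>(bd C)" by simp_all
  then obtain as bs where s: "splits (bd C) u as v bs"
    by (rule cycle_splits[OF cyc(1)[OF C(1)] _ _ uv])
  have bdE: "bd C \<subseteq> E" using cyc(2)[OF C(1)] ME by (rule subset_trans)
  let ?Q1 = "path_edges (u # as @ [v])" and ?Q2 = "path_edges (v # bs @ [u])"
  have bdC: "bd C = ?Q1 \<union> ?Q2" using s by (simp add: splits_def)
  obtain g1 g2 where g12: "arc g1" "arc g2" "pathstart g1 = p u" "pathfinish g1 = p v" "pathstart g2 = p u" "pathfinish g2 = p v"
    "path_image g1 = drawing ?Q1" "path_image g2 = drawing ?Q2"
    "path_image g1 \<inter> path_image g2 = {p u, p v}" "path_image g1 \<union> path_image g2 = drawing (bd C)"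
    by (rule cycle_arcs[OF s bdE])
  have QM: "drawing (bd C) \<subseteq> drawing M" using drawing_mono[OF cyc(2)[OF C(1)]] .
  have e1: "path_image g1 \<inter> path_image g = {p u, p v}" "path_image g2 \<inter> path_image g = {p u, p v}"
  proof -
    have *: "X \<inter> Z = S" if "S \<subseteq> X" "S \<subseteq> Z" "X \<subseteq> Y" "Y \<inter> Z = S" for X Y Z S :: "complex set"
      using that by auto
    have 1: "{p u, p v} \<subseteq> path_image g1" "{p u, p v} \<subseteq> path_image g2"
      unfolding g12(9)[symmetric] by simp_all
    have "path_image g1 \<union> path_image g2 \<subseteq> drawing M" unfolding g12(10) by (rule QM)
    then have 2: "path_image g1 \<subseteq> drawing M" "path_image g2 \<subseteq> drawing M" by simp_all
    have 3: "{p u, p v} \<subseteq> path_image g" unfolding MP[symmetric] g(2) by simp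
    have 4: "drawing M \<inter> path_image g = {p u, p v}" unfolding g(2) by (rule MP)
    show "path_image g1 \<inter> path_image g = {p u, p v}" by (rule *[OF 1(1) 3 2(1) 4])
    show "path_image g2 \<inter> path_image g = {p u, p v}" by (rule *[OF 1(2) 3 2(2) 4])
  qed
  interpret theta g1 g2 g "p u" "p v"
    by unfold_locales (fact g12 g e1)+
  let ?J = "drawing (bd C)" and ?T = "path_image g1 \<union> path_image g2 \<union> path_image g"
  obtain D0 D1 D2 where D: "components (- ?T) = {D0, D1, D2}" "frontier D0 = ?J"
    "frontier D1 = path_image g1 \<union> path_image g" "frontier D2 = path_image g2 \<union> path_image g"
    using three_faces g12(10) unfolding has_three_faces_def by metis
  obtain z1 where z1: "z1 \<in> path_image g1" "z1 \<noteq> p u" "z1 \<noteq> p v" using arc_interior_nonempty[OF g12(1)] unfolding g12(3,4) by auto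
  obtain z2 where z2: "z2 \<in> path_image g2" "z2 \<noteq> p u" "z2 \<noteq> p v" using arc_interior_nonempty[OF g12(2)] unfolding g12(5,6) by auto
  have "z1 \<notin> path_image g2 \<union> path_image g" using z1 g12(9) e1(1) by blast
  then have D12: "D1 \<noteq> D2" using D(3,4) z1 by blast
  obtain z where z: "z \<in> path_image g" "z \<notin> ?J"
    using Pi(1) Pi3 Pint g(2) QM by blast
  have D0n: "D0 \<noteq> D1" "D0 \<noteq> D2" using D(2-4) z by blast+
  obtain A B where AB: "A \<inter> B = {}" "A \<union> B = - ?J" "open A" "open B" "connected A" "connected B"
    "A \<noteq> {}" "B \<noteq> {}" "frontier A = ?J" "frontier B = ?J" "components (- ?J) = {A, B}"
    by (rule cycle_sides[OF cyc(1)[OF C(1)] bdE])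
  \<comment> \<open>Since the frontier of \<open>C\<close> is its whole boundary cycle,
    \<open>C\<close> is one full side of that cycle. The other side \<open>C'\<close> does not meet
    the ear, so it is the face \<open>D0\<close> of the theta graph, and \<open>D1\<close>,
    \<open>D2\<close> must fill \<open>C\<close> minus the ear.\<close>
  have "C \<in> components (- ?J)"
    using in_components_connected[OF C(1)] in_components_nonempty[OF C(1)] fr[OF C(1)] DX[OF C(1)] QM
    by (intro in_components_Compl) auto
  then obtain C' where C': "C \<inter> C' = {}" "C \<union> C' = - ?J" "connected C'" "C' \<noteq> {}" "frontier C' = ?J"
  proof -
    have "C = A \<or> C = B" using \<open>C \<in> components (- ?J)\<close> AB(11) by simp
    then show thesis
    proof
      assume "C = A" then show thesis using that[of B] AB(1,2,6,8,10) by simp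
    next
      assume "C = B" then show thesis using that[of A] AB(1,2,5,7,9) by (simp add: Int_commute Un_commute)
    qed
  qed
  have PC: "drawing ?P \<subseteq> C \<union> {p u, p v}" using C(2) Pint by blast
  have uvJ: "{p u, p v} \<subseteq> ?J" using g12(9,10) by blast
  have "C' \<in> components (- ?T)"
  proof (rule in_components_Compl[OF C'(3,4)])
    show "frontier C' \<subseteq> ?T" using C'(5) g12(10) by blast
    show "C' \<inter> ?T = {}" using C'(1,2) g12(10) g(2) PC uvJ by blast
  qed
  moreover have "C' \<noteq> D1" "C' \<noteq> D2" using D(3,4) C'(5) z by blast+
  ultimately have "C' = D0" using D(1) by blast
  have Dc: "D0 \<in> components (- ?T)" "D1 \<in> components (- ?T)" "D2 \<in> components (- ?T)" using D(1) by blast+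
  have dis: "D0 \<inter> D1 = {}" "D0 \<inter> D2 = {}" "D1 \<inter> D2 = {}"
    using components_nonoverlap Dc D0n D12 by blast+
  have "\<Union>{D0, D1, D2} = - ?T" unfolding D(1)[symmetric] by simp
  then have "D0 \<union> D1 \<union> D2 = - (?J \<union> drawing ?P)" unfolding g12(10) g(2) by (simp add: Un_assoc)
  moreover have "A0 \<union> B1 = C - P" if "C \<inter> D = {}" "C \<union> D = - J" "D \<union> A0 \<union> B1 = - (J \<union> P)" "D \<inter> A0 = {}" "D \<inter> B1 = {}"
    for A0 B1 D J P :: "complex set" using that by auto
  ultimately have DD: "D1 \<union> D2 = C - drawing ?P"
    using dis(1,2) C'(1,2) unfolding \<open>C' = D0\<close> by metis
  have oT: "open (- ?T)"
    using g12(1,2) g(1) by (intro open_Compl closed_Un closed_arc_image) auto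
  have comps: "components (- drawing (M \<union> ?P)) = ?F - {C} \<union> {D1, D2}"
  proof (rule components_eqI)
    have 1: "\<Union>?F = - drawing M" by simp
    have 2: "\<Union>(?F - {C}) \<inter> C = {}"
    proof -
      have "D \<inter> C = {}" if "D \<in> ?F - {C}" for D using that components_nonoverlap[of D "- drawing M" C] C(1) by simp
      then show ?thesis by (simp add: Int_Union2)
    qed
    have 3: "\<Union>?F = \<Union>(?F - {C}) \<union> C"
    proof -
      have "?F = insert C (?F - {C})" using C(1) by (simp add: insert_absorb)
      then show ?thesis by (metis Union_insert Un_commute)
    qed
    have "{p u, p v} \<subseteq> drawing M" using uvJ QM by (rule subset_trans)
    then have 4: "drawing ?P \<subseteq> C \<union> drawing M" using PC by (meson Un_mono order_refl order_trans)
    have 5: "\<Union>(?F - {C} \<union> {D1, D2}) = \<Union>(?F - {C}) \<union> (C - drawing ?P)"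
      unfolding DD[symmetric] by (simp only: Union_Un_distrib Union_insert Union_empty Un_empty_right)
    have "A \<union> (C - R) = - (Y \<union> R)" if "A \<union> C = - Y" "A \<inter> C = {}" "R \<subseteq> C \<union> Y" for A R Y :: "complex set"
      using that by blast
    from this[OF _ 2 4] show "\<Union>(?F - {C} \<union> {D1, D2}) = - drawing (M \<union> ?P)"
      unfolding 5 drawing_Un using 1 3 by simp
  next
    fix D assume "D \<in> ?F - {C} \<union> {D1, D2}"
    then show "open D \<and> connected D \<and> D \<noteq> {}"
      using onC open_components[OF oT] Dc in_components_connected in_components_nonempty by blast
  next
    fix D D' assume a: "D \<in> ?F - {C} \<union> {D1, D2}" "D' \<in> ?F - {C} \<union> {D1, D2}" "D \<noteq> D'"
    have "D1 \<subseteq> C" "D2 \<subseteq> C" using DD by blast+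
    moreover have "X \<inter> C = {}" if "X \<in> ?F - {C}" for X using that components_nonoverlap C(1) by blast
    moreover have "X \<inter> Y = {}" if "X \<in> ?F - {C}" "Y \<in> ?F - {C}" "X \<noteq> Y" for X Y using that components_nonoverlap by blast
    moreover have "D2 \<inter> D1 = {}" using dis(3) by (simp add: Int_commute)
    ultimately show "D \<inter> D' = {}" using a dis(3) by (elim UnE insertE emptyE; simp; blast)
  qed
  have new: "D1 \<notin> ?F - {C}" "D2 \<notin> ?F - {C}"
  proof -
    have "D1 \<subseteq> C" "D2 \<subseteq> C" using DD by blast+
    moreover have "D1 \<noteq> {}" "D2 \<noteq> {}" using in_components_nonempty Dc by blast+
    moreover have "X \<inter> C = {}" if "X \<in> ?F - {C}" for X using that components_nonoverlap C(1) by blast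
    ultimately show "D1 \<notin> ?F - {C}" "D2 \<notin> ?F - {C}" by blast+
  qed
  define bd' where "bd' = bd(D1 := ?Q1 \<union> ?P, D2 := ?Q2 \<union> ?P)"
  have b1: "bd' D1 = ?Q1 \<union> ?P" "bd' D2 = ?Q2 \<union> ?P" using D12 by (auto simp: bd'_def)
  have b2: "bd' f = bd f" if "f \<in> ?F - {C}" for f
    using that new unfolding bd'_def by (metis fun_upd_other)
  have PM: "?P \<inter> M = {}" using assms(5) by blast
  have "face_system (M \<union> ?P) (?F - {C} \<union> {D1, D2}) bd'"
    by (rule face_system_ear[OF fs C(1) s assms(4,6) PM new D12 b1 b2])
  moreover have "frontier D = drawing (bd' D)" if "D \<in> ?F - {C} \<union> {D1, D2}" for D
  proof -
    have "D \<in> ?F - {C} \<or> D = D1 \<or> D = D2" using that by blast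
    then consider "D \<in> ?F - {C}" | "D = D1" | "D = D2" by (elim disjE)
    then show ?thesis
    proof cases
      case 1 then show ?thesis using fr b2 by auto
    next
      case 2 then show ?thesis using D(3) b1(1) g12(7) g(2) by (simp add: drawing_Un)
    next
      case 3 then show ?thesis using D(4) b1(2) g12(8) g(2) by (simp add: drawing_Un)
    qed
  qed
  ultimately show ?thesis unfolding good_def comps using ME PE by blast
qed

text \<open>If \<open>M\<close> covers all vertices, a missing edge is an ear without inner
  vertices. Otherwise some edge leads from a vertex \<open>u\<close> of \<open>M\<close> to a vertex
  \<open>w\<close> outside. Deleting \<open>u\<close> leaves the graph connected, so a path from
  \<open>w\<close> returns to \<open>M\<close> at a vertex other than \<open>u\<close>; its first
  return closes the ear. The set \<open>S\<close> collects the ends of paths from \<open>w\<close>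
  whose earlier vertices avoid \<open>M\<close>.\<close>

lemma exists_ear:
  assumes M: "M \<subseteq> E" "M \<noteq> E" "M \<noteq> {}"
    and conn: "connected_on E V" "\<And>c. c \<in> V \<Longrightarrow> connected_on E (V - {c})"
  obtains u ps v where "u \<in> \<Union>M" "v \<in> \<Union>M" "distinct (u # ps @ [v])" "path_edges (u # ps @ [v]) \<subseteq> E - M"
    "set ps \<inter> \<Union>M = {}"
proof (cases "\<Union>M = V")
  case True
  obtain e where e: "e \<in> E" "e \<notin> M" using M(1,2) by auto
  obtain u v where uv: "e = {u, v}" "u \<in> V" "v \<in> V" "u \<noteq> v" using edge[OF e(1)] by metis
  have "u \<in> \<Union>M" "v \<in> \<Union>M" using uv True by simp_all
  then show thesis by (rule that[of u v "[]"]) (use e uv in auto)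
next
  case False
  let ?U = "\<Union>M"
  have UV: "?U \<subseteq> V" using M(1) edge_subset by (meson Sup_least subsetD)
  obtain e0 where e0: "e0 \<in> M" using M(3) by auto
  obtain a b where ab: "e0 = {a, b}" "a \<noteq> b" using edge[of e0] e0 M(1) by (meson subsetD)
  have abU: "a \<in> ?U" "b \<in> ?U" using e0 ab by auto
  have "\<exists>x\<in>?U. \<exists>y\<in>V. {x, y} \<in> E \<and> y \<notin> ?U"
  proof (rule ccontr)
    assume "\<not> ?thesis"
    then have "y \<in> ?U" if "x \<in> ?U" "y \<in> V" "{x, y} \<in> E" for x y using that by metis
    moreover have "?U \<noteq> {}" using abU(1) by (metis empty_iff)
    ultimately have "?U = V" using connected_onD[OF conn(1) UV] by metis
    then show False using False by simp
  qed
  then obtain u w where u: "u \<in> ?U" "w \<in> V" "{u, w} \<in> E" "w \<notin> ?U" by metis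
  have uV: "u \<in> V" using u(1) UV by (rule subsetD[rotated])
  define S where "S = {x. \<exists>qs. distinct (qs @ [x]) \<and> hd (qs @ [x]) = w \<and> path_edges (qs @ [x]) \<subseteq> E \<and>
    set qs \<subseteq> V - ?U \<and> x \<in> V - {u}}"
  have wS: "w \<in> S" 
  proof -
    have "w \<noteq> u" using u(1,4) by metis
    then show ?thesis unfolding S_def mem_Collect_eq by (intro exI[of _ "[]"]) (simp add: u(2))
  qed
  have "\<exists>x\<in>S. x \<in> ?U"
  proof (rule ccontr)
    assume n: "\<not> ?thesis"
    have "y \<in> S" if xy: "x \<in> S" "y \<in> V - {u}" "{x, y} \<in> E" for x y
    proof -
      obtain qs where qs: "distinct (qs @ [x])" "hd (qs @ [x]) = w" "path_edges (qs @ [x]) \<subseteq> E" "set qs \<subseteq> V - ?U" "x \<in> V"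
        using xy(1) unfolding S_def by auto
      have xU: "x \<notin> ?U" using n xy(1) by auto
      show ?thesis
      proof (cases "y \<in> set (qs @ [x])")
        case False
        have "distinct ((qs @ [x]) @ [y])" using False qs(1) by auto
        moreover have "hd ((qs @ [x]) @ [y]) = w" using qs(2) by (cases qs) auto
        moreover have "path_edges ((qs @ [x]) @ [y]) \<subseteq> E" using qs(3) xy(3) path_edges_snoc2[of qs x y] by auto
        moreover have "set (qs @ [x]) \<subseteq> V - ?U" using qs(4,5) xU by auto
        ultimately show ?thesis unfolding S_def using xy(2) by blast
      next
        case True
        \<comment> \<open>If \<open>y\<close> already lies on the path, the initial piece ending at
          \<open>y\<close> is a path to \<open>y\<close>.\<close>
        then obtain as bs where ab: "qs @ [x] = as @ y # bs" by (metis split_list)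
        have "path_edges (qs @ [x]) = path_edges (as @ [y]) \<union> path_edges (y # bs)"
          unfolding ab by (rule path_edges_append)
        then have "path_edges (as @ [y]) \<subseteq> E" using qs(3) by auto
        moreover have "distinct (as @ [y])" using qs(1) unfolding ab by auto
        moreover have "hd (as @ [y]) = w" using qs(2) unfolding ab by (cases as) auto
        moreover have "set as \<subseteq> V - ?U"
        proof -
          have "set as \<subseteq> set (qs @ [x])" unfolding ab by auto
          also have "\<dots> \<subseteq> V - ?U" using qs(4,5) xU by simp
          finally show ?thesis .
        qed
        ultimately show ?thesis unfolding S_def using xy(2) by blast
      qed
    qed
    moreover have "S \<subseteq> V - {u}" unfolding S_def by auto
    ultimately have "S = V - {u}" using connected_onD[OF conn(2)[OF uV], of S] wS by blast
    \<comment> \<open>An edge of \<open>M\<close> has two ends, so at least one of them is different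
      from \<open>u\<close>.\<close>
    then have "a \<in> S \<or> b \<in> S" using abU UV ab(2) by auto
    then show False using n abU by auto
  qed
  then obtain x qs where x: "x \<in> ?U" "distinct (qs @ [x])" "hd (qs @ [x]) = w" "path_edges (qs @ [x]) \<subseteq> E"
    "set qs \<subseteq> V - ?U" "x \<noteq> u" unfolding S_def by auto
  have qs: "qs \<noteq> []" using x(1,3) u(4) by auto
  then obtain q' where q': "qs = w # q'" using x(3) by (cases qs) auto
  have uq: "u \<notin> set qs" using x(5) u(1) by auto
  have P: "path_edges (u # qs @ [x]) = insert {u, w} (path_edges (qs @ [x]))" unfolding q' by simp
  have "e \<notin> M" if "e \<in> path_edges (u # qs @ [x])" for e
  proof -
    have "e \<inter> set qs \<noteq> {}"
      using that edge_meets_prefix[of e qs x] unfolding P q' by auto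
    then show ?thesis using x(5) by auto
  qed
  then have "path_edges (u # qs @ [x]) \<subseteq> E - M" using x(4) u(3) unfolding P by auto
  moreover have "set qs \<inter> ?U = {}" using x(5) by auto
  moreover have "distinct (u # qs @ [x])" using x(2,6) uq by auto
  ultimately show thesis using that[OF u(1) x(1)] by metis
qed

text \<open>A largest good edge set is taken instead of an explicit ear decomposition: an ear would
  enlarge it, so it must be \<open>E\<close>. The cycle \<open>Z\<close> only ensures that there is
  a nonempty good set.\<close>

theorem good_E:
  assumes Z: "is_cycle Z" "Z \<subseteq> E"
    and conn: "connected_on E V" "\<And>c. c \<in> V \<Longrightarrow> connected_on E (V - {c})"
  shows "good E"
proof -
  have "good Z \<and> Z \<noteq> {}" using good_cycle[OF Z] is_cycle_nonempty[OF Z(1)] by simp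
  moreover have "\<forall>M. good M \<and> M \<noteq> {} \<longrightarrow> card M < card E + 1"
    using card_mono[OF finite_E] by (simp add: good_def less_Suc_eq_le)
  ultimately obtain M where "good M \<and> M \<noteq> {} \<and> (\<forall>M'. good M' \<and> M' \<noteq> {} \<longrightarrow> card M' \<le> card M)"
    using ex_has_greatest_nat[of "\<lambda>M. good M \<and> M \<noteq> {}" Z card "card E + 1"] by (auto simp: less_imp_le)
  then have M: "good M" "M \<noteq> {}" "\<And>M'. good M' \<Longrightarrow> M' \<noteq> {} \<Longrightarrow> card M' \<le> card M" by simp_all
  have ME: "M \<subseteq> E" using M(1) by (simp add: good_def)
  have "M = E"
  proof (rule ccontr)
    assume "M \<noteq> E"
    then obtain u ps v where ear: "u \<in> \<Union>M" "v \<in> \<Union>M" "distinct (u # ps @ [v])" "path_edges (u # ps @ [v]) \<subseteq> E - M"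
      "set ps \<inter> \<Union>M = {}"
      by (rule exists_ear[OF ME _ M(2) conn])
    let ?P = "path_edges (u # ps @ [v])"
    have "?P \<noteq> {}" by (cases ps) auto
    have "good (M \<union> ?P)" by (rule good_ear[OF M(1) ear])
    then have "card (M \<union> ?P) \<le> card M" using M(2,3) by simp
    moreover have "card M < card (M \<union> ?P)"
      using ear(4) \<open>?P \<noteq> {}\<close> finite_subset[OF ME finite_E] by (intro psubset_card_mono) auto
    ultimately show False by simp
  qed
  then show ?thesis using M(1) by simp
qed

section \<open>Induced nonseparating cycles bound faces\<close>

text \<open>The vertices off \<open>Z\<close> are connected without crossing \<open>Z\<close>, so
  all of them lie on one side. An edge on the other side would have both ends on \<open>Z\<close>
  and be a chord. That side is therefore empty, hence a face.\<close>

lemma facial_cycle: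
  assumes Z: "is_cycle Z" "Z \<subseteq> E" and conn: "connected_on E (V - \<Union>Z)" "V - \<Union>Z \<noteq> {}"
    and chord: "\<And>e. e \<in> E \<Longrightarrow> e \<subseteq> \<Union>Z \<Longrightarrow> e \<in> Z"
  obtains C where "C \<in> components (- drawing E)" "frontier C = drawing Z"
proof -
  let ?W = "\<Union>Z"
  obtain w0 where w0: "w0 \<in> V - ?W" using conn(2) by auto
  obtain A B where AB: "A \<inter> B = {}" "A \<union> B = - drawing Z" "open A" "open B" "connected A" "connected B"
    "A \<noteq> {}" "B \<noteq> {}" "frontier A = drawing Z" "frontier B = drawing Z" "components (- drawing Z) = {A, B}"
    by (rule cycle_sides[OF Z])
  have pZ: "p x \<notin> drawing Z" if "x \<in> V - ?W" for x using vertex_in_drawing[OF Z(2), of x] that by simp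
  have main: "\<exists>C. C \<in> components (- drawing E) \<and> frontier C = drawing Z"
    if AB: "A \<inter> B = {}" "open A" "connected B" "B \<noteq> {}" "frontier B = drawing Z" "A \<in> components (- drawing Z)"
      "B \<inter> drawing Z = {}" "p w0 \<in> A" for A B
  proof -
    have int: "arc_interior (\<gamma> e) \<subseteq> A" if e: "e \<in> E" "e \<notin> Z" "x \<in> e" "p x \<in> A" for e x
    proof (rule connected_subset_component[OF AB(6) connected_arc_interior[OF arc[OF e(1)]]])
      show "arc_interior (\<gamma> e) \<subseteq> - drawing Z"
        using interior_arcs[OF e(1)] e(2) Z(2) unfolding drawing_def by blast
      have "p x \<in> path_image (\<gamma> e)" using vertex_in_image[OF e(1)] edge_subset[OF e(1)] e(3) by auto
      with closure_arc_interior[OF arc[OF e(1)]] have "p x \<in> closure (arc_interior (\<gamma> e))" by (rule subsetD)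
      then show "arc_interior (\<gamma> e) \<inter> A \<noteq> {}" using AB(2) e(4) by (metis Int_commute disjoint_iff open_Int_closure_eq_empty)
    qed
    have all: "p x \<in> A" if "x \<in> V - ?W" for x
    proof -
      have "{x \<in> V - ?W. p x \<in> A} = V - ?W"
      proof (rule connected_onD[OF conn(1)])
        show "{x \<in> V - ?W. p x \<in> A} \<subseteq> V - ?W" by auto
        show "{x \<in> V - ?W. p x \<in> A} \<noteq> {}" using w0 AB(8) by auto
        fix x y assume xy: "x \<in> {x \<in> V - ?W. p x \<in> A}" "y \<in> V - ?W" "{x, y} \<in> E"
        have "{x, y} \<notin> Z" using xy(2) by auto
        then have "arc_interior (\<gamma> {x, y}) \<subseteq> A" using int[OF xy(3), of x] xy(1) by auto
        moreover have "p y \<in> path_image (\<gamma> {x, y})" using vertex_in_image[OF xy(3)] xy(2) by auto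
        with closure_arc_interior[OF arc[OF xy(3)]] have "p y \<in> closure (arc_interior (\<gamma> {x, y}))" by (rule subsetD)
        ultimately have "p y \<in> closure A" using closure_mono by (meson subsetD)
        moreover have "frontier A \<subseteq> drawing Z"
          using frontier_of_components_closed_complement[OF _ AB(6)] compact_imp_closed[OF compact_drawing[OF Z(2)]] by simp
        moreover have "p y \<notin> drawing Z" using pZ xy(2) by simp
        ultimately have "p y \<in> A" unfolding frontier_def interior_open[OF AB(2)] by auto
        then show "y \<in> {x \<in> V - ?W. p x \<in> A}" using xy(2) by auto
      qed
      then show ?thesis using that by auto
    qed
    have BE: "B \<inter> drawing E = {}"
    proof -
      have "B \<inter> path_image (\<gamma> e) = {}" if e: "e \<in> E" for e
      proof (cases "e \<in> Z")
        case True
        then have "path_image (\<gamma> e) \<subseteq> drawing Z" by (auto simp: drawing_def)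
        then show ?thesis using AB(7) by blast
      next
        case False
        then obtain x where x: "x \<in> e" "x \<notin> ?W" using chord[OF e] by auto
        have "p x \<in> A" using all x edge_subset[OF e] by blast
        then have "arc_interior (\<gamma> e) \<subseteq> A" using int[OF e False x(1)] by simp
        moreover have "p y \<notin> B" if "y \<in> e" for y
        proof (cases "y \<in> ?W")
          case True
          then have "p y \<in> drawing Z" using vertex_in_drawing[OF Z(2), of y] edge_subset[OF e] that by auto
          then show ?thesis using AB(7) by blast
        next
          case False
          then have "p y \<in> A" using all edge_subset[OF e] that by blast
          then show ?thesis using AB(1) by blast
        qed
        ultimately show ?thesis unfolding image_eq[OF e] using AB(1) by blast
      qed
      then show ?thesis unfolding drawing_def by blast
    qed
    have "frontier B \<subseteq> drawing E" unfolding AB(5) using Z(2) by (rule drawing_mono)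
    then have "B \<in> components (- drawing E)" by (rule in_components_Compl[OF AB(3,4) _ BE])
    then show ?thesis using AB(5) by metis
  qed
  have "p w0 \<in> A \<or> p w0 \<in> B" using AB(2) pZ[OF w0] by blast
  moreover have "A \<inter> drawing Z = {}" "B \<inter> drawing Z = {}" using AB(2) by blast+
  moreover have "A \<in> components (- drawing Z)" "B \<in> components (- drawing Z)" using AB(11) by simp_all
  moreover have "B \<inter> A = {}" using AB(1) by (simp add: Int_commute)
  ultimately show thesis using main[of A B] main[of B A] AB that by metis
qed

end

section \<open>Connectivity of covers\<close>

lemma neighbours_K1222_None: "neighbours K1222 None = Some ` {y. fst y < 3}"
  by (auto simp: neighbours_def K1222_def add_apex_def octahedron_def)

lemma neighbours_K1222_Some:
  "fst x < 3 \<Longrightarrow> neighbours K1222 (Some x) = insert None (Some ` {y. fst y < 3 \<and> fst y \<noteq> fst x})"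
  by (cases x) (auto simp: neighbours_def K1222_def add_apex_def octahedron_def)

lemma pverts_K1222: "pverts K1222 = insert None (Some ` {y. fst y < 3})"
  by (auto simp: K1222_def add_apex_def octahedron_def)

lemma neighbours_K1222_sym: "y \<in> neighbours K1222 x \<Longrightarrow> x \<in> neighbours K1222 y"
  by (auto simp: neighbours_def K1222_def add_apex_def octahedron_def)

lemma neighbours_K1222_neq: "y \<in> neighbours K1222 x \<Longrightarrow> x \<noteq> y"
  by (auto simp: neighbours_def K1222_def add_apex_def octahedron_def)

text \<open>Two nonadjacent vertices are opposite in the octahedron and have the other four
  octahedral vertices as common neighbours; three deletions cannot remove all of these.\<close>

lemma K1222_connected_minus:
  assumes X: "finite X" "card X \<le> 3" and T: "T \<subseteq> pverts K1222 - X" "T \<noteq> {}"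
    and closed: "\<And>x y. x \<in> T \<Longrightarrow> y \<in> pverts K1222 - X \<Longrightarrow> y \<in> neighbours K1222 x \<Longrightarrow> y \<in> T"
  shows "T = pverts K1222 - X"
proof -
  have "y \<in> T" if y: "y \<in> pverts K1222 - X" for y
  proof -
    obtain t where t: "t \<in> T" using T(2) by auto
    have tK: "t \<in> pverts K1222 - X" using t T(1) by auto
    have "\<exists>w \<in> pverts K1222 - X. w \<in> neighbours K1222 t \<and> y \<in> neighbours K1222 w"
      if n: "y \<noteq> t" "y \<notin> neighbours K1222 t"
    proof -
      obtain a where a: "t = Some a" "fst a < 3" using tK n y by (auto simp: pverts_K1222 neighbours_K1222_None)
      obtain b where b: "y = Some b" "fst b < 3" using y n a by (auto simp: pverts_K1222 neighbours_K1222_Some)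
      have ab: "fst b = fst a" using n a b by (auto simp: neighbours_K1222_Some)
      let ?N = "Some ` (({..<3} - {fst a}) \<times> (UNIV :: bool set))"
      have "card ?N = 4" using a(2) by (simp add: card_image card_cartesian_product)
      then have "\<not> ?N \<subseteq> X" using card_mono[OF X(1), of ?N] X(2) by auto
      then obtain w where w: "w \<in> ?N" "w \<notin> X" by blast
      have "w \<in> pverts K1222" "w \<in> neighbours K1222 t" "y \<in> neighbours K1222 w"
        using w(1) a b ab by (auto simp: pverts_K1222 neighbours_K1222_Some image_iff)
      then show ?thesis using w(2) by blast
    qed
    then show ?thesis using closed t y by metis
  qed
  then show ?thesis using T(1) by auto
qed

locale label_cover =
  fixes V :: "'a set" and E :: "'a set set" and \<pi> :: "'a \<Rightarrow> (nat \<times> bool) option"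
  assumes finV: "finite V"
    and edges: "e \<in> E \<Longrightarrow> \<exists>u v. e = {u, v} \<and> u \<in> V \<and> v \<in> V \<and> u \<noteq> v"
    and bij: "v \<in> V \<Longrightarrow> bij_betw \<pi> {w. {v, w} \<in> E} (neighbours K1222 (\<pi> v))"
    and labels: "v \<in> V \<Longrightarrow> \<pi> v \<in> pverts K1222"
begin

text \<open>The end of the lift to \<open>v\<close> of the edge from \<open>\<pi> v\<close> to
  \<open>y\<close>. It is meaningful only if \<open>y\<close> is adjacent to
  \<open>\<pi> v\<close>.\<close>

definition nb :: "'a \<Rightarrow> (nat \<times> bool) option \<Rightarrow> 'a" where
  "nb v y = (THE w. {v, w} \<in> E \<and> \<pi> w = y)"

lemma edge_verts: "{v, w} \<in> E \<Longrightarrow> v \<in> V \<and> w \<in> V \<and> v \<noteq> w"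
  using edges[of "{v, w}"] by (auto simp: doubleton_eq_iff)

lemma edge_label: "{v, w} \<in> E \<Longrightarrow> \<pi> w \<in> neighbours K1222 (\<pi> v)"
  using bij[of v] edge_verts[of v w] unfolding bij_betw_def by auto

lemma label_inj:
  assumes "{v, w} \<in> E" "{v, w'} \<in> E" "\<pi> w = \<pi> w'"
  shows "w = w'"
proof -
  have "inj_on \<pi> {w. {v, w} \<in> E}" using bij[of v] edge_verts[OF assms(1)] by (simp add: bij_betw_def)
  then show ?thesis using assms by (simp add: inj_on_def)
qed

lemma nb_ex:
  assumes "v \<in> V" "y \<in> neighbours K1222 (\<pi> v)"
  shows "\<exists>w. {v, w} \<in> E \<and> \<pi> w = y"
proof -
  have "y \<in> \<pi> ` {w. {v, w} \<in> E}" using bij[OF assms(1)] assms(2) by (simp add: bij_betw_def)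
  then show ?thesis by auto
qed

lemma nb:
  assumes "v \<in> V" "y \<in> neighbours K1222 (\<pi> v)"
  shows "{v, nb v y} \<in> E" "\<pi> (nb v y) = y"
proof -
  have "\<exists>!w. {v, w} \<in> E \<and> \<pi> w = y" using nb_ex[OF assms] label_inj by metis
  from theI'[OF this] show "{v, nb v y} \<in> E" "\<pi> (nb v y) = y" unfolding nb_def by simp_all
qed

lemma nb_eq: "{v, w} \<in> E \<Longrightarrow> nb v (\<pi> w) = w"
  using nb[of v "\<pi> w"] edge_verts[of v w] edge_label[of v w] label_inj[of v w "nb v (\<pi> w)"] by simp

lemma nb_nb:
  assumes "v \<in> V" "y \<in> neighbours K1222 (\<pi> v)"
  shows "nb (nb v y) (\<pi> v) = v"
  using nb[OF assms] nb_eq[of "nb v y" v] by (simp add: insert_commute)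

definition fibre :: "'a set \<Rightarrow> (nat \<times> bool) option \<Rightarrow> 'a set" where
  "fibre S y = {v \<in> S. \<pi> v = y}"

text \<open>Lifting the edge from \<open>y\<close> to \<open>z\<close> is injective on the fibre,
  because lifting the reversed edge leads back to the starting vertex.\<close>

lemma card_fibre_le:
  assumes "S \<subseteq> V" "T \<subseteq> V" "z \<in> neighbours K1222 y" "\<And>v. v \<in> S \<Longrightarrow> \<pi> v = y \<Longrightarrow> nb v z \<in> T"
  shows "card (fibre S y) \<le> card (fibre T z)"
proof (rule card_inj_on_le)
  show "finite (fibre T z)" using assms(2) finV unfolding fibre_def by (auto intro: finite_subset)
  show "(\<lambda>v. nb v z) ` fibre S y \<subseteq> fibre T z"
    using assms nb(2) unfolding fibre_def by auto
  show "inj_on (\<lambda>v. nb v z) (fibre S y)"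
  proof (rule inj_onI)
    fix v w assume "v \<in> fibre S y" "w \<in> fibre S y" "nb v z = nb w z"
    moreover from this have "v \<in> V" "w \<in> V" "\<pi> v = y" "\<pi> w = y" using assms(1) unfolding fibre_def by auto
    ultimately show "v = w" using nb_nb[of v z] nb_nb[of w z] assms(3) by simp
  qed
qed

text \<open>
  Lifting along edges shows that all fibres over labels outside the clique have the same size in a
  union of components of the complement of the clique. Comparing with the fibre of a clique vertex
  c, either all or none of the neighbours of c outside the clique lie in that union.
\<close>

lemma connected_minus_clique:
  assumes conn: "connected_on E V"
    and C: "C \<subseteq> V" "card C \<le> 3" "\<And>c d. c \<in> C \<Longrightarrow> d \<in> C \<Longrightarrow> c \<noteq> d \<Longrightarrow> {c, d} \<in> E"
  shows "connected_on E (V - C)"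
  using C
proof (induction "card C" arbitrary: C rule: less_induct)
  case less
  note C = less.prems
  have finC: "finite C" using C(1) finV finite_subset by blast
  show ?case unfolding connected_on_def
  proof (intro allI impI)
    fix S assume S: "S \<subseteq> V - C" "S \<noteq> {}" "\<forall>x\<in>S. \<forall>y\<in>V - C. {x, y} \<in> E \<longrightarrow> y \<in> S"
    let ?X = "\<pi> ` C" and ?L = "pverts K1222"
    have closed: "y \<in> S" if "x \<in> S" "{x, y} \<in> E" "y \<notin> C" for x y
      using S(3) that edge_verts[OF that(2)] by simp
    have SV: "S \<subseteq> V" using S(1) by auto
    have card_le: "card (fibre S y) \<le> card (fibre S z)"
      if "y \<in> ?L - ?X" "z \<in> ?L - ?X" "z \<in> neighbours K1222 y" for y z
    proof (rule card_fibre_le[OF SV SV that(3)])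
      fix v assume v: "v \<in> S" "\<pi> v = y"
      have vV: "v \<in> V" using v SV by auto
      have n: "{v, nb v z} \<in> E" "\<pi> (nb v z) = z" using nb[OF vV] v that(3) by auto
      then have "nb v z \<notin> C" using that(2) by (metis DiffD2 imageI)
      then show "nb v z \<in> S" using closed[OF v(1) n(1)] by simp
    qed
    have const: "card (fibre S y) = card (fibre S z)" if "y \<in> ?L - ?X" "z \<in> ?L - ?X" for y z
    proof -
      have "{t \<in> ?L - ?X. card (fibre S t) = card (fibre S y)} = ?L - ?X"
      proof (rule K1222_connected_minus)
        show "finite ?X" "card ?X \<le> 3" using finC C(2) card_image_le[OF finC, of \<pi>] by auto
        show "{t \<in> ?L - ?X. card (fibre S t) = card (fibre S y)} \<noteq> {}" using that(1) by auto
        fix s t assume st: "s \<in> {t \<in> ?L - ?X. card (fibre S t) = card (fibre S y)}" "t \<in> ?L - ?X" "t \<in> neighbours K1222 s"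
        then have "card (fibre S s) = card (fibre S t)"
          using card_le[of s t] card_le[of t s] neighbours_K1222_sym[OF st(3)] by simp
        then show "t \<in> {t \<in> ?L - ?X. card (fibre S t) = card (fibre S y)}" using st by simp
      qed auto
      then have "z \<in> {t \<in> ?L - ?X. card (fibre S t) = card (fibre S y)}" using that(2) by (simp only:)
      then show ?thesis by simp
    qed
    have same: "d = c" if "c \<in> C" "d \<in> C" "\<pi> d = \<pi> c" for c d
      using C(3)[OF that(1,2)] edge_label[of c d] neighbours_K1222_neq that(3) by metis
    have clabel: "y \<in> C" if cy: "c \<in> C" "{c, y} \<in> E" "\<pi> y \<in> ?X" for c y
    proof -
      obtain d where d: "d \<in> C" "\<pi> y = \<pi> d" using cy(3) by auto
      have "d \<noteq> c" using edge_label[OF cy(2)] d(2) neighbours_K1222_neq by metis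
      then have "{c, d} \<in> E" using C(3)[OF cy(1) d(1)] by simp
      then have "y = d" using label_inj[OF cy(2)] d(2) by simp
      then show ?thesis using d by simp
    qed
    have all_or_none: "nb c z' \<in> S"
      if c: "c \<in> C" and z: "z \<in> ?L - ?X" "z \<in> neighbours K1222 (\<pi> c)" "nb c z \<in> S"
        and z': "z' \<in> ?L - ?X" "z' \<in> neighbours K1222 (\<pi> c)" for c z z'
    proof (rule ccontr)
      assume n: "nb c z' \<notin> S"
      have cV: "c \<in> V" using c C(1) by auto
      have cS: "c \<notin> S" using c S(1) by auto
      \<comment> \<open>As \<open>nb c z'\<close> is not in \<open>S\<close>, lifting from the fibre
        over \<open>z'\<close> never ends in \<open>c\<close> and so stays in \<open>S\<close>. Over
        \<open>z\<close>, in contrast, \<open>c\<close> itself lifts into \<open>S\<close>, so the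
        fibre over \<open>z\<close> has room for one vertex more than the fibre over
        \<open>\<pi> c\<close>. The fibres over \<open>z'\<close> and \<open>z\<close> would have
        different sizes.\<close>
      have "card (fibre S z') \<le> card (fibre S (\<pi> c))"
      proof (rule card_fibre_le[OF SV SV neighbours_K1222_sym[OF z'(2)]])
        fix v assume v: "v \<in> S" "\<pi> v = z'"
        have vV: "v \<in> V" using v SV by auto
        have e: "{v, nb v (\<pi> c)} \<in> E" "\<pi> (nb v (\<pi> c)) = \<pi> c" using nb[OF vV] v neighbours_K1222_sym[OF z'(2)] by auto
        have "nb v (\<pi> c) \<noteq> c"
        proof
          assume "nb v (\<pi> c) = c"
          then have "{c, v} \<in> E" using e(1) by (simp add: insert_commute)
          then have "nb c z' = v" using nb_eq v(2) by blast
          then show False using n v by simp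
        qed
        then have "nb v (\<pi> c) \<notin> C" using same[OF c] e(2) by blast
        then show "nb v (\<pi> c) \<in> S" using closed[OF v(1) e(1)] by simp
      qed
      also have "card (fibre S (\<pi> c)) < card (fibre S z)"
      proof -
        have "card (fibre (insert c S) (\<pi> c)) \<le> card (fibre S z)"
        proof (rule card_fibre_le[OF _ SV z(2)])
          show "insert c S \<subseteq> V" using cV SV by auto
          fix v assume v: "v \<in> insert c S" "\<pi> v = \<pi> c"
          show "nb v z \<in> S"
          proof (cases "v = c")
            case True then show ?thesis using z(3) by simp
          next
            case False
            then have vS: "v \<in> S" using v by simp
            then have vV: "v \<in> V" using SV by auto
            have e: "{v, nb v z} \<in> E" "\<pi> (nb v z) = z" using nb[OF vV] v(2) z(2) by auto
            then have "nb v z \<notin> C" using z(1) by (metis DiffD2 imageI)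
            then show ?thesis using closed[OF vS e(1)] by simp
          qed
        qed
        moreover have "fibre (insert c S) (\<pi> c) = insert c (fibre S (\<pi> c))" unfolding fibre_def by auto
        moreover have "c \<notin> fibre S (\<pi> c)" using cS unfolding fibre_def by simp
        moreover have "finite (fibre S (\<pi> c))" using SV finV unfolding fibre_def by (auto intro: finite_subset)
        ultimately show ?thesis by simp
      qed
      finally show False using const[OF z(1) z'(1)] by simp
    qed
    \<comment> \<open>\<open>C1\<close> consists of the clique vertices attached to
      \<open>S\<close>. If there are none, \<open>S\<close> is closed in the whole graph. Otherwise
      \<open>S \<union> C1\<close> is closed after deleting only the smaller clique
      \<open>C - C1\<close>, and the induction hypothesis applies.\<close>
    define C1 where "C1 = {c \<in> C. \<forall>z \<in> ?L - ?X. z \<in> neighbours K1222 (\<pi> c) \<longrightarrow> nb c z \<in> S}"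
    show "S = V - C"
    proof (cases "C1 = {}")
      case True
      have "S = V"
      proof (rule connected_onD[OF conn SV S(2)])
        fix x y assume xy: "x \<in> S" "y \<in> V" "{x, y} \<in> E"
        show "y \<in> S"
        proof (rule ccontr)
          assume n: "y \<notin> S"
          then have yC: "y \<in> C" using closed[OF xy(1,3)] by blast
          have yx: "{y, x} \<in> E" using xy(3) by (simp add: insert_commute)
          have "x \<notin> C" using xy(1) S(1) by auto
          then have px: "\<pi> x \<in> ?L - ?X" using clabel[OF yC yx] labels xy(1) SV by auto
          have nyx: "nb y (\<pi> x) \<in> S" using nb_eq[OF yx] xy(1) by simp
          have "y \<in> C1" unfolding C1_def using yC all_or_none[OF yC px edge_label[OF yx] nyx] by simp
          then show False using True by simp
        qed
      qed
      then show ?thesis using S(1) by auto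
    next
      case False
      have C1C: "C1 \<subseteq> C" unfolding C1_def by auto
      have "connected_on E (V - (C - C1))"
      proof (rule less.hyps)
        show "card (C - C1) < card C" using C1C False finC by (intro psubset_card_mono) auto
        then show "card (C - C1) \<le> 3" using C(2) by simp
      qed (use C in auto)
      then have "S \<union> C1 = V - (C - C1)"
      proof (rule connected_onD)
        show "S \<union> C1 \<subseteq> V - (C - C1)" using S(1) C1C C(1) by auto
        show "S \<union> C1 \<noteq> {}" using S(2) by simp
        fix x y assume xy: "x \<in> S \<union> C1" "y \<in> V - (C - C1)" "{x, y} \<in> E"
        show "y \<in> S \<union> C1"
        proof (cases "y \<in> C")
          case True then show ?thesis using xy(2) by simp
        next
          case yC: False
          show ?thesis
          proof (cases "x \<in> S")
            case True then show ?thesis using closed[OF True xy(3) yC] by simp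
          next
            case False
            then have x: "x \<in> C1" using xy(1) by simp
            then have "\<pi> y \<notin> ?X" using clabel[of x y] xy(3) yC C1C by auto
            moreover have "\<pi> y \<in> ?L" using labels xy(2) by simp
            ultimately have "nb x (\<pi> y) \<in> S" using x edge_label[OF xy(3)] unfolding C1_def by simp
            then show ?thesis using nb_eq[OF xy(3)] by simp
          qed
        qed
      qed
      then show ?thesis using S(1) C1C by auto
    qed
  qed
qed

end

section \<open>Corners of the wheels\<close>

lemma face_system_incident:
  assumes "face_system M F bd" "f \<in> F" "e \<in> bd f" "v \<in> e"
  shows "card (incident v (bd f)) = 2"
proof -
  have "\<forall>f\<in>F. is_cycle (bd f) \<and> bd f \<subseteq> M" using assms(1) unfolding face_system_def by (elim conjE)
  then have "is_cycle (bd f)" using assms(2) by simp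
  moreover have "v \<in> \<Union>(bd f)" using assms(3,4) by auto
  ultimately show ?thesis by (rule cycle_incident)
qed

lemma face_system_two_edges:
  assumes "face_system M F bd" "f \<in> F" "e1 \<in> bd f" "e2 \<in> bd f" "e \<in> bd f" "v \<in> e1" "v \<in> e2" "v \<in> e" "e1 \<noteq> e2"
  shows "e = e1 \<or> e = e2"
proof (rule ccontr)
  assume n: "\<not> ?thesis"
  have c: "card (incident v (bd f)) = 2" by (rule face_system_incident[OF assms(1,2,3,6)])
  then have "finite (incident v (bd f))" using card.infinite by fastforce
  moreover have "{e, e1, e2} \<subseteq> incident v (bd f)" using assms unfolding incident_def by simp
  ultimately have "card {e, e1, e2} \<le> 2" using card_mono c by metis
  then show False using n assms(9) by simp
qed

lemma face_system_second_edge: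
  assumes "face_system M F bd" "f \<in> F" "e \<in> bd f" "v \<in> e"
  obtains e' where "e' \<in> bd f" "v \<in> e'" "e' \<noteq> e"
proof -
  have c: "card (incident v (bd f)) = 2" by (rule face_system_incident[OF assms])
  have "\<not> incident v (bd f) \<subseteq> {e}"
  proof
    assume "incident v (bd f) \<subseteq> {e}"
    then have "card (incident v (bd f)) \<le> card {e}" by (intro card_mono) simp_all
    then show False using c by simp
  qed
  then show thesis using that unfolding incident_def by auto
qed

lemma face_system_two_faces:
  assumes "face_system M F bd" "e \<in> M" "f1 \<in> F" "e \<in> bd f1" "f2 \<in> F" "e \<in> bd f2" "f1 \<noteq> f2" "f \<in> F" "e \<in> bd f"
  shows "f = f1 \<or> f = f2"
proof (rule ccontr)
  assume n: "\<not> ?thesis"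
  have "\<forall>e\<in>M. card {f \<in> F. e \<in> bd f} = 2" using assms(1) unfolding face_system_def by (elim conjE)
  then have c: "card {f \<in> F. e \<in> bd f} = 2" using assms(2) by simp
  have "finite F" using assms(1) unfolding face_system_def by (elim conjE)
  then have "card {f, f1, f2} \<le> card {f \<in> F. e \<in> bd f}" using assms by (intro card_mono) simp_all
  then show False using n c assms(7) by simp
qed

lemma face_system_other_face:
  assumes "face_system M F bd" "e \<in> M"
  obtains f' where "f' \<in> F" "e \<in> bd f'" "f' \<noteq> f"
proof -
  have "\<forall>e\<in>M. card {f \<in> F. e \<in> bd f} = 2" using assms(1) unfolding face_system_def by (elim conjE)
  then have c: "card {f \<in> F. e \<in> bd f} = 2" using assms(2) by simp
  have "\<not> {f \<in> F. e \<in> bd f} \<subseteq> {f}"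
  proof
    assume "{f \<in> F. e \<in> bd f} \<subseteq> {f}"
    then have "card {f \<in> F. e \<in> bd f} \<le> card {f}" by (intro card_mono) simp_all
    then show False using c by simp
  qed
  then show thesis using that by auto
qed

lemma face_system_link:
  assumes "face_system M F bd" "S \<subseteq> incident v M" "S \<noteq> {}" "S \<noteq> incident v M"
  obtains f d e where "f \<in> F" "d \<in> bd f" "e \<in> bd f" "d \<in> S" "e \<in> incident v M" "e \<notin> S"
proof -
  have "\<forall>v S. S \<subseteq> incident v M \<longrightarrow> S \<noteq> {} \<longrightarrow> S \<noteq> incident v M \<longrightarrow>
    (\<exists>f\<in>F. \<exists>d\<in>bd f. \<exists>e\<in>bd f. d \<in> S \<and> e \<in> incident v M \<and> e \<notin> S)"
    using assms(1) unfolding face_system_def by (elim conjE)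
  then show thesis using assms(2-4) that by metis
qed

lemma less_6_cases: "(i::nat) < 6 \<Longrightarrow> i = 0 \<or> i = 1 \<or> i = 2 \<or> i = 3 \<or> i = 4 \<or> i = 5"
  by linarith

text \<open>The drawing is no longer visible here: all that is kept is the face system, the covering
  map, and the fact that each triangle at an apex vertex bounds a face. The rest of the argument is
  purely combinatorial.\<close>

locale wheel_faces = label_cover V E \<pi>
  for V :: "'a set" and E :: "'a set set" and \<pi> :: "'a \<Rightarrow> (nat \<times> bool) option" +
  fixes F :: "'f set" and bd :: "'f \<Rightarrow> 'a set set"
  assumes fs: "face_system E F bd"
    and cover_E: "\<Union>E = V"
    and triangle: "\<pi> a = None \<Longrightarrow> {a, v} \<in> E \<Longrightarrow> {a, w} \<in> E \<Longrightarrow> {v, w} \<in> E \<Longrightarrow>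
      \<exists>f\<in>F. bd f = {{a, v}, {a, w}, {v, w}}"
    and wheel: "a \<in> V \<Longrightarrow> \<pi> a = None \<Longrightarrow> \<exists>h::nat \<Rightarrow> 'a. bij_betw h {..<6} {w. {a, w} \<in> E} \<and>
      (\<forall>i<6. \<forall>j<6. {h i, h j} \<in> E \<longleftrightarrow> j = Suc i mod 6 \<or> i = Suc j mod 6)"
begin

lemma bd_E: "f \<in> F \<Longrightarrow> bd f \<subseteq> E"
proof -
  have "\<forall>f\<in>F. is_cycle (bd f) \<and> bd f \<subseteq> E" using fs unfolding face_system_def by (elim conjE)
  then show "f \<in> F \<Longrightarrow> bd f \<subseteq> E" by simp
qed

section \<open>Spokes, hexagon edges and external edges\<close>

definition U :: "'a set" where "U = {v \<in> V. \<pi> v \<noteq> None}"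

definition hub :: "'a \<Rightarrow> 'a" where "hub v = nb v None"

text \<open>
  An edge avoiding the apex vertices is a hexagon edge (\<open>hx\<close>) if its ends have the same hub, and
  external (\<open>ex\<close>) otherwise.
\<close>

definition hx :: "'a \<Rightarrow> 'a \<Rightarrow> bool" where
  "hx v w \<longleftrightarrow> {v, w} \<in> E \<and> v \<in> U \<and> w \<in> U \<and> hub v = hub w"

definition ex :: "'a \<Rightarrow> 'a \<Rightarrow> bool" where
  "ex v w \<longleftrightarrow> {v, w} \<in> E \<and> v \<in> U \<and> w \<in> U \<and> hub v \<noteq> hub w"

text \<open>The octahedral label, meaningful on \<open>U\<close>. Its first component names a pair
  of opposite octahedral vertices and the second a member of the pair; labels are adjacent exactly
  if their first components differ.\<close>

definition lb :: "'a \<Rightarrow> nat \<times> bool" where "lb v = the (\<pi> v)"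

lemma hx_sym: "hx v w \<Longrightarrow> hx w v" and ex_sym: "ex v w \<Longrightarrow> ex w v"
  by (auto simp: hx_def ex_def insert_commute)

lemma hx_not_ex: "hx v w \<Longrightarrow> \<not> ex v w"
  by (simp add: hx_def ex_def)

lemma U_label: "v \<in> U \<Longrightarrow> \<pi> v = Some (lb v) \<and> fst (lb v) < 3"
  using labels[of v] unfolding U_def lb_def pverts_K1222 by auto

lemma hub:
  assumes "v \<in> U"
  shows "{v, hub v} \<in> E" "\<pi> (hub v) = None" "hub v \<in> V" "hub v \<notin> U"
proof -
  have v: "v \<in> V" "None \<in> neighbours K1222 (\<pi> v)"
    using U_label[OF assms] assms by (auto simp: neighbours_K1222_Some U_def)
  show 1: "{v, hub v} \<in> E" "\<pi> (hub v) = None" unfolding hub_def using nb[OF v] by simp_all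
  then show "hub v \<in> V" "hub v \<notin> U" using edge_verts by (auto simp: U_def)
qed

lemma hub_eq: "v \<in> U \<Longrightarrow> {v, a} \<in> E \<Longrightarrow> \<pi> a = None \<Longrightarrow> a = hub v"
  using hub[of v] label_inj by metis

lemma apex_nb: "\<pi> a = None \<Longrightarrow> {a, w} \<in> E \<Longrightarrow> w \<in> U \<and> hub w = a"
proof -
  assume a: "\<pi> a = None" "{a, w} \<in> E"
  then have "\<pi> w \<noteq> None" using edge_label[OF a(2)] by (auto simp: neighbours_K1222_None)
  then have w: "w \<in> U" using edge_verts[OF a(2)] by (simp add: U_def)
  then show ?thesis using hub_eq[OF w, of a] a by (simp add: insert_commute)
qed

lemma U_edge_cases: "{v, w} \<in> E \<Longrightarrow> v \<in> U \<Longrightarrow> w = hub v \<or> hx v w \<or> ex v w"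
  using hub_eq[of v w] edge_verts[of v w] unfolding hx_def ex_def U_def by (auto simp del: not_None_eq)

lemma nb_labels: "hx v w \<or> ex v w \<Longrightarrow> fst (lb v) < 3 \<and> fst (lb w) < 3 \<and> fst (lb w) \<noteq> fst (lb v)"
proof -
  assume "hx v w \<or> ex v w"
  then have e: "{v, w} \<in> E" "v \<in> U" "w \<in> U" by (auto simp: hx_def ex_def)
  then show ?thesis using edge_label[OF e(1)] U_label[OF e(2)] U_label[OF e(3)] by (auto simp: neighbours_K1222_Some)
qed

lemma nb_label_inj: "hx v w \<or> ex v w \<Longrightarrow> hx v w' \<or> ex v w' \<Longrightarrow> lb w = lb w' \<Longrightarrow> w = w'"
proof -
  assume a: "hx v w \<or> ex v w" "hx v w' \<or> ex v w'" "lb w = lb w'"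
  then have "{v, w} \<in> E" "{v, w'} \<in> E" "w \<in> U" "w' \<in> U" by (auto simp: hx_def ex_def)
  then show ?thesis using label_inj[of v w w'] U_label[of w] U_label[of w'] a(3) by simp
qed

lemma card_U_nb:
  assumes "v \<in> U"
  shows "card {w \<in> U. {v, w} \<in> E} = 4"
proof -
  have v: "v \<in> V" "\<pi> v = Some (lb v)" "fst (lb v) < 3" using U_label[OF assms] assms by (simp_all add: U_def)
  have "bij_betw \<pi> {w. {v, w} \<in> E} (insert None (Some ` {y. fst y < 3 \<and> fst y \<noteq> fst (lb v)}))"
    using bij[OF v(1)] v by (simp add: neighbours_K1222_Some)
  then have b: "inj_on \<pi> {w. {v, w} \<in> E}" "\<pi> ` {w. {v, w} \<in> E} = insert None (Some ` {y. fst y < 3 \<and> fst y \<noteq> fst (lb v)})"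
    unfolding bij_betw_def by simp_all
  have "\<pi> ` {w \<in> U. {v, w} \<in> E} = \<pi> ` {w. {v, w} \<in> E} - {None}"
    using edge_verts by (auto simp: U_def)
  also have "\<dots> = Some ` (({..<3} - {fst (lb v)}) \<times> UNIV)" unfolding b(2) by auto
  finally have "card (\<pi> ` {w \<in> U. {v, w} \<in> E}) = 4"
    using v(3) by (simp add: card_image card_cartesian_product)
  moreover have "inj_on \<pi> {w \<in> U. {v, w} \<in> E}" by (rule inj_on_subset[OF b(1)]) auto
  ultimately show ?thesis by (simp add: card_image)
qed

definition hexagon :: "'a \<Rightarrow> (nat \<Rightarrow> 'a) \<Rightarrow> bool" where
  "hexagon a h \<longleftrightarrow> bij_betw h {..<6} {w. {a, w} \<in> E} \<and>
      (\<forall>i<6. \<forall>j<6. {h i, h j} \<in> E \<longleftrightarrow> j = Suc i mod 6 \<or> i = Suc j mod 6)"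

lemma hexagon_hx:
  assumes a: "a \<in> V" "\<pi> a = None" and h: "hexagon a h" and i: "i < 6"
  shows "h i \<in> U" "hub (h i) = a" "{w. hx (h i) w} = {h (Suc i mod 6), h ((i + 5) mod 6)}"
proof -
  have h1: "bij_betw h {..<6} {w. {a, w} \<in> E}" "\<And>i j. i < 6 \<Longrightarrow> j < 6 \<Longrightarrow> {h i, h j} \<in> E \<longleftrightarrow> j = Suc i mod 6 \<or> i = Suc j mod 6"
    using h unfolding hexagon_def by simp_all
  have im: "{a, h j} \<in> E" if "j < 6" for j using h1(1) that unfolding bij_betw_def by auto
  have hU: "h j \<in> U \<and> hub (h j) = a" if "j < 6" for j using apex_nb[OF a(2) im[OF that]] .
  show "h i \<in> U" "hub (h i) = a" using hU[OF i] by simp_all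
  \<comment> \<open>\<open>(i + 5) mod 6\<close> is the predecessor of \<open>i\<close> on the
    hexagon; subtraction on the naturals would fail at 0.\<close>
  have idx: "j = (i + 5) mod 6 \<longleftrightarrow> i = Suc j mod 6" if "j < 6" for j
    using less_6_cases[OF i] less_6_cases[OF that] by (elim disjE; simp)
  show "{w. hx (h i) w} = {h (Suc i mod 6), h ((i + 5) mod 6)}"
  proof (intro equalityI subsetI)
    fix w assume "w \<in> {w. hx (h i) w}"
    then have w: "{h i, w} \<in> E" "w \<in> U" "hub w = a" using hU[OF i] by (simp_all add: hx_def)
    then have "{a, w} \<in> E" using hub(1)[of w] by (simp add: insert_commute)
    then obtain j where j: "j < 6" "w = h j" using h1(1) unfolding bij_betw_def by auto
    then show "w \<in> {h (Suc i mod 6), h ((i + 5) mod 6)}" using h1(2)[OF i j(1)] w(1) idx[OF j(1)] by auto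
  next
    fix w assume "w \<in> {h (Suc i mod 6), h ((i + 5) mod 6)}"
    then obtain j where j: "w = h j" "j < 6" "j = Suc i mod 6 \<or> j = (i + 5) mod 6" by auto
    then show "w \<in> {w. hx (h i) w}" using h1(2)[OF i j(2)] idx[OF j(2)] hU[OF i] hU[OF j(2)] by (simp add: hx_def)
  qed
qed

lemma hx_two:
  assumes "v \<in> U"
  obtains a b where "a \<noteq> b" "{w. hx v w} = {a, b}"
proof -
  note hv = hub[OF assms]
  obtain h where h: "hexagon (hub v) h" using wheel[OF hv(3,2)] unfolding hexagon_def by auto
  have "{hub v, v} \<in> E" using hv(1) by (simp add: insert_commute)
  then have "v \<in> h ` {..<6}" using h unfolding hexagon_def bij_betw_def by simp
  then obtain i where i: "i < 6" "v = h i" by auto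
  have inj: "inj_on h {..<6}" using h unfolding hexagon_def bij_betw_def by simp
  have "Suc i mod 6 \<noteq> (i + 5) mod 6" using less_6_cases[OF i(1)] by (elim disjE; simp)
  then have "h (Suc i mod 6) \<noteq> h ((i + 5) mod 6)" using inj_onD[OF inj] by force
  then show thesis using that hexagon_hx(3)[OF hv(3,2) h i(1)] i(2) by metis
qed

lemma ex_two:
  assumes "v \<in> U"
  obtains x y where "x \<noteq> y" "{w. ex v w} = {x, y}"
proof -
  obtain a b where ab: "a \<noteq> b" "{w. hx v w} = {a, b}" by (rule hx_two[OF assms])
  have "{w \<in> U. {v, w} \<in> E} = {w. hx v w} \<union> {w. ex v w}"
    using assms by (auto simp: hx_def ex_def)
  moreover have "{w. hx v w} \<inter> {w. ex v w} = {}" by (auto simp: hx_def ex_def)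
  moreover have "finite {w \<in> U. {v, w} \<in> E}" using card_U_nb[OF assms] by (intro card_ge_0_finite) simp
  ultimately have "card {w. ex v w} = 2"
    using card_U_nb[OF assms] ab card_Un_disjoint[of "{w. hx v w}" "{w. ex v w}"] by simp
  then show thesis using that by (metis card_2_iff)
qed

lemma doubleton_neq: "x \<noteq> y \<Longrightarrow> {v, x} \<noteq> {v, y}"
  by (metis doubleton_eq_iff)

lemma triangle_at:
  assumes "hx v a"
  obtains f where "f \<in> F" "bd f = {{hub v, v}, {hub v, a}, {v, a}}"
    "{v, hub v} \<in> bd f" "{v, a} \<in> bd f"
proof -
  have v: "v \<in> U" "a \<in> U" "{v, a} \<in> E" "hub a = hub v" using assms by (auto simp: hx_def)
  have "{hub v, v} \<in> E" "{hub v, a} \<in> E" using hub(1)[OF v(1)] hub(1)[OF v(2)] v(4) by (simp_all add: insert_commute)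
  from triangle[OF hub(2)[OF v(1)] this v(3)] obtain f where f: "f \<in> F" "bd f = {{hub v, v}, {hub v, a}, {v, a}}" by auto
  have "{v, hub v} \<in> bd f" "{v, a} \<in> bd f" unfolding f(2) by (simp_all add: insert_commute)
  with f show thesis using that by blast
qed

section \<open>Cyclic order of the faces at a vertex\<close>

text \<open>These are the faces that survive the contraction of the wheels; by
  \<open>spoke_face\<close> all others are wheel triangles.\<close>

definition outer :: "'f set" where
  "outer = {f \<in> F. \<forall>e\<in>bd f. \<forall>c\<in>e. \<pi> c \<noteq> None}"

text \<open>Each spoke already borders the two wheel triangles at the hexagon edges of its outer
  end, and an edge borders only two faces.\<close>

lemma spoke_face:
  assumes f: "f \<in> F" "e \<in> bd f" "c \<in> e" "\<pi> c = None"
  obtains v w where "hx v w" "hub v = c" "bd f = {{c, v}, {c, w}, {v, w}}" 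
proof -
  have eE: "e \<in> E" using f bd_E by auto
  obtain v where v: "e = {c, v}" using edges[OF eE] f(3) by auto
  have vU: "v \<in> U" "hub v = c" using apex_nb[OF f(4)] eE v by auto
  obtain a b where ab: "a \<noteq> b" "{w. hx v w} = {a, b}" by (rule hx_two[OF vU(1)])
  have h: "hx v a" "hx v b" using ab(2) by auto
  obtain fa where fa: "fa \<in> F" "bd fa = {{hub v, v}, {hub v, a}, {v, a}}" "{v, hub v} \<in> bd fa" "{v, a} \<in> bd fa"
    by (rule triangle_at[OF h(1)])
  obtain fb where fb: "fb \<in> F" "bd fb = {{hub v, v}, {hub v, b}, {v, b}}" "{v, hub v} \<in> bd fb" "{v, b} \<in> bd fb"
    by (rule triangle_at[OF h(2)])
  have vn: "v \<noteq> hub v" "a \<noteq> v" "b \<noteq> v" "a \<noteq> hub v" "b \<noteq> hub v"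
    using hub(4)[OF vU(1)] vU(1) h edge_verts by (auto simp: hx_def)
  have "{v, a} \<notin> bd fb" unfolding fb(2) using ab(1) vn by (simp add: doubleton_eq_iff)
  then have "fa \<noteq> fb" using fa(4) by auto
  moreover have "{v, hub v} \<in> bd f" using f(2) v vU(2) by (simp add: insert_commute)
  ultimately have "f = fa \<or> f = fb"
    using face_system_two_faces[OF fs hub(1)[OF vU(1)] fa(1,3) fb(1,3) _ f(1)] by simp
  then show thesis using that[of v a] that[of v b] h fa(2) fb(2) vU(2) by auto
qed

lemma ex_face_outer:
  assumes "f \<in> F" "{v, x} \<in> bd f" "ex v x"
  shows "f \<in> outer"
proof (rule ccontr)
  assume "f \<notin> outer"
  then obtain e c where e: "e \<in> bd f" "c \<in> e" "\<pi> c = None" using assms(1) unfolding outer_def by blast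
  then obtain u w where uw: "hx u w" "hub u = c" "bd f = {{c, u}, {c, w}, {u, w}}"
    by (rule spoke_face[OF assms(1)])
  have "v \<in> U" "x \<in> U" using assms(3) by (auto simp: ex_def)
  then have "v \<noteq> c" "x \<noteq> c" using e(3) by (auto simp: U_def)
  then have "{v, x} = {u, w}" using assms(2) unfolding uw(3) by (auto simp: doubleton_eq_iff)
  then have "hx v x" using uw(1) hx_sym by (auto simp: doubleton_eq_iff)
  then show False using assms(3) hx_not_ex by simp
qed

text \<open>
  The cyclic order of the edges at v is spoke, a, x, y, b: the spoke lies in the two triangles, and
  connectedness of the link forces the remaining three faces.
\<close>

lemma corner_faces_oriented:
  assumes v: "v \<in> U" and hx: "{w. hx v w} = {a, b}" "a \<noteq> b" and ex: "{w. ex v w} = {x, y}" "x \<noteq> y"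
    and Ta: "Ta \<in> F" "{v, hub v} \<in> bd Ta" "{v, a} \<in> bd Ta"
    and Tb: "Tb \<in> F" "{v, hub v} \<in> bd Tb" "{v, b} \<in> bd Tb"
    and fa: "fa \<in> F" "{v, a} \<in> bd fa" "fa \<noteq> Ta" "{v, x} \<in> bd fa"
  shows "\<exists>fb g. fb \<in> F \<and> g \<in> F \<and> fb \<noteq> Tb \<and> g \<noteq> fa \<and> g \<noteq> fb \<and> {v, b} \<in> bd fb \<and> {v, y} \<in> bd fb \<and>
    {v, x} \<in> bd g \<and> {v, y} \<in> bd g"
proof -
  let ?s = "{v, hub v}" and ?a = "{v, a}" and ?b = "{v, b}" and ?x = "{v, x}" and ?y = "{v, y}"
  have m: "hx v a" "hx v b" "ex v x" "ex v y" using hx ex by auto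
  have ne: "hub v \<noteq> a" "hub v \<noteq> b" "hub v \<noteq> x" "hub v \<noteq> y"
    using hub(4)[OF v] m by (auto simp: hx_def ex_def)
  have ne2: "a \<noteq> x" "a \<noteq> y" "b \<noteq> x" "b \<noteq> y" using m hx_not_ex by auto
  have dist: "?s \<noteq> ?a" "?s \<noteq> ?b" "?s \<noteq> ?x" "?s \<noteq> ?y" "?a \<noteq> ?b" "?a \<noteq> ?x" "?a \<noteq> ?y" "?b \<noteq> ?x" "?b \<noteq> ?y" "?x \<noteq> ?y"
    using ne ne2 hx(2) ex(2) doubleton_neq by metis+
  have E: "?s \<in> E" "?a \<in> E" "?b \<in> E" "?x \<in> E" "?y \<in> E"
    using hub(1)[OF v] m by (auto simp: hx_def ex_def)
  have inc: "e = ?s \<or> e = ?a \<or> e = ?b \<or> e = ?x \<or> e = ?y" if e: "f \<in> F" "e \<in> bd f" "v \<in> e" for e f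
  proof -
    have eE: "e \<in> E" using e bd_E by auto
    then obtain w where w: "e = {v, w}" using edges[OF eE] e(3) by auto
    then have "w = hub v \<or> hx v w \<or> ex v w" using U_edge_cases eE v by simp
    then have "w = hub v \<or> w \<in> {a, b} \<or> w \<in> {x, y}" unfolding hx(1)[symmetric] ex(1)[symmetric] by simp
    then show ?thesis using w by auto
  qed
  have tw: "e = e1 \<or> e = e2" if "f \<in> F" "e1 \<in> bd f" "e2 \<in> bd f" "e1 \<noteq> e2" "v \<in> e1" "v \<in> e2" "e \<in> bd f" "v \<in> e" for f e1 e2 e
    using face_system_two_edges[OF fs that(1,2,3,7,5,6,8,4)] .
  have Ta': "e = ?s \<or> e = ?a" if "e \<in> bd Ta" "v \<in> e" for e using tw[OF Ta dist(1) _ _ that] by simp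
  have Tb': "e = ?s \<or> e = ?b" if "e \<in> bd Tb" "v \<in> e" for e using tw[OF Tb dist(2) _ _ that] by simp
  have fa': "e = ?a \<or> e = ?x" if "e \<in> bd fa" "v \<in> e" for e using tw[OF fa(1,2,4) dist(6) _ _ that] by simp
  have "Ta \<noteq> Tb" using Tb'[of ?a] Ta(3) dist by (metis insertI1)
  then have s_faces: "f = Ta \<or> f = Tb" if "f \<in> F" "?s \<in> bd f" for f
    using face_system_two_faces[OF fs E(1) Ta(1,2) Tb(1,2) _ that] by simp
  have a_faces: "f = Ta \<or> f = fa" if "f \<in> F" "?a \<in> bd f" for f
    using face_system_two_faces[OF fs E(2) Ta(1,3) fa(1,2) fa(3)[symmetric] that] .
  obtain fb where fb: "fb \<in> F" "?b \<in> bd fb" "fb \<noteq> Tb" by (rule face_system_other_face[OF fs E(3)])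
  have b_faces: "f = Tb \<or> f = fb" if "f \<in> F" "?b \<in> bd f" for f
    using face_system_two_faces[OF fs E(3) Tb(1,3) fb(1,2) fb(3)[symmetric] that] .
  have fbTa: "fb \<noteq> Ta" "fb \<noteq> fa" using Ta'[of ?b] fa'[of ?b] fb(2) dist by (metis insertI1)+
  obtain e2 where e2: "e2 \<in> bd fb" "v \<in> e2" "e2 \<noteq> ?b"
    by (rule face_system_second_edge[OF fs fb(1,2), of v]) auto
  \<comment> \<open>Both faces at each of \<open>?s\<close>, \<open>?a\<close> and \<open>?b\<close>
    are known by now, and among them only \<open>fb\<close> can contain \<open>?y\<close>.\<close>
  have ybad: False if f: "f \<in> F" "?y \<in> bd f" "e' \<in> bd f" "v \<in> e'" "e' \<noteq> ?y" "e' \<noteq> ?x" "f \<noteq> fb" for f e'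
  proof -
    have "f \<noteq> Ta" "f \<noteq> Tb" "f \<noteq> fa" using Ta'[of ?y] Tb'[of ?y] fa'[of ?y] f(2) dist by (metis insertI1)+
    moreover have "e' = ?s \<or> e' = ?a \<or> e' = ?b" using inc[OF f(1,3,4)] f(5,6) by metis
    ultimately show False using s_faces[OF f(1)] a_faces[OF f(1)] b_faces[OF f(1)] f(3,7) by metis
  qed
  have "e2 = ?y"
  proof (rule ccontr)
    \<comment> \<open>If \<open>fb\<close> turned from \<open>?b\<close> to \<open>?x\<close>, both
      faces at \<open>?x\<close> would be known, namely \<open>fa\<close> and \<open>fb\<close>. A
      face at \<open>?y\<close> other than \<open>fb\<close> can only turn to \<open>?x\<close>, so
      it would be \<open>fa\<close>, which does not contain \<open>?y\<close>.\<close>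
    assume n: "e2 \<noteq> ?y"
    have "e2 \<noteq> ?s" using s_faces[OF fb(1)] e2(1) fb(3) fbTa by metis
    moreover have "e2 \<noteq> ?a" using a_faces[OF fb(1)] e2(1) fbTa by metis
    ultimately have ex2: "e2 = ?x" using inc[OF fb(1) e2(1,2)] e2(3) n by metis
    have fb': "e = ?b \<or> e = ?x" if "e \<in> bd fb" "v \<in> e" for e
      using tw[OF fb(1,2) e2(1)[unfolded ex2] dist(8) _ _ that] by simp
    obtain f where f: "f \<in> F" "?y \<in> bd f" "f \<noteq> fb" by (rule face_system_other_face[OF fs E(5)])
    obtain e' where e': "e' \<in> bd f" "v \<in> e'" "e' \<noteq> ?y"
      by (rule face_system_second_edge[OF fs f(1,2), of v]) auto
    have "e' = ?x" using ybad[OF f(1,2) e' _ f(3)] by blast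
    then have "f = fa \<or> f = fb"
      using face_system_two_faces[OF fs E(4) fa(1,4) fb(1) _ _ f(1)] e2(1) ex2 fbTa(2) e'(1) by metis
    then show False using f(3) fa'[of ?y] f(2) dist by (metis insertI1)
  qed
  then have yb: "?y \<in> bd fb" using e2(1) by simp
  obtain g where g: "g \<in> F" "?y \<in> bd g" "g \<noteq> fb" by (rule face_system_other_face[OF fs E(5)])
  obtain e' where e': "e' \<in> bd g" "v \<in> e'" "e' \<noteq> ?y"
    by (rule face_system_second_edge[OF fs g(1,2), of v]) auto
  have "e' = ?x" using ybad[OF g(1,2) e' _ g(3)] by blast
  moreover have "g \<noteq> fa" using fa'[of ?y] g(2) dist by (metis insertI1)
  ultimately show ?thesis using fb g yb e'(1) by blast
qed

text \<open>Connectedness of the link gives a face that turns at \<open>v\<close> from the spoke or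
  a hexagon edge to an external edge. The faces of the spoke are the wheel triangles, so it turns
  from a hexagon edge. The four possible pairs of edges are symmetric under exchanging
  \<open>a\<close> with \<open>b\<close> and \<open>x\<close> with \<open>y\<close>.\<close>

lemma corner_faces:
  assumes v: "v \<in> U" and hx: "{w. hx v w} = {a, b}" "a \<noteq> b"
  obtains x y fa fb g where "{w. ex v w} = {x, y}" "x \<noteq> y" "fa \<in> outer" "fb \<in> outer" "g \<in> outer"
    "{v, a} \<in> bd fa" "{v, x} \<in> bd fa" "{v, b} \<in> bd fb" "{v, y} \<in> bd fb" "{v, x} \<in> bd g" "{v, y} \<in> bd g"
    "g \<noteq> fa" "g \<noteq> fb"
proof -
  obtain x y where ex: "{w. ex v w} = {x, y}" "x \<noteq> y" using ex_two[OF v] by metis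
  have m: "hx v a" "hx v b" "ex v x" "ex v y" using hx ex by auto
  obtain Ta where Ta: "Ta \<in> F" "bd Ta = {{hub v, v}, {hub v, a}, {v, a}}" "{v, hub v} \<in> bd Ta" "{v, a} \<in> bd Ta"
    by (rule triangle_at[OF m(1)])
  obtain Tb where Tb: "Tb \<in> F" "bd Tb = {{hub v, v}, {hub v, b}, {v, b}}" "{v, hub v} \<in> bd Tb" "{v, b} \<in> bd Tb"
    by (rule triangle_at[OF m(2)])
  have E: "{v, hub v} \<in> E" "{v, a} \<in> E" "{v, b} \<in> E" "{v, x} \<in> E" "{v, y} \<in> E"
    using hub(1)[OF v] m by (auto simp: hx_def ex_def)
  let ?S = "{{v, hub v}, {v, a}, {v, b}}"
  have ne: "x \<noteq> hub v" "x \<noteq> a" "x \<noteq> b" "y \<noteq> hub v" "y \<noteq> a" "y \<noteq> b"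
    using hub(4)[OF v] m hx_not_ex by (auto simp: hx_def ex_def)
  have xS: "{v, x} \<notin> ?S" "{v, y} \<notin> ?S" using ne doubleton_neq by (metis insertE emptyE)+
  have "?S \<subseteq> incident v E" "{v, x} \<in> incident v E" using E by (auto simp: incident_def)
  moreover from this have "?S \<noteq> incident v E" using xS(1) by metis
  ultimately obtain f d e where f: "f \<in> F" "d \<in> bd f" "e \<in> bd f" "d \<in> ?S" "e \<in> incident v E" "e \<notin> ?S"
    using face_system_link[OF fs, of ?S v] by (metis insert_not_empty)
  have exy: "e = {v, x} \<or> e = {v, y}"
  proof -
    have eE: "e \<in> E" "v \<in> e" using f(5) by (auto simp: incident_def)
    then obtain w where w: "e = {v, w}" using edges[OF eE(1)] by auto
    then have "w = hub v \<or> hx v w \<or> ex v w" using U_edge_cases eE v by simp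
    then have "w = hub v \<or> w \<in> {a, b} \<or> w \<in> {x, y}" unfolding hx(1)[symmetric] ex(1)[symmetric] by simp
    then show ?thesis using w f(6) by auto
  qed
  have sface: "g = Ta \<or> g = Tb" if "g \<in> F" "{v, hub v} \<in> bd g" for g
  proof -
    have "{v, a} \<notin> bd Tb" unfolding Tb(2) using m hx(2) hub(4)[OF v] edge_verts
      by (auto simp: doubleton_eq_iff hx_def)
    then have "Ta \<noteq> Tb" using Ta(4) by auto
    then show ?thesis using face_system_two_faces[OF fs E(1) Ta(1,3) Tb(1,3) _ that] by simp
  qed
  have xT: "{v, z} \<notin> bd Ta" "{v, z} \<notin> bd Tb" if "z = x \<or> z = y" for z
    unfolding Ta(2) Tb(2) using that m ne hub(4)[OF v] edge_verts by (auto simp: doubleton_eq_iff hx_def ex_def)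
  have fT: "f \<noteq> Ta" "f \<noteq> Tb" using xT exy f(3) by blast+
  have "d \<noteq> {v, hub v}" using sface[OF f(1)] f(2) fT by auto
  then have dab: "d = {v, a} \<or> d = {v, b}" using f(4) by simp
  have ex': "{w. ex v w} = {y, x}" "y \<noteq> x" using ex by auto
  have hx': "{w. hx v w} = {b, a}" "b \<noteq> a" using hx by auto
  have oc: "h \<in> outer" if "h \<in> F" "{v, z} \<in> bd h" "z = x \<or> z = y" for h z
    using ex_face_outer[OF that(1,2)] m that(3) by auto
  show thesis
  proof (cases "d = {v, a}")
    case da: True
    show thesis
    proof (cases "e = {v, x}")
      case True
      obtain fb g where "fb \<in> F" "g \<in> F" "g \<noteq> f" "g \<noteq> fb" "{v, b} \<in> bd fb" "{v, y} \<in> bd fb" "{v, x} \<in> bd g" "{v, y} \<in> bd g"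
        using corner_faces_oriented[OF v hx ex Ta(1,3,4) Tb(1,3,4) f(1) f(2)[unfolded da] fT(1) f(3)[unfolded True]] by auto
      then show thesis using that[OF ex, of f fb g] oc f(1-3) da True by simp
    next
      case False
      then have e: "e = {v, y}" using exy by simp
      obtain fb g where "fb \<in> F" "g \<in> F" "g \<noteq> f" "g \<noteq> fb" "{v, b} \<in> bd fb" "{v, x} \<in> bd fb" "{v, y} \<in> bd g" "{v, x} \<in> bd g"
        using corner_faces_oriented[OF v hx ex' Ta(1,3,4) Tb(1,3,4) f(1) f(2)[unfolded da] fT(1) f(3)[unfolded e]] by auto
      then show thesis using that[OF ex', of f fb g] oc f(1-3) da e by simp
    qed
  next
    case False
    then have db: "d = {v, b}" using dab by simp
    show thesis
    proof (cases "e = {v, x}")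
      case True
      obtain fb g where "fb \<in> F" "g \<in> F" "g \<noteq> f" "g \<noteq> fb" "{v, a} \<in> bd fb" "{v, y} \<in> bd fb" "{v, x} \<in> bd g" "{v, y} \<in> bd g"
        using corner_faces_oriented[OF v hx' ex Tb(1,3,4) Ta(1,3,4) f(1) f(2)[unfolded db] fT(2) f(3)[unfolded True]] by auto
      then show thesis using that[OF ex', of fb f g] oc f(1-3) db True by simp
    next
      case False
      then have e: "e = {v, y}" using exy by simp
      obtain fb g where "fb \<in> F" "g \<in> F" "g \<noteq> f" "g \<noteq> fb" "{v, a} \<in> bd fb" "{v, x} \<in> bd fb" "{v, y} \<in> bd g" "{v, x} \<in> bd g"
        using corner_faces_oriented[OF v hx' ex' Tb(1,3,4) Ta(1,3,4) f(1) f(2)[unfolded db] fT(2) f(3)[unfolded e]] by auto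
      then show thesis using that[OF ex, of fb f g] oc f(1-3) db e by simp
    qed
  qed
qed

section \<open>Digons\<close>

text \<open>
  \<open>EF v w\<close> is the outer face at the hexagon edge v w, \<open>VF v\<close> the face between the two external edges at v,
  and \<open>nx v w\<close> the external neighbour of v next to w in the cyclic order around v.
\<close>

definition EF :: "'a \<Rightarrow> 'a \<Rightarrow> 'f" where
  "EF v w = (THE f. f \<in> outer \<and> {v, w} \<in> bd f)"

definition VF :: "'a \<Rightarrow> 'f" where
  "VF v = (THE f. f \<in> F \<and> (\<forall>x. ex v x \<longrightarrow> {v, x} \<in> bd f))"

definition nx :: "'a \<Rightarrow> 'a \<Rightarrow> 'a" where
  "nx v w = (THE x. ex v x \<and> {v, x} \<in> bd (EF v w))"

lemma outer_F: "f \<in> outer \<Longrightarrow> f \<in> F"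
  by (simp add: outer_def)

lemma hx_outer_unique:
  assumes "hx v a" "f \<in> outer" "{v, a} \<in> bd f" "g \<in> outer" "{v, a} \<in> bd g"
  shows "f = g"
proof -
  obtain T where T: "T \<in> F" "bd T = {{hub v, v}, {hub v, a}, {v, a}}" "{v, hub v} \<in> bd T" "{v, a} \<in> bd T"
    by (rule triangle_at[OF assms(1)])
  have v: "v \<in> U" "{v, a} \<in> E" using assms(1) by (simp_all add: hx_def)
  have "T \<notin> outer" using T(3) hub(2)[OF v(1)] unfolding outer_def by blast
  then show ?thesis
    using face_system_two_faces[OF fs v(2) T(1,4) outer_F[OF assms(2)] assms(3) _ outer_F[OF assms(4)] assms(5)] assms(2,4)
    by metis
qed

lemma EF_sym: "EF v w = EF w v"
  unfolding EF_def by (simp add: insert_commute)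

text \<open>Shows that the definite descriptions \<open>EF\<close>, \<open>VF\<close> and
  \<open>nx\<close> denote: the outer faces at \<open>v\<close> are told apart by which two of the
  edges at \<open>v\<close> they contain.\<close>

lemma corner:
  assumes "hx v a" "hx v b" "a \<noteq> b"
  shows "EF v a \<in> outer" "{v, a} \<in> bd (EF v a)" "VF v \<in> outer" "EF v a \<noteq> VF v"
    "ex v (nx v a)" "{v, nx v a} \<in> bd (EF v a)" "nx v a \<noteq> nx v b"
    "\<And>x. ex v x \<Longrightarrow> x = nx v a \<or> x = nx v b"
    "\<And>x. ex v x \<Longrightarrow> {v, x} \<in> bd (VF v)"
    "\<And>x. ex v x \<Longrightarrow> {v, x} \<in> bd (EF v a) \<Longrightarrow> x = nx v a"
    "\<And>f. f \<in> F \<Longrightarrow> {v, nx v a} \<in> bd f \<Longrightarrow> f = EF v a \<or> f = VF v"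
proof -
  have vU: "v \<in> U" using assms by (simp add: hx_def)
  obtain a' b' where ab': "a' \<noteq> b'" "{w. hx v w} = {a', b'}" by (rule hx_two[OF vU])
  have "a \<in> {a', b'}" "b \<in> {a', b'}" unfolding ab'(2)[symmetric] using assms by simp_all
  then have hx2: "{w. hx v w} = {a, b}" unfolding ab'(2) using assms(3) by auto
  obtain x y fa fb g where c: "{w. ex v w} = {x, y}" "x \<noteq> y" "fa \<in> outer" "fb \<in> outer" "g \<in> outer"
    "{v, a} \<in> bd fa" "{v, x} \<in> bd fa" "{v, b} \<in> bd fb" "{v, y} \<in> bd fb" "{v, x} \<in> bd g" "{v, y} \<in> bd g"
    "g \<noteq> fa" "g \<noteq> fb"
    by (rule corner_faces[OF vU hx2 assms(3)])
  have xy: "ex v x" "ex v y" using c(1) by auto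
  have exs: "z = x \<or> z = y" if "ex v z" for z
  proof -
    have "z \<in> {w. ex v w}" using that by simp
    then show ?thesis unfolding c(1) by simp
  qed
  have E: "{v, x} \<in> E" "{v, y} \<in> E" using xy by (simp_all add: ex_def)
  have ne: "a \<noteq> x" "a \<noteq> y" "b \<noteq> x" "b \<noteq> y" using assms xy hx_not_ex by auto
  have ya: "{v, y} \<notin> bd fa"
    using face_system_two_edges[OF fs outer_F[OF c(3)] c(6,7), of "{v, y}" v] doubleton_neq ne c(2) by (metis insertI1)
  have xb: "{v, x} \<notin> bd fb"
    using face_system_two_edges[OF fs outer_F[OF c(4)] c(8,9), of "{v, x}" v] doubleton_neq ne c(2) by (metis insertI1)
  have EFa: "EF v a = fa" unfolding EF_def
    by (rule the_equality) (use c(3,6) hx_outer_unique[OF assms(1)] in blast)+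
  have EFb: "EF v b = fb" unfolding EF_def
    by (rule the_equality) (use c(4,8) hx_outer_unique[OF assms(2)] in blast)+
  have xf: "f = fa \<or> f = g" if "f \<in> F" "{v, x} \<in> bd f" for f
    using face_system_two_faces[OF fs E(1) outer_F[OF c(3)] c(7) outer_F[OF c(5)] c(10) c(12)[symmetric] that] .
  have VFg: "VF v = g" unfolding VF_def
  proof (rule the_equality)
    show "g \<in> F \<and> (\<forall>x. ex v x \<longrightarrow> {v, x} \<in> bd g)" using outer_F[OF c(5)] exs c(10,11) by auto
    fix f assume "f \<in> F \<and> (\<forall>x. ex v x \<longrightarrow> {v, x} \<in> bd f)"
    then have "f \<in> F" "{v, x} \<in> bd f" "{v, y} \<in> bd f" using xy by simp_all
    then show "f = g" using xf ya by metis
  qed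
  have nxa: "nx v a = x" unfolding nx_def EFa
    by (rule the_equality) (use xy c(7) exs ya in blast)+
  have nxb: "nx v b = y" unfolding nx_def EFb
    by (rule the_equality) (use xy c(9) exs xb in blast)+
  show "EF v a \<in> outer" "{v, a} \<in> bd (EF v a)" "VF v \<in> outer" "EF v a \<noteq> VF v"
    "ex v (nx v a)" "{v, nx v a} \<in> bd (EF v a)" "nx v a \<noteq> nx v b"
    unfolding EFa VFg nxa nxb using c xy by auto
  show "z = nx v a \<or> z = nx v b" if "ex v z" for z using exs[OF that] unfolding nxa nxb .
  show "{v, z} \<in> bd (VF v)" if "ex v z" for z using exs[OF that] c(10,11) unfolding VFg by auto
  show "z = nx v a" if "ex v z" "{v, z} \<in> bd (EF v a)" for z
    using exs[OF that(1)] that(2) ya unfolding EFa nxa by auto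
  show "f = EF v a \<or> f = VF v" if "f \<in> F" "{v, nx v a} \<in> bd f" for f
    using xf that unfolding nxa EFa VFg by simp
qed

lemma other_hx: "hx v a \<Longrightarrow> \<exists>b. hx v b \<and> b \<noteq> a"
proof -
  assume h: "hx v a"
  then have "v \<in> U" by (simp add: hx_def)
  then obtain c d where cd: "c \<noteq> d" "{w. hx v w} = {c, d}" by (rule hx_two)
  then have "hx v c" "hx v d" by auto
  then show ?thesis using cd(1) by metis
qed

lemma hx_ex: "v \<in> U \<Longrightarrow> \<exists>a. hx v a"
  using hx_two by (metis insertI1 mem_Collect_eq)

lemma EF_outer: "hx v a \<Longrightarrow> EF v a \<in> outer"
  and EF_hx: "hx v a \<Longrightarrow> {v, a} \<in> bd (EF v a)"
  and EF_neq_VF: "hx v a \<Longrightarrow> EF v a \<noteq> VF v"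
  and nx_ex: "hx v a \<Longrightarrow> ex v (nx v a)"
  and nx_bd: "hx v a \<Longrightarrow> {v, nx v a} \<in> bd (EF v a)"
  and nx_eqI: "hx v a \<Longrightarrow> ex v x \<Longrightarrow> {v, x} \<in> bd (EF v a) \<Longrightarrow> nx v a = x"
  and nx_faces: "hx v a \<Longrightarrow> f \<in> F \<Longrightarrow> {v, nx v a} \<in> bd f \<Longrightarrow> f = EF v a \<or> f = VF v"
  using other_hx[of v a] corner[of v a] by metis+

lemma VF_outer: "v \<in> U \<Longrightarrow> VF v \<in> outer"
  using hx_ex[of v] other_hx corner(3) by metis

lemma VF_bd: "ex v x \<Longrightarrow> {v, x} \<in> bd (VF v)"
  using hx_ex[of v] other_hx corner(9) by (metis ex_def)

lemma nx_cases: "ex v x \<Longrightarrow> hx v a \<Longrightarrow> hx v b \<Longrightarrow> a \<noteq> b \<Longrightarrow> x = nx v a \<or> x = nx v b"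
  using corner(8) by metis

lemma nx_neq: "hx v a \<Longrightarrow> hx v b \<Longrightarrow> a \<noteq> b \<Longrightarrow> nx v a \<noteq> nx v b"
  using corner(7) by metis

lemma EF_eqI: "hx v a \<Longrightarrow> f \<in> outer \<Longrightarrow> {v, a} \<in> bd f \<Longrightarrow> f = EF v a"
  using hx_outer_unique[of v a f "EF v a"] EF_outer[of v a] EF_hx[of v a] by simp

text \<open>
  Contracting every wheel to a point turns f into a face of length \<open>k f\<close>; below, a digon is a face
  with \<open>k f = 2\<close>.
\<close>

definition xedges :: "'f \<Rightarrow> 'a set set" where
  "xedges f = {e \<in> bd f. \<exists>v x. ex v x \<and> e = {v, x}}"

definition k :: "'f \<Rightarrow> nat" where "k f = card (xedges f)"

lemma xedgesI: "{v, x} \<in> bd f \<Longrightarrow> ex v x \<Longrightarrow> {v, x} \<in> xedges f"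
  by (auto simp: xedges_def)

lemma finite_xedges: "f \<in> F \<Longrightarrow> finite (xedges f)"
proof -
  assume "f \<in> F"
  moreover have "finite E" using fs unfolding face_system_def by (elim conjE)
  ultimately have "finite (bd f)" using bd_E finite_subset by metis
  then show ?thesis unfolding xedges_def by simp
qed

lemma xedges_two: "k f = 2 \<Longrightarrow> e1 \<in> xedges f \<Longrightarrow> e2 \<in> xedges f \<Longrightarrow> e1 \<noteq> e2 \<Longrightarrow> e \<in> xedges f \<Longrightarrow> e = e1 \<or> e = e2"
proof (rule ccontr)
  assume a: "k f = 2" "e1 \<in> xedges f" "e2 \<in> xedges f" "e1 \<noteq> e2" "e \<in> xedges f" "\<not> (e = e1 \<or> e = e2)"
  have "finite (xedges f)" using a(1) unfolding k_def by (intro card_ge_0_finite) simp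
  then have "card {e, e1, e2} \<le> k f" unfolding k_def using a by (intro card_mono) simp_all
  then show False using a by simp
qed

text \<open>One step along the boundary of an outer face. No apex vertex lies on it, so the next
  edge is not a spoke. Digons are explored by such steps.\<close>

lemma outer_next:
  assumes "f \<in> outer" "{v, x} \<in> bd f"
  obtains c where "{x, c} \<in> bd f" "c \<noteq> v" "hx x c \<or> ex x c"
proof -
  have f: "f \<in> F" using assms(1) by (rule outer_F)
  obtain e where e: "e \<in> bd f" "x \<in> e" "e \<noteq> {v, x}"
    by (rule face_system_second_edge[OF fs f assms(2), of x]) auto
  have eE: "e \<in> E" using e(1) bd_E[OF f] by auto
  obtain c where c: "e = {x, c}" using edges[OF eE] e(2) by auto
  have "\<pi> x \<noteq> None" "\<pi> c \<noteq> None" using assms(1) e(1) c unfolding outer_def by auto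
  then have "x \<in> U" "c \<in> U" using edge_verts eE c by (auto simp: U_def)
  then have "hx x c \<or> ex x c" using eE c by (auto simp: hx_def ex_def)
  moreover have "c \<noteq> v" using e(3) c by (auto simp: insert_commute)
  ultimately show thesis using that e(1) c by simp
qed

lemma EF_xedges:
  assumes "hx v w"
  shows "{v, nx v w} \<in> xedges (EF v w)" "{w, nx w v} \<in> xedges (EF v w)" "{v, nx v w} \<noteq> {w, nx w v}"
proof -
  have h': "hx w v" using assms by (rule hx_sym)
  show "{v, nx v w} \<in> xedges (EF v w)" using nx_bd[OF assms] nx_ex[OF assms] by (rule xedgesI)
  show "{w, nx w v} \<in> xedges (EF v w)" using nx_bd[OF h'] nx_ex[OF h'] EF_sym[of v w] by (simp add: xedgesI)
  have "nx v w \<noteq> w" "v \<noteq> w" using nx_ex[OF assms] hx_not_ex[OF assms] edge_verts assms by (auto simp: hx_def)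
  then show "{v, nx v w} \<noteq> {w, nx w v}" by (auto simp: doubleton_eq_iff)
qed

section \<open>Shapes of digons before contraction\<close>

text \<open>A digon at a hexagon edge comes from a triangle or a quadrangle. Its two external edges
  are those at \<open>v\<close> and \<open>w\<close>. Past \<open>nx v w\<close> the boundary either
  continues with an external edge, which must be the one to \<open>w\<close>, or with a hexagon
  edge, whose far end carries an external edge of the same face and so is
  \<open>nx w v\<close>.\<close>

lemma EF_digon:
  assumes h: "hx v w" and k: "k (EF v w) = 2"
  shows "nx v w = nx w v \<or> hx (nx v w) (nx w v) \<and> EF v w = EF (nx v w) (nx w v)"
proof -
  let ?f = "EF v w" and ?x = "nx v w" and ?z = "nx w v"
  have h': "hx w v" using h by (rule hx_sym)
  have x: "ex v ?x" "ex w ?z" using nx_ex h h' by auto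
  have only: "e = {v, ?x} \<or> e = {w, ?z}" if "e \<in> xedges ?f" for e
    using xedges_two[OF k EF_xedges[OF h] that] .
  obtain c where c: "{?x, c} \<in> bd ?f" "c \<noteq> v" "hx ?x c \<or> ex ?x c"
    by (rule outer_next[OF EF_outer[OF h] nx_bd[OF h]])
  have xw: "?x \<noteq> w" "?x \<noteq> v" using x(1) hx_not_ex[OF h] edge_verts by (auto simp: ex_def)
  show ?thesis
  proof (cases "ex ?x c")
    case True
    then have "{?x, c} = {v, ?x} \<or> {?x, c} = {w, ?z}" using only xedgesI[OF c(1)] by simp
    then show ?thesis using c(2) xw by (auto simp: doubleton_eq_iff)
  next
    case False
    then have hc: "hx ?x c" using c(3) by simp
    then have f: "?f = EF ?x c" using EF_eqI EF_outer[OF h] c(1) by simp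
    have hc': "hx c ?x" using hc by (rule hx_sym)
    have "{c, nx c ?x} \<in> xedges ?f" using nx_bd[OF hc'] nx_ex[OF hc'] f EF_sym[of c ?x] xedgesI by simp
    then have "{c, nx c ?x} = {v, ?x} \<or> {c, nx c ?x} = {w, ?z}" using only by simp
    moreover have "c \<noteq> ?x" using hc edge_verts by (auto simp: hx_def)
    ultimately have "c = w \<or> c = ?z" using c(2) by (auto simp: doubleton_eq_iff)
    moreover have "c \<noteq> w" using hc h x(1) by (auto simp: hx_def ex_def)
    ultimately show ?thesis using hc f by auto
  qed
qed

text \<open>A digon at a vertex always comes from a triangle: both external edges meet at
  \<open>v\<close>, so past \<open>x\<close> there follows a hexagon edge, and its far end carries
  the other external edge, which is the one to \<open>y\<close>.\<close>

lemma VF_digon: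
  assumes x: "ex v x" "ex v y" "x \<noteq> y" and k: "k (VF v) = 2"
  shows "hx x y \<and> VF v = EF x y"
proof -
  let ?f = "VF v"
  have vU: "v \<in> U" using x by (simp add: ex_def)
  have b: "{v, x} \<in> bd ?f" "{v, y} \<in> bd ?f" using VF_bd x by simp_all
  have only: "e = {v, x} \<or> e = {v, y}" if "e \<in> xedges ?f" for e
    using xedges_two[OF k xedgesI[OF b(1) x(1)] xedgesI[OF b(2) x(2)] doubleton_neq[OF x(3)] that] .
  obtain c where c: "{x, c} \<in> bd ?f" "c \<noteq> v" "hx x c \<or> ex x c"
    by (rule outer_next[OF VF_outer[OF vU] b(1)])
  have xv: "x \<noteq> v" using x(1) edge_verts by (auto simp: ex_def)
  have "\<not> ex x c"
  proof
    assume "ex x c"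
    then have "{x, c} = {v, x} \<or> {x, c} = {v, y}" using only xedgesI[OF c(1)] by simp
    then show False using c(2) xv x(3) by (auto simp: doubleton_eq_iff)
  qed
  then have hc: "hx x c" using c(3) by simp
  then have f: "?f = EF x c" using EF_eqI VF_outer[OF vU] c(1) by simp
  have hc': "hx c x" using hc by (rule hx_sym)
  have "{c, nx c x} \<in> xedges ?f" using nx_bd[OF hc'] nx_ex[OF hc'] f EF_sym[of c x] xedgesI by simp
  then have "{c, nx c x} = {v, x} \<or> {c, nx c x} = {v, y}" using only by simp
  moreover have "c \<noteq> x" using hc edge_verts by (auto simp: hx_def)
  ultimately have "c = y" using c(2) by (auto simp: doubleton_eq_iff)
  then show ?thesis using hc f by simp
qed

lemma k_ge_2: "hx v w \<Longrightarrow> 2 \<le> k (EF v w)" "v \<in> U \<Longrightarrow> 2 \<le> k (VF v)"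
proof -
  have *: "2 \<le> k f" if "f \<in> F" "e1 \<in> xedges f" "e2 \<in> xedges f" "e1 \<noteq> e2" for f e1 e2
  proof -
    have "card {e1, e2} \<le> k f" unfolding k_def using that finite_xedges by (intro card_mono) simp_all
    then show ?thesis using that(4) by simp
  qed
  show "hx v w \<Longrightarrow> 2 \<le> k (EF v w)" using *[OF outer_F[OF EF_outer]] EF_xedges by metis
  assume v: "v \<in> U"
  obtain x y where "x \<noteq> y" "{w. ex v w} = {x, y}" by (rule ex_two[OF v])
  then have "x \<noteq> y" "ex v x" "ex v y" by auto
  then show "2 \<le> k (VF v)" using *[OF outer_F[OF VF_outer[OF v]]] xedgesI VF_bd doubleton_neq by metis
qed

lemma k_ge_4:
  assumes "f \<in> F" "{a1, b1} \<in> xedges f" "{a2, b2} \<in> xedges f" "{a3, b3} \<in> xedges f" "{a4, b4} \<in> xedges f"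
    "distinct [{a1, b1}, {a2, b2}, {a3, b3}, {a4, b4}]"
  shows "4 \<le> k f"
proof -
  have "card (set [{a1, b1}, {a2, b2}, {a3, b3}, {a4, b4}]) \<le> k f"
    unfolding k_def using assms finite_xedges by (intro card_mono) simp_all
  then show ?thesis unfolding distinct_card[OF assms(6)] by simp
qed

lemma VF_xedges: "ex v x \<Longrightarrow> {v, x} \<in> xedges (VF v)"
  using VF_bd xedgesI by simp

text \<open>A quadrangle is a digon at a hexagon edge for both wheels it touches. The edge from
  \<open>v\<close> to \<open>x\<close> borders only this digon and \<open>VF v\<close>; the digon is
  a hexagon-edge face at \<open>x\<close>, so the vertex face of \<open>x\<close> is the other
  one.\<close>

lemma EF_digon_square:
  assumes "hx v w" "k (EF v w) = 2" "nx v w \<noteq> nx w v"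
  defines "x \<equiv> nx v w" and "z \<equiv> nx w v"
  shows "hx x z" "EF v w = EF x z" "nx x z = v" "VF x = VF v"
proof -
  show hz: "hx x z" "EF v w = EF x z" using EF_digon[OF assms(1,2)] assms(3) unfolding x_def z_def by simp_all
  have ev: "ex v x" unfolding x_def using nx_ex[OF assms(1)] .
  then have xv: "ex x v" by (rule ex_sym)
  have "{v, x} \<in> bd (EF v w)" unfolding x_def by (rule nx_bd[OF assms(1)])
  then have b: "{x, v} \<in> bd (EF x z)" unfolding hz(2) by (simp only: insert_commute)
  show nxz: "nx x z = v" by (rule nx_eqI[OF hz(1) xv b])
  have xU: "x \<in> U" using xv by (simp add: ex_def)
  have "{v, nx v w} \<in> bd (VF x)" using VF_bd[OF xv] unfolding x_def by (simp add: insert_commute)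
  then have "VF x = EF v w \<or> VF x = VF v" by (rule nx_faces[OF assms(1) outer_F[OF VF_outer[OF xU]]])
  then show "VF x = VF v" using EF_neq_VF[OF hz(1)] hz(2) by auto
qed

text \<open>Put \<open>x = nx v u\<close> and \<open>y = nx v w\<close>. The digon at
  \<open>v\<close> makes \<open>x\<close> and \<open>y\<close> hexagon neighbours with
  \<open>nx x y = v\<close>. If the digon at \<open>u\<close> and \<open>v\<close> were a
  quadrangle, a second hexagon neighbour of \<open>x\<close> would also have \<open>v\<close> as its
  next external neighbour, which \<open>nx_neq\<close> forbids.\<close>

lemma two_digons_triangle:
  assumes "hx u v" "hx v w" "u \<noteq> w" "k (EF u v) = 2" "k (VF v) = 2"
  shows "nx u v = nx v u" "hx (nx v u) (nx v w)" "VF v = EF (nx v u) (nx v w)"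
proof -
  let ?x = "nx v u" and ?y = "nx v w"
  have vu: "hx v u" using assms(1) by (rule hx_sym)
  have x: "ex v ?x" "ex v ?y" "?x \<noteq> ?y" using nx_ex vu assms(2) nx_neq[OF vu assms(2,3)] by auto
  show xy: "hx ?x ?y" "VF v = EF ?x ?y" using VF_digon[OF x assms(5)] by simp_all
  show "nx u v = nx v u"
  proof (rule ccontr)
    assume n: "nx u v \<noteq> nx v u"
    have k: "k (EF v u) = 2" using assms(4) EF_sym by metis
    note sq = EF_digon_square[OF vu k n[symmetric]]
    have "nx ?x ?y = v"
      using nx_eqI[OF xy(1) ex_sym[OF x(1)]] VF_bd[OF x(1)] xy(2) by (simp add: insert_commute)
    moreover have "nx u v \<noteq> ?y" using sq(2) xy(2) EF_neq_VF[OF vu] by auto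
    ultimately show False using nx_neq[OF sq(1) xy(1)] sq(3) by simp
  qed
qed

text \<open>Two adjacent digons force all labels nearby. The vertex \<open>x\<close> is adjacent to
  \<open>u\<close> and \<open>v\<close>, and the label of \<open>w\<close> is taken at
  \<open>v\<close>, so \<open>x\<close> has the label opposite to \<open>w\<close>. Then
  \<open>y\<close>, adjacent to \<open>v\<close> and \<open>x\<close>, is opposite to
  \<open>u\<close>, and the label left for \<open>s\<close> is opposite to \<open>v\<close>. Around
  \<open>x\<close> the triangle with \<open>u\<close> and \<open>v\<close> is the vertex face, so
  beyond the edge to \<open>u\<close> lies the face at \<open>x\<close> and
  \<open>s\<close>.\<close>

lemma two_digons:
  assumes uvw: "hx u v" "hx v w" "lb u = (i, p)" "lb v = (j, q)" "lb w = (m, r)"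
    and ijm: "i \<noteq> j" "i \<noteq> m" "j \<noteq> m"
    and k: "k (EF u v) = 2" "k (VF v) = 2"
  obtains x y s where "x = nx u v" "x = nx v u" "y = nx v w" "hx x y" "hx x s" "lb x = (m, \<not> r)" "lb y = (i, \<not> p)" "lb s = (j, \<not> q)"
    "VF u = EF x s" "VF v = EF x y" "ex u x" "ex v x" "ex v y"
proof -
  have vu: "hx v u" using uvw(1) by (rule hx_sym)
  have uw: "u \<noteq> w" using uvw ijm by auto
  define x where "x = nx v u"
  define y where "y = nx v w"
  note t = two_digons_triangle[OF uvw(1,2) uw k, folded x_def y_def]
  have e: "ex v x" "ex v y" "ex u x" using nx_ex[OF vu] nx_ex[OF uvw(2)] nx_ex[OF uvw(1)] t(1) unfolding x_def y_def by auto
  have third: "fst l = m" if "fst l < 3" "fst l \<noteq> i" "fst l \<noteq> j" for l :: "nat \<times> bool"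
    using that ijm nb_labels[of u v] nb_labels[of v w] uvw by auto
  have xw: "x \<noteq> w" "y \<noteq> u" using e hx_not_ex[OF uvw(2)] hx_not_ex[OF vu] by auto
  have fx: "fst (lb x) = m" using nb_labels[of v x] nb_labels[of u x] e uvw by (intro third) auto
  have "lb x \<noteq> (m, r)" using nb_label_inj[of v x w] e(1) uvw(2,5) xw by auto
  then have lx: "lb x = (m, \<not> r)" using fx by (cases "lb x") auto
  have ly0: "fst (lb y) \<noteq> j" "fst (lb y) < 3" "fst (lb y) \<noteq> m"
    using nb_labels[of v y] nb_labels[of x y] e(2) t(2) uvw lx by auto
  have fy: "fst (lb y) = i" using ly0 third[of "lb y"] by auto
  have "lb y \<noteq> (i, p)" using nb_label_inj[of v y u] e(2) vu uvw(3) xw by auto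
  then have ly: "lb y = (i, \<not> p)" using fy by (cases "lb y") auto
  obtain s where s: "hx x s" "s \<noteq> y" using other_hx[OF t(2)] by auto
  have nxy: "nx x y = v"
    using nx_eqI[OF t(2) ex_sym[OF e(1)]] VF_bd[OF e(1)] t(3) by (simp add: insert_commute)
  have uv: "u \<noteq> v" using uvw ijm by auto
  have nxs: "nx x s = u"
    using nx_cases[OF ex_sym[OF e(3)] t(2) s(1) s(2)[symmetric]] nxy uv by auto
  have xU: "x \<in> U" "u \<in> U" using e by (simp_all add: ex_def)
  have "{v, nx v u} \<in> bd (VF x)" using VF_bd[OF ex_sym[OF e(1)]] unfolding x_def by (simp add: insert_commute)
  then have "VF x = EF v u \<or> VF x = VF v" by (rule nx_faces[OF vu outer_F[OF VF_outer[OF xU(1)]]])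
  moreover have "VF x \<noteq> VF v" using t(3) EF_neq_VF[OF t(2)] by auto
  ultimately have VFx: "VF x = EF u v" using EF_sym by metis
  have "{x, nx x s} \<in> bd (VF u)" using VF_bd[OF e(3)] unfolding nxs by (simp add: insert_commute)
  then have "VF u = EF x s \<or> VF u = VF x" by (rule nx_faces[OF s(1) outer_F[OF VF_outer[OF xU(2)]]])
  then have VFu: "VF u = EF x s" using VFx EF_neq_VF[OF uvw(1)] by auto
  have ls0: "fst (lb s) < 3" "fst (lb s) \<noteq> m" using nb_labels[of x s] s(1) lx by auto
  have su: "s \<noteq> u" "s \<noteq> v" using s(1) hx_not_ex[OF s(1)] ex_sym[OF e(3)] ex_sym[OF e(1)] by auto
  have "lb s \<noteq> (i, p)" "lb s \<noteq> (j, q)" "lb s \<noteq> (i, \<not> p)"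
    using nb_label_inj[of x s u] nb_label_inj[of x s v] nb_label_inj[of x s y] s ex_sym[OF e(3)] ex_sym[OF e(1)] t(2) su uvw ly by auto
  moreover have "fst (lb s) = i \<or> fst (lb s) = j" using third[OF ls0(1)] ls0(2) by auto
  ultimately have ls: "lb s = (j, \<not> q)" by (cases "lb s") auto
  show thesis
    using that[of x y s] t(1) lx ly ls VFu t(2,3) s(1) e unfolding x_def y_def by simp
qed

section \<open>Weights of the wheels\<close>

text \<open>As there are only six octahedral labels, distinctness makes the labels a Hamiltonian
  cycle of the octahedron.\<close>

definition hexcycle :: "'a \<Rightarrow> 'a \<Rightarrow> 'a \<Rightarrow> 'a \<Rightarrow> 'a \<Rightarrow> 'a \<Rightarrow> bool" where
  "hexcycle v0 v1 v2 v3 v4 v5 \<longleftrightarrow> hx v0 v1 \<and> hx v1 v2 \<and> hx v2 v3 \<and> hx v3 v4 \<and> hx v4 v5 \<and> hx v5 v0 \<and>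
     distinct (map lb [v0, v1, v2, v3, v4, v5])"

text \<open>The poles v0 and v3 are the vertices whose two hexagon neighbours carry opposite labels.\<close>

definition pole_hexagon ::
  "'a \<Rightarrow> 'a \<Rightarrow> 'a \<Rightarrow> 'a \<Rightarrow> 'a \<Rightarrow> 'a \<Rightarrow> nat \<Rightarrow> nat \<Rightarrow> nat \<Rightarrow> bool \<Rightarrow> bool \<Rightarrow> bool \<Rightarrow> bool" where
  "pole_hexagon v0 v1 v2 v3 v4 v5 i j m p q r \<longleftrightarrow>
     hx v0 v1 \<and> hx v1 v2 \<and> hx v2 v3 \<and> hx v3 v4 \<and> hx v4 v5 \<and> hx v5 v0 \<and>
     lb v0 = (i, p) \<and> lb v1 = (j, q) \<and> lb v2 = (m, r) \<and> lb v3 = (i, \<not> p) \<and> lb v4 = (m, \<not> r) \<and> lb v5 = (j, \<not> q) \<and>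
     i \<noteq> j \<and> i \<noteq> m \<and> j \<noteq> m \<and> i < 3 \<and> j < 3 \<and> m < 3"

text \<open>Reflection in the axis through the poles. With the half turn that exchanges the poles, a
  statement about one place of the hexagon is available at all places symmetric to it.\<close>

lemma pole_hexagon_reflect:
  "pole_hexagon v0 v1 v2 v3 v4 v5 i j m p q r \<Longrightarrow> pole_hexagon v0 v5 v4 v3 v2 v1 i j m p (\<not> q) (\<not> r)"
  unfolding pole_hexagon_def using hx_sym by auto

lemma pole_hexagon_rotate:
  "pole_hexagon v0 v1 v2 v3 v4 v5 i j m p q r \<Longrightarrow> pole_hexagon v3 v4 v5 v0 v1 v2 i m j (\<not> p) (\<not> r) (\<not> q)"
  unfolding pole_hexagon_def using hx_sym by auto

lemma hx_ex_label: "hx v a \<Longrightarrow> ex v x \<Longrightarrow> lb x \<noteq> lb a"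
  using nb_label_inj[of v x a] hx_not_ex by blast

lemma ex_ex_label: "ex v x \<Longrightarrow> ex v y \<Longrightarrow> x \<noteq> y \<Longrightarrow> lb x \<noteq> lb y"
  using nb_label_inj[of v x y] by blast

lemma hx_hx_label: "hx v x \<Longrightarrow> hx v y \<Longrightarrow> x \<noteq> y \<Longrightarrow> lb x \<noteq> lb y"
  using nb_label_inj[of v x y] by blast

lemma ex_fst: "ex v x \<Longrightarrow> fst (lb x) \<noteq> fst (lb v)" "ex v x \<Longrightarrow> fst (lb x) < 3"
  using nb_labels by blast+

lemma hx_fst: "hx v x \<Longrightarrow> fst (lb x) \<noteq> fst (lb v)" "hx v x \<Longrightarrow> fst (lb x) < 3"
  using nb_labels by blast+

lemma three_values:
  fixes i j m n :: nat
  assumes "i \<noteq> j" "i \<noteq> m" "j \<noteq> m" "i < 3" "j < 3" "m < 3" "n < 3"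
  shows "n = i \<or> n = j \<or> n = m"
  using assms by linarith

lemma ex_other_nb:
  assumes "ex v x" obtains t where "ex v t" "t \<noteq> x"
proof -
  have "v \<in> U" using assms by (simp add: ex_def)
  then obtain y z where "y \<noteq> z" "{w. ex v w} = {y, z}" by (rule ex_two)
  then have "y \<noteq> z" "ex v y" "ex v z" by auto
  then show thesis using that by metis
qed

text \<open>The edge from \<open>v\<close> to \<open>nx v w\<close> borders \<open>EF v w\<close>
  and \<open>VF v\<close>. Seen from its other end, \<open>VF v\<close> is a face at a hexagon edge,
  so the vertex face there must be \<open>EF v w\<close>.\<close>

lemma VF_swap:
  assumes "hx v w" "hx x (nx v w)" "VF v = EF x (nx v w)"
  shows "VF (nx v w) = EF v w"
proof -
  let ?y = "nx v w"
  have e: "ex v ?y" by (rule nx_ex[OF assms(1)])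
  have yU: "?y \<in> U" using e by (simp add: ex_def)
  have "{v, ?y} \<in> bd (VF ?y)" using VF_bd[OF ex_sym[OF e]] by (simp add: insert_commute)
  then have "VF ?y = EF v w \<or> VF ?y = VF v" by (rule nx_faces[OF assms(1) outer_F[OF VF_outer[OF yU]]])
  moreover have "VF ?y \<noteq> VF v" using EF_neq_VF[OF hx_sym[OF assms(2)]] assms(3) EF_sym by metis
  ultimately show ?thesis by simp
qed

section \<open>Long faces and forbidden digons near the poles\<close>

text \<open>By \<open>VF_swap\<close> the face at the edge \<open>v1\<close>, \<open>v2\<close> is
  also the vertex face of the external neighbours \<open>y\<close> and \<open>y'\<close> at its two
  ends. Each contributes a second external edge, and the labels, opposite for \<open>y\<close> and
  \<open>y'\<close>, keep the four edges apart.\<close>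

lemma mid_edge_bound:
  assumes P: "pole_hexagon v0 v1 v2 v3 v4 v5 i j m p q r"
    and k: "k (EF v0 v1) = 2" "k (VF v1) = 2" "k (VF v2) = 2" "k (EF v2 v3) = 2"
  shows "4 \<le> k (EF v1 v2)"
proof -
  have h: "hx v0 v1" "hx v1 v2" "hx v2 v3" "lb v0 = (i, p)" "lb v1 = (j, q)" "lb v2 = (m, r)" "lb v3 = (i, \<not> p)"
    "i \<noteq> j" "i \<noteq> m" "j \<noteq> m" using P by (simp_all add: pole_hexagon_def)
  obtain x y where x: "y = nx v1 v2" "hx x y" "lb y = (i, \<not> p)" "VF v1 = EF x y" "ex v1 y"
    by (rule two_digons[OF h(1,2,4-6,8-10) k(1,2)]) blast
  have k': "k (EF v3 v2) = 2" using k(4) EF_sym by metis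
  obtain x' y' where x': "y' = nx v2 v1" "hx x' y'" "lb y' = (i, p)" "VF v2 = EF x' y'" "ex v2 y'"
    by (rule two_digons[OF hx_sym[OF h(3)] hx_sym[OF h(2)] h(7,6,5) h(9,8) h(10)[symmetric] k' k(3)]) simp
  have V: "VF y = EF v1 v2" using VF_swap[OF h(2)] x(1,2,4) by simp
  have V': "VF y' = EF v1 v2" using VF_swap[OF hx_sym[OF h(2)]] x'(1,2,4) EF_sym by metis
  obtain t where t: "ex y t" "t \<noteq> v1" using ex_other_nb[OF ex_sym[OF x(5)]] by metis
  obtain t' where t': "ex y' t'" "t' \<noteq> v2" using ex_other_nb[OF ex_sym[OF x'(5)]] by metis
  have lt: "fst (lb t) \<noteq> i" "lb t \<noteq> (j, q)"
    using ex_fst(1)[OF t(1)] ex_ex_label[OF t(1) ex_sym[OF x(5)] t(2)] x(3) h(5) by simp_all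
  have lt': "fst (lb t') \<noteq> i" "lb t' \<noteq> (m, r)"
    using ex_fst(1)[OF t'(1)] ex_ex_label[OF t'(1) ex_sym[OF x'(5)] t'(2)] x'(3) h(6) by simp_all
  have "{v1, y} \<in> xedges (EF v1 v2)" "{v2, y'} \<in> xedges (EF v1 v2)"
    using EF_xedges[OF h(2)] x(1) x'(1) by simp_all
  moreover have "{y, t} \<in> xedges (EF v1 v2)" "{y', t'} \<in> xedges (EF v1 v2)"
    using VF_xedges[OF t(1)] VF_xedges[OF t'(1)] V V' by simp_all
  moreover have "distinct [{v1, y}, {v2, y'}, {y, t}, {y', t'}]"
    using h x(3) x'(3) lt lt' by (auto simp: doubleton_eq_iff)
  ultimately show ?thesis using k_ge_4 outer_F[OF EF_outer[OF h(2)]] by metis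
qed

text \<open>By \<open>two_digons\<close> on either side, the vertex face of the pole continues past
  each of its two external edges along a hexagon edge of another wheel. The far ends
  \<open>s\<close> and \<open>s'\<close> of these edges carry opposite labels and contribute two
  more external edges.\<close>

lemma pole_bound:
  assumes P: "pole_hexagon v0 v1 v2 v3 v4 v5 i j m p q r"
    and k: "k (EF v0 v1) = 2" "k (VF v1) = 2" "k (VF v5) = 2" "k (EF v5 v0) = 2"
  shows "4 \<le> k (VF v0)"
proof -
  have h: "hx v0 v1" "hx v1 v2" "hx v5 v0" "hx v4 v5" "lb v0 = (i, p)" "lb v1 = (j, q)" "lb v2 = (m, r)"
    "lb v5 = (j, \<not> q)" "lb v4 = (m, \<not> r)"
    "i \<noteq> j" "i \<noteq> m" "j \<noteq> m" using P by (simp_all add: pole_hexagon_def)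
  obtain x s where x: "hx x s" "lb x = (m, \<not> r)" "lb s = (j, \<not> q)" "VF v0 = EF x s" "ex v0 x"
    by (rule two_digons[OF h(1,2,5-7,10-12) k(1,2)]) blast
  have k': "k (EF v0 v5) = 2" using k(4) EF_sym by metis
  obtain x' s' where x': "hx x' s'" "lb x' = (m, r)" "lb s' = (j, q)" "VF v0 = EF x' s'" "ex v0 x'"
    by (rule two_digons[OF hx_sym[OF h(3)] hx_sym[OF h(4)] h(5,8,9,10-12) k' k(3)]) simp
  let ?z = "nx s x" and ?z' = "nx s' x'"
  have lz: "fst (lb ?z) \<noteq> j" "fst (lb ?z') \<noteq> j"
    using ex_fst(1)[OF nx_ex[OF hx_sym[OF x(1)]]] ex_fst(1)[OF nx_ex[OF hx_sym[OF x'(1)]]] x(3) x'(3) by simp_all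
  have "{v0, x} \<in> xedges (VF v0)" "{v0, x'} \<in> xedges (VF v0)" using VF_xedges x(5) x'(5) by simp_all
  moreover have "{s, ?z} \<in> xedges (VF v0)" "{s', ?z'} \<in> xedges (VF v0)"
    using EF_xedges(2)[OF x(1)] EF_xedges(2)[OF x'(1)] unfolding x(4)[symmetric] x'(4)[symmetric] by simp_all
  moreover have "distinct [{v0, x}, {v0, x'}, {s, ?z}, {s', ?z'}]"
    using h x(2,3) x'(2,3) lz by (auto simp: doubleton_eq_iff)
  moreover have "VF v0 \<in> F" using x(5) by (intro outer_F[OF VF_outer]) (simp add: ex_def)
  ultimately show ?thesis using k_ge_4 by metis
qed

text \<open>A common external neighbour of \<open>v1\<close> and \<open>v2\<close> would need a
  label from the pair of the poles, but one of these is taken by \<open>v0\<close> next to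
  \<open>v1\<close> and the other by \<open>v3\<close> next to \<open>v2\<close>. So a digon at this
  edge is a quadrangle.\<close>

lemma mid_edge_no_triangle:
  assumes P: "pole_hexagon v0 v1 v2 v3 v4 v5 i j m p q r"
  shows "nx v1 v2 \<noteq> nx v2 v1"
proof
  assume n: "nx v1 v2 = nx v2 v1"
  have h: "hx v0 v1" "hx v1 v2" "hx v2 v3" "lb v0 = (i, p)" "lb v1 = (j, q)" "lb v2 = (m, r)" "lb v3 = (i, \<not> p)"
    "i \<noteq> j" "i \<noteq> m" "j \<noteq> m" "i < 3" "j < 3" "m < 3" using P by (simp_all add: pole_hexagon_def)
  let ?x = "nx v1 v2"
  have e: "ex v1 ?x" "ex v2 ?x" using nx_ex[OF h(2)] nx_ex[OF hx_sym[OF h(2)]] n by simp_all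
  have "lb ?x \<noteq> (i, p)" "lb ?x \<noteq> (i, \<not> p)"
    using hx_ex_label[OF hx_sym[OF h(1)] e(1)] hx_ex_label[OF h(3) e(2)] h by simp_all
  then have "fst (lb ?x) \<noteq> i" by (cases "lb ?x") auto
  then show False using three_values[OF h(8-13) ex_fst(2)[OF e(1)]] ex_fst(1)[OF e(1)] ex_fst(1)[OF e(2)] h by simp
qed

text \<open>The hexagon neighbours of the pole use up both labels of one pair, so its two external
  neighbours carry the two labels of the remaining pair. These are not adjacent, whereas a digon
  would make them so.\<close>

lemma pole_not_digon:
  assumes P: "pole_hexagon v0 v1 v2 v3 v4 v5 i j m p q r"
  shows "k (VF v0) \<noteq> 2"
proof
  assume k: "k (VF v0) = 2"
  have h: "hx v0 v1" "hx v5 v0" "lb v0 = (i, p)" "lb v1 = (j, q)" "lb v5 = (j, \<not> q)"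
    "i \<noteq> j" "i \<noteq> m" "j \<noteq> m" "i < 3" "j < 3" "m < 3" using P by (simp_all add: pole_hexagon_def)
  have h5: "hx v0 v5" using h(2) by (rule hx_sym)
  have "v1 \<noteq> v5" using h(4,5) by auto
  then have e: "ex v0 (nx v0 v1)" "ex v0 (nx v0 v5)" "nx v0 v1 \<noteq> nx v0 v5"
    using nx_ex h(1) h5 nx_neq by auto
  have m: "fst (lb x) = m" if x: "ex v0 x" for x
  proof -
    have "lb x \<noteq> (j, q)" "lb x \<noteq> (j, \<not> q)" using hx_ex_label[OF h(1) x] hx_ex_label[OF h5 x] h by simp_all
    then have "fst (lb x) \<noteq> j" by (cases "lb x") auto
    then show ?thesis using three_values[OF h(6-11) ex_fst(2)[OF x]] ex_fst(1)[OF x] h(3) by simp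
  qed
  have "hx (nx v0 v1) (nx v0 v5)" using VF_digon[OF e k] by simp
  then show False using hx_fst(1) m e by metis
qed

text \<open>Two adjacent digons would turn the one at the edge \<open>v1\<close>, \<open>v2\<close>
  into a triangle.\<close>

lemma consecutive_digons_at_mid:
  assumes P: "pole_hexagon v0 v1 v2 v3 v4 v5 i j m p q r"
  shows "\<not> (k (VF v1) = 2 \<and> k (EF v1 v2) = 2)"
proof
  assume k: "k (VF v1) = 2 \<and> k (EF v1 v2) = 2"
  have h: "hx v0 v1" "hx v1 v2" "v2 \<noteq> v0" using P by (auto simp: pole_hexagon_def)
  have "k (EF v2 v1) = 2" using k EF_sym by metis
  from two_digons_triangle(1)[OF hx_sym[OF h(2)] hx_sym[OF h(1)] h(3) this] k
  show False using mid_edge_no_triangle[OF P] by simp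
qed

text \<open>Here digons at \<open>v4\<close>, \<open>v5\<close> and at \<open>v5\<close>,
  \<open>v0\<close> follow each other with no digon required at \<open>v5\<close>. The digon at
  \<open>v4\<close>, \<open>v5\<close> is a quadrangle, so \<open>VF v5\<close> is also the vertex
  face of \<open>?y\<close> and has three external edges. If the digon at \<open>v5\<close>,
  \<open>v0\<close> is a quadrangle too, the same happens at \<open>?B\<close> and supplies the
  fourth. If it is a triangle, a hexagon edge at its third vertex continues \<open>VF v0\<close> or
  \<open>VF v5\<close> and supplies a fourth edge there.\<close>

lemma isolated_digon_bound:
  assumes P: "pole_hexagon v0 v1 v2 v3 v4 v5 i j m p q r"
    and k: "k (EF v0 v1) = 2" "k (VF v1) = 2" "k (EF v4 v5) = 2" "k (EF v5 v0) = 2"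
  shows "4 \<le> k (VF v0) \<or> 4 \<le> k (VF v5)"
proof -
  have h: "hx v0 v1" "hx v1 v2" "hx v5 v0" "hx v4 v5" "hx v3 v4" "lb v0 = (i, p)" "lb v1 = (j, q)" "lb v2 = (m, r)"
    "lb v3 = (i, \<not> p)" "lb v5 = (j, \<not> q)" "lb v4 = (m, \<not> r)" "i \<noteq> j" "i \<noteq> m" "j \<noteq> m" "i < 3" "j < 3" "m < 3"
    using P by (simp_all add: pole_hexagon_def)
  note tri3 = three_values[OF h(12-17)]
  have h': "hx v0 v5" "hx v5 v4" using h(3,4) by (simp_all add: hx_sym)
  obtain x s where x: "x = nx v0 v1" "hx x s" "lb x = (m, \<not> r)" "lb s = (j, \<not> q)" "VF v0 = EF x s" "ex v0 x"
    by (rule two_digons[OF h(1,2,6-8,12-14) k(1,2)]) blast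
  have v15: "v1 \<noteq> v5" "v4 \<noteq> v0" using h by auto
  let ?n = "nx v0 v5" and ?B = "nx v5 v0" and ?y = "nx v5 v4" and ?q = "nx v4 v5"
  have en: "ex v0 ?n" "?n \<noteq> x" using nx_ex[OF h'(1)] nx_neq[OF h(1) h'(1) v15(1)] x(1) by auto
  have ln: "lb ?n = (m, r)"
  proof -
    have "lb ?n \<noteq> (j, q)" "lb ?n \<noteq> (j, \<not> q)" "lb ?n \<noteq> (m, \<not> r)" "fst (lb ?n) \<noteq> i"
      using hx_ex_label[OF h(1) en(1)] hx_ex_label[OF h'(1) en(1)] ex_ex_label[OF en(1) x(6) en(2)] ex_fst(1)[OF en(1)] h x(3) by simp_all
    then show ?thesis using tri3[OF ex_fst(2)[OF en(1)]] by (cases "lb ?n") auto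
  qed
  have eB: "ex v5 ?B" "ex v5 ?y" "?y \<noteq> ?B"
    using nx_ex[OF h(3)] nx_ex[OF h'(2)] nx_neq[OF h'(2) h(3) v15(2)] by auto
  have lB: "lb ?B \<noteq> (i, p)" "lb ?B \<noteq> (m, \<not> r)" "fst (lb ?B) \<noteq> j"
    using hx_ex_label[OF h(3) eB(1)] hx_ex_label[OF h'(2) eB(1)] ex_fst(1)[OF eB(1)] h by simp_all
  have ly: "lb ?y \<noteq> (i, p)" "lb ?y \<noteq> (m, \<not> r)" "fst (lb ?y) \<noteq> j" "lb ?y \<noteq> lb ?B"
    using hx_ex_label[OF h(3) eB(2)] hx_ex_label[OF h'(2) eB(2)] ex_fst(1)[OF eB(2)] ex_ex_label[OF eB(2,1,3)] h by simp_all
  have kv: "k (EF v5 v4) = 2" using k(3) EF_sym by metis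
  have "?y \<noteq> ?q" using mid_edge_no_triangle[OF pole_hexagon_reflect[OF P]] .
  note sq = EF_digon_square[OF h'(2) kv this]
  obtain u where u: "ex ?y u" "u \<noteq> v5" using ex_other_nb[OF ex_sym[OF eB(2)]] by metis
  have lu: "fst (lb u) \<noteq> fst (lb ?y)" "lb u \<noteq> (j, \<not> q)"
    using ex_fst(1)[OF u(1)] ex_ex_label[OF u(1) ex_sym[OF eB(2)] u(2)] h by simp_all
  have y1: "{v5, ?y} \<in> xedges (VF v5)" "{v5, ?B} \<in> xedges (VF v5)" "{?y, u} \<in> xedges (VF v5)"
    using VF_xedges[OF eB(2)] VF_xedges[OF eB(1)] VF_xedges[OF u(1)] sq(4) by simp_all
  have VF5: "VF v5 \<in> F" "VF v0 \<in> F" using h'(2) h(1) by (auto intro!: outer_F VF_outer simp: hx_def)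
  show ?thesis
  proof (cases "?B = ?n")
    case True
    let ?w = "?n"
    have ew: "ex ?w v0" "ex ?w v5" using en(1) eB(1) True by (simp_all add: ex_sym)
    have lyy: "lb ?y = (i, \<not> p)"
      using ly ln True tri3[OF ex_fst(2)[OF eB(2)]] by (cases "lb ?y") auto
    have eq: "ex v4 ?q" using nx_ex[OF h(4)] .
    have lq: "lb ?q = (j, q)"
    proof -
      have "lb ?q \<noteq> (j, \<not> q)" "fst (lb ?q) \<noteq> m" "fst (lb ?q) \<noteq> i"
        using hx_ex_label[OF h(4) eq] ex_fst(1)[OF eq] hx_fst(1)[OF sq(1)] h lyy by simp_all
      then show ?thesis using tri3[OF ex_fst(2)[OF eq]] by (cases "lb ?q") auto
    qed
    have luj: "fst (lb u) \<noteq> j"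
    proof -
      have "lb u \<noteq> (j, q)" using hx_ex_label[OF sq(1) u(1)] lq by simp
      then show ?thesis using lu(2) by (cases "lb u") auto
    qed
    obtain c where c: "hx ?w c" using hx_ex ew(1) by (auto simp: ex_def)
    obtain d where d: "hx ?w d" "d \<noteq> c" using other_hx[OF c] by metis
    \<comment> \<open>The third vertex of the triangle sees \<open>v0\<close> and \<open>v5\<close>
      as its external neighbours, so its hexagon neighbours carry the two octahedral labels opposite
      to these.\<close>
    have lab: "lb a = (i, \<not> p) \<or> lb a = (j, q)" if a: "hx ?w a" for a
    proof -
      have "lb a \<noteq> (i, p)" "lb a \<noteq> (j, \<not> q)" "fst (lb a) \<noteq> m"
        using hx_ex_label[OF a ew(1)] hx_ex_label[OF a ew(2)] hx_fst(1)[OF a] h ln by auto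
      then show ?thesis using tri3[OF hx_fst(2)[OF a]] by (cases "lb a") auto
    qed
    have "lb c \<noteq> lb d" using hx_hx_label[OF c d(1)] d(2) by simp
    then have "\<exists>b b'. hx ?w b \<and> lb b = (j, q) \<and> hx ?w b' \<and> b \<noteq> b'" using lab[OF c] lab[OF d(1)] c d by metis
    then obtain b b' where b: "hx ?w b" "lb b = (j, q)" "hx ?w b'" "b \<noteq> b'" by blast
    have v05: "v0 \<noteq> v5" using h by auto
    let ?z = "nx b ?w"
    have lz: "fst (lb ?z) \<noteq> j" using ex_fst(1)[OF nx_ex[OF hx_sym[OF b(1)]]] b(2) by simp
    have bz: "{b, ?z} \<in> xedges (EF ?w b)" by (rule EF_xedges(2)[OF b(1)])
    have tri: "{?w, v0} \<in> bd (EF v0 v5)" "{?w, v5} \<in> bd (EF v0 v5)"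
    proof -
      show "{?w, v0} \<in> bd (EF v0 v5)" using nx_bd[OF h'(1)] by (simp add: insert_commute)
      show "{?w, v5} \<in> bd (EF v0 v5)" using nx_bd[OF h(3)] True EF_sym[of v0 v5] by (simp add: insert_commute)
    qed
    have EFF: "EF v0 v5 \<in> F" using outer_F[OF EF_outer[OF h'(1)]] .
    \<comment> \<open>The triangle is the vertex face of \<open>?w\<close>; therefore beyond the
      edge from \<open>?w\<close> to \<open>v0\<close> or \<open>v5\<close>, whichever is next to
      \<open>b\<close>, lies the face at \<open>?w\<close> and \<open>b\<close>. This is the face
      that receives the external edge at \<open>b\<close>.\<close>
    consider "nx ?w b = v0" | "nx ?w b = v5"
      using nx_cases[OF ew(1) b(1,3,4)] nx_cases[OF ew(2) b(1,3,4)] v05 by metis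
    then show ?thesis
    proof cases
      case 1
      have "EF v0 v5 \<noteq> EF ?w b" using nx_eqI[OF b(1) ew(2)] tri(2) 1 v05 by auto
      then have VFw: "VF ?w = EF v0 v5" using nx_faces[OF b(1) EFF] tri(1) 1 by simp
      have "{?w, v0} \<in> bd (VF v0)" using VF_bd[OF en(1)] by (simp add: insert_commute)
      then have "VF v0 = EF ?w b" using nx_faces[OF b(1) VF5(2)] 1 VFw EF_neq_VF[OF h'(1)] by auto
      then have "{b, ?z} \<in> xedges (VF v0)" using bz by simp
      moreover have "{v0, x} \<in> xedges (VF v0)" "{v0, ?w} \<in> xedges (VF v0)" using VF_xedges x(6) en(1) by simp_all
      moreover have "{s, nx s x} \<in> xedges (VF v0)" unfolding x(5) by (rule EF_xedges(2)[OF x(2)])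
      moreover have "fst (lb (nx s x)) \<noteq> j" using ex_fst(1)[OF nx_ex[OF hx_sym[OF x(2)]]] x(4) by simp
      then have "distinct [{b, ?z}, {v0, x}, {v0, ?w}, {s, nx s x}]"
        using h(6,12-14) x(3,4) b(2) lz ln by (auto simp: doubleton_eq_iff)
      ultimately have "4 \<le> k (VF v0)" using k_ge_4[OF VF5(2)] by metis
      then show ?thesis ..
    next
      case 2
      have "EF v0 v5 \<noteq> EF ?w b" using nx_eqI[OF b(1) ew(1)] tri(1) 2 v05 by auto
      then have VFw: "VF ?w = EF v0 v5" using nx_faces[OF b(1) EFF] tri(2) 2 by simp
      have "{?w, v5} \<in> bd (VF v5)" using VF_bd[OF eB(1)] True by (simp add: insert_commute)
      then have "VF v5 = EF ?w b" using nx_faces[OF b(1) VF5(1)] 2 VFw EF_neq_VF[OF h(3)] EF_sym[of v5 v0] by auto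
      then have "{b, ?z} \<in> xedges (VF v5)" using bz by simp
      moreover have "distinct [{b, ?z}, {v5, ?y}, {v5, ?B}, {?y, u}]"
        using h(10,12-14) b(2) lz ln True lyy lu luj by (auto simp: doubleton_eq_iff)
      ultimately have "4 \<le> k (VF v5)" using k_ge_4[OF VF5(1)] y1 by metis
      then show ?thesis ..
    qed
  next
    case False
    note sq' = EF_digon_square[OF h(3) k(4) False]
    have lB2: "lb ?B = (i, \<not> p)"
      using lB hx_fst(1)[OF sq'(1)] ln tri3[OF ex_fst(2)[OF eB(1)]] by (cases "lb ?B") auto
    have ly2: "lb ?y = (m, r)"
      using ly lB2 tri3[OF ex_fst(2)[OF eB(2)]] by (cases "lb ?y") auto
    obtain t where t: "ex ?B t" "t \<noteq> v5" using ex_other_nb[OF ex_sym[OF eB(1)]] by metis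
    have lt: "fst (lb t) \<noteq> i" "lb t \<noteq> (j, \<not> q)" "lb t \<noteq> (m, r)"
      using ex_fst(1)[OF t(1)] ex_ex_label[OF t(1) ex_sym[OF eB(1)] t(2)] hx_ex_label[OF sq'(1) t(1)] h lB2 ln by simp_all
    have "{?B, t} \<in> xedges (VF v5)" using VF_xedges[OF t(1)] sq'(4) by simp
    moreover have "distinct [{?B, t}, {v5, ?y}, {v5, ?B}, {?y, u}]"
      using h(10,12-14) lB2 ly2 lt lu by (auto simp: doubleton_eq_iff)
    ultimately have "4 \<le> k (VF v5)" using k_ge_4[OF VF5(1)] y1 by metis
    then show ?thesis ..
  qed
qed

section \<open>Total weight of a hexagon with poles\<close>

definition \<rho> :: "'f \<Rightarrow> real" where "\<rho> f = 1 / real (k f)"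

lemma \<rho>_le: "2 \<le> k f \<Longrightarrow> \<rho> f \<le> 1/2" "2 \<le> k f \<Longrightarrow> k f \<noteq> 2 \<longrightarrow> \<rho> f \<le> 1/3" "4 \<le> k f \<Longrightarrow> \<rho> f \<le> 1/4"
  unfolding \<rho>_def by (simp_all add: field_simps)

definition wsum :: "'a \<Rightarrow> 'a \<Rightarrow> 'a \<Rightarrow> 'a \<Rightarrow> 'a \<Rightarrow> 'a \<Rightarrow> real" where
  "wsum v0 v1 v2 v3 v4 v5 = \<rho> (VF v0) + \<rho> (VF v1) + \<rho> (VF v2) + \<rho> (VF v3) + \<rho> (VF v4) + \<rho> (VF v5) +
     \<rho> (EF v0 v1) + \<rho> (EF v1 v2) + \<rho> (EF v2 v3) + \<rho> (EF v3 v4) + \<rho> (EF v4 v5) + \<rho> (EF v5 v0)"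

text \<open>Arithmetic for the five corners strictly between the poles on one side; the Booleans say
  which are digons. The base value is 5/3, and each digon adds 1/6. Four digons are possible in one
  pattern only, where the middle corner drops to 1/4: 5/3 + 4/6 - 1/12 = 9/4. Three digons give 13/6
  and two give 2; the extra conditions of the last bound rule out every pattern with three.\<close>

lemma half_hexagon_bound:
  fixes e01 e12 e23 w1 w2 :: real
  assumes "e01 \<le> 1/2" "e12 \<le> 1/2" "e23 \<le> 1/2" "w1 \<le> 1/2" "w2 \<le> 1/2"
    "\<not> E01 \<longrightarrow> e01 \<le> 1/3" "\<not> E12 \<longrightarrow> e12 \<le> 1/3" "\<not> E23 \<longrightarrow> e23 \<le> 1/3" "\<not> W1 \<longrightarrow> w1 \<le> 1/3" "\<not> W2 \<longrightarrow> w2 \<le> 1/3"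
    "\<not> (W1 \<and> E12)" "\<not> (W2 \<and> E12)" "E01 \<and> W1 \<and> W2 \<and> E23 \<longrightarrow> e12 \<le> 1/4"
  shows "e01 + w1 + e12 + w2 + e23 \<le> 9/4"
    "\<not> (E01 \<and> W1 \<and> W2 \<and> E23) \<Longrightarrow> e01 + w1 + e12 + w2 + e23 \<le> 13/6"
    "\<not> (E01 \<and> W1) \<Longrightarrow> \<not> (W2 \<and> E23) \<Longrightarrow> \<not> (E01 \<and> E12 \<and> E23) \<Longrightarrow> e01 + w1 + e12 + w2 + e23 \<le> 2"
proof -
  show a: "e01 + w1 + e12 + w2 + e23 \<le> 9/4"
  proof (cases "E01 \<and> W1 \<and> W2 \<and> E23")
    case True then show ?thesis using assms by linarith
  next
    case False then show ?thesis using assms by (cases E01; cases E12; cases E23; cases W1; cases W2; simp)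
  qed
  show "e01 + w1 + e12 + w2 + e23 \<le> 13/6" if "\<not> (E01 \<and> W1 \<and> W2 \<and> E23)"
    using that assms by (cases E01; cases E12; cases E23; cases W1; cases W2; simp)
  show "e01 + w1 + e12 + w2 + e23 \<le> 2" if "\<not> (E01 \<and> W1)" "\<not> (W2 \<and> E23)" "\<not> (E01 \<and> E12 \<and> E23)"
    using that assms by (cases E01; cases E12; cases E23; cases W1; cases W2; simp)
qed

text \<open>A side is full if it has four digons, and the half turn lets the left side be full
  whenever one is. The poles are never digons, so they add at most 2/3. With no full side the sum is
  at most 13/6 + 13/6 + 2/3, with two full sides both poles drop to 1/4 and it is at most 9/4 + 9/4
  + 1/2; both equal 5. With only the left side full, three digons on the right force one more corner
  down to 1/4, and 9/4 + 13/6 + 1/4 + 1/3 is again 5.\<close>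

lemma wsum_pole_le_aux:
  assumes P: "pole_hexagon v0 v1 v2 v3 v4 v5 i j m p q r"
  defines "fullL \<equiv> k (EF v0 v1) = 2 \<and> k (VF v1) = 2 \<and> k (VF v2) = 2 \<and> k (EF v2 v3) = 2"
    and "fullR \<equiv> k (EF v3 v4) = 2 \<and> k (VF v4) = 2 \<and> k (VF v5) = 2 \<and> k (EF v5 v0) = 2"
  assumes LR: "fullR \<Longrightarrow> fullL"
  shows "wsum v0 v1 v2 v3 v4 v5 \<le> 5"
proof -
  note R = pole_hexagon_reflect[OF P] and T = pole_hexagon_rotate[OF P]
  note TR = pole_hexagon_reflect[OF T]
  have h: "hx v0 v1" "hx v1 v2" "hx v2 v3" "hx v3 v4" "hx v4 v5" "hx v5 v0" using P by (simp_all add: pole_hexagon_def)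
  have vU: "v0 \<in> U" "v1 \<in> U" "v2 \<in> U" "v3 \<in> U" "v4 \<in> U" "v5 \<in> U" using h by (simp_all add: hx_def)
  have s: "EF v1 v0 = EF v0 v1" "EF v2 v1 = EF v1 v2" "EF v3 v2 = EF v2 v3" "EF v4 v3 = EF v3 v4" "EF v5 v4 = EF v4 v5" "EF v0 v5 = EF v5 v0"
    by (rule EF_sym)+
  note k2 = h[THEN k_ge_2(1)] vU[THEN k_ge_2(2)]
  note le2 = k2[THEN \<rho>_le(1)] and le3 = k2[THEN \<rho>_le(2)]
  have V0: "\<rho> (VF v0) \<le> 1/3" "\<rho> (VF v3) \<le> 1/3"
    using le3(7,10) pole_not_digon[OF P] pole_not_digon[OF T] by simp_all
  let ?E = "\<lambda>v w. k (EF v w) = 2" and ?V = "\<lambda>v. k (VF v) = 2"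
  have no: "\<not> (?V v1 \<and> ?E v1 v2)" "\<not> (?V v5 \<and> ?E v4 v5)" "\<not> (?V v4 \<and> ?E v4 v5)" "\<not> (?V v2 \<and> ?E v1 v2)"
    using consecutive_digons_at_mid[OF P] consecutive_digons_at_mid[OF R] consecutive_digons_at_mid[OF T]
      consecutive_digons_at_mid[OF TR] s by simp_all
  have mid: "?E v0 v1 \<and> ?V v1 \<and> ?V v2 \<and> ?E v2 v3 \<longrightarrow> \<rho> (EF v1 v2) \<le> 1/4"
    using mid_edge_bound[OF P] \<rho>_le(3) by simp
  have mid': "?E v3 v4 \<and> ?V v4 \<and> ?V v5 \<and> ?E v5 v0 \<longrightarrow> \<rho> (EF v4 v5) \<le> 1/4"
    using mid_edge_bound[OF T] \<rho>_le(3) by simp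
  have pole: "\<rho> (VF v0) \<le> 1/4" if "?E v0 v1" "?V v1" "?V v5" "?E v5 v0"
    using pole_bound[OF P] that \<rho>_le(3) by simp
  have pole': "\<rho> (VF v3) \<le> 1/4" if "?E v3 v4" "?V v4" "?V v2" "?E v2 v3"
    using pole_bound[OF T] that \<rho>_le(3) by simp
  have iso: "\<rho> (VF v0) \<le> 1/4 \<or> \<rho> (VF v5) \<le> 1/4" if "?E v0 v1" "?V v1" "?E v4 v5" "?E v5 v0"
    using isolated_digon_bound[OF P that] \<rho>_le(3) by blast
  let ?L = "\<rho> (EF v0 v1) + \<rho> (VF v1) + \<rho> (EF v1 v2) + \<rho> (VF v2) + \<rho> (EF v2 v3)"
  let ?R = "\<rho> (EF v3 v4) + \<rho> (VF v4) + \<rho> (EF v4 v5) + \<rho> (VF v5) + \<rho> (EF v5 v0)"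
  note L = half_hexagon_bound[OF le2(1,2,3,8,9) le3(1,2,3,8,9) no(1,4) mid]
  note R' = half_hexagon_bound[OF le2(4,5,6,11,12) le3(4,5,6,11,12) no(3,2) mid']
  have sum: "wsum v0 v1 v2 v3 v4 v5 = \<rho> (VF v0) + \<rho> (VF v3) + ?L + ?R" unfolding wsum_def by simp
  consider (none) "\<not> fullL" "\<not> fullR" | (both) fullL fullR | (left) fullL "\<not> fullR" using LR by blast
  then show ?thesis
  proof cases
    case none
    then have "?L \<le> 13/6" "?R \<le> 13/6" using L(2) R'(2) unfolding fullL_def fullR_def by simp_all
    then show ?thesis using V0 sum by linarith
  next
    case both
    then have "\<rho> (VF v0) \<le> 1/4" "\<rho> (VF v3) \<le> 1/4" using pole pole' unfolding fullL_def fullR_def by simp_all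
    then show ?thesis using L(1) R'(1) sum by linarith
  next
    case left
    have f: "?E v0 v1" "?V v1" "?V v2" "?E v2 v3" using left(1) unfolding fullL_def by simp_all
    have R: "?R \<le> 13/6" using R'(2) left(2) unfolding fullR_def by simp
    consider "?E v3 v4 \<and> ?V v4" | "?V v5 \<and> ?E v5 v0" | "?E v3 v4 \<and> ?E v4 v5 \<and> ?E v5 v0" "\<not> ?V v4" "\<not> ?V v5"
      | "\<not> (?E v3 v4 \<and> ?V v4)" "\<not> (?V v5 \<and> ?E v5 v0)" "\<not> (?E v3 v4 \<and> ?E v4 v5 \<and> ?E v5 v0)" by blast
    then show ?thesis
    proof cases
      case 1
      then have "\<rho> (VF v3) \<le> 1/4" using pole' f by simp
      then show ?thesis using R L(1) V0 sum by linarith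
    next
      case 2
      then have "\<rho> (VF v0) \<le> 1/4" using pole f by simp
      then show ?thesis using R L(1) V0 sum by linarith
    next
      case 3
      then have "\<rho> (VF v0) \<le> 1/4 \<or> \<rho> (VF v5) \<le> 1/4" using iso f by simp
      moreover have "\<rho> (VF v4) \<le> 1/3" "\<rho> (VF v5) \<le> 1/3" using 3 le3(11,12) by simp_all
      ultimately show ?thesis using L(1) R V0 le2(4,5,6) sum by linarith
    next
      case 4
      then have "?R \<le> 2" using R'(3) by simp
      then show ?thesis using L(1) V0 sum by linarith
    qed
  qed
qed

lemma wsum_pole_le:
  assumes P: "pole_hexagon v0 v1 v2 v3 v4 v5 i j m p q r"
  shows "wsum v0 v1 v2 v3 v4 v5 \<le> 5"
proof (cases "k (EF v0 v1) = 2 \<and> k (VF v1) = 2 \<and> k (VF v2) = 2 \<and> k (EF v2 v3) = 2")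
  case True
  then show ?thesis using wsum_pole_le_aux[OF P] by simp
next
  case False
  have "wsum v3 v4 v5 v0 v1 v2 \<le> 5" using wsum_pole_le_aux[OF pole_hexagon_rotate[OF P]] False by simp
  then show ?thesis unfolding wsum_def by simp
qed

section \<open>Counting faces\<close>

text \<open>Under these conditions \<open>u\<close> and \<open>z\<close> carry the two labels of the
  third pair, the only labels possible for a common external neighbour of \<open>v\<close> and
  \<open>w\<close>, and each is already taken by a hexagon neighbour.\<close>

lemma nonpoles_no_triangle:
  assumes h: "hx u v" "hx v w" "hx w z" and lb: "lb u \<noteq> lb z" "fst (lb u) \<noteq> fst (lb w)" "fst (lb v) \<noteq> fst (lb z)"
  shows "nx v w \<noteq> nx w v"
proof
  assume n: "nx v w = nx w v"
  let ?x = "nx v w"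
  have e: "ex v ?x" "ex w ?x" using nx_ex[OF h(2)] nx_ex[OF hx_sym[OF h(2)]] n by simp_all
  have vw: "fst (lb v) \<noteq> fst (lb w)" "fst (lb v) < 3" "fst (lb w) < 3" using hx_fst(1)[OF h(2)] hx_fst(2)[OF h(2)] hx_fst(2)[OF h(1)] by auto
  have "fst (lb ?x) \<noteq> fst (lb v)" "fst (lb ?x) \<noteq> fst (lb w)" "fst (lb ?x) < 3"
    using ex_fst(1)[OF e(1)] ex_fst(1)[OF e(2)] ex_fst(2)[OF e(1)] by simp_all
  moreover have "fst (lb u) \<noteq> fst (lb v)" "fst (lb u) < 3" "fst (lb z) \<noteq> fst (lb w)" "fst (lb z) < 3"
    using hx_fst[OF hx_sym[OF h(1)]] hx_fst[OF h(3)] by simp_all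
  ultimately have f: "fst (lb u) = fst (lb ?x)" "fst (lb z) = fst (lb ?x)" using lb(2,3) vw by linarith+
  have "lb ?x \<noteq> lb u" "lb ?x \<noteq> lb z" using hx_ex_label[OF hx_sym[OF h(1)] e(1)] hx_ex_label[OF h(3) e(2)] by simp_all
  then show False using f lb(1) by (cases "lb u"; cases "lb z"; cases "lb ?x") auto
qed

text \<open>A vertex corner and the following edge corner cannot both be digons, so together they
  receive at most 1/2 + 1/3. A hexagon without poles splits into six such pairs, with total at most
  5.\<close>

lemma nonpole_corner_bound:
  assumes h: "hx u v" "hx v w" "hx w z" and lb: "lb u \<noteq> lb z" "fst (lb u) \<noteq> fst (lb w)" "fst (lb v) \<noteq> fst (lb z)"
  shows "\<rho> (VF v) + \<rho> (EF v w) \<le> 5/6"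
proof -
  have vU: "v \<in> U" using h(1) by (simp add: hx_def)
  have "\<not> (k (EF v w) = 2 \<and> k (VF v) = 2)"
  proof
    assume k: "k (EF v w) = 2 \<and> k (VF v) = 2"
    have "w \<noteq> u" using lb(2) by auto
    moreover have "k (EF w v) = 2" using k EF_sym by metis
    ultimately show False
      using two_digons_triangle(1)[OF hx_sym[OF h(2)] hx_sym[OF h(1)]] k nonpoles_no_triangle[OF h lb] by auto
  qed
  then show ?thesis
    using \<rho>_le(1,2)[OF k_ge_2(1)[OF h(2)]] \<rho>_le(1,2)[OF k_ge_2(2)[OF vU]] by linarith
qed

lemma hexcycle_rotate: "hexcycle v0 v1 v2 v3 v4 v5 \<Longrightarrow> hexcycle v1 v2 v3 v4 v5 v0"
  unfolding hexcycle_def by auto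

lemma wsum_rotate: "wsum v0 v1 v2 v3 v4 v5 = wsum v1 v2 v3 v4 v5 v0"
  unfolding wsum_def by simp

text \<open>One vertex whose neighbours carry opposite labels fixes the whole pattern. If
  \<open>v3\<close> were not opposite to \<open>v0\<close>, both \<open>v2\<close> and
  \<open>v4\<close> would have to carry the label opposite to \<open>v0\<close>.\<close>

lemma hexcycle_pole:
  assumes h: "hexcycle v0 v1 v2 v3 v4 v5" and pole: "fst (lb v1) = fst (lb v5)"
  shows "wsum v0 v1 v2 v3 v4 v5 \<le> 5"
proof -
  have hx: "hx v0 v1" "hx v1 v2" "hx v2 v3" "hx v3 v4" "hx v4 v5" "hx v5 v0" using h by (simp_all add: hexcycle_def)
  have d: "distinct (map lb [v0, v1, v2, v3, v4, v5])" using h by (simp add: hexcycle_def)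
  obtain i p where l0: "lb v0 = (i, p)" by (cases "lb v0") auto
  obtain j q where l1: "lb v1 = (j, q)" by (cases "lb v1") auto
  obtain m r where l2: "lb v2 = (m, r)" by (cases "lb v2") auto
  have l5: "lb v5 = (j, \<not> q)" using pole l1 d by (cases "lb v5") auto
  note f = hx_fst[OF hx(1)] hx_fst[OF hx(2)] hx_fst[OF hx(3)] hx_fst[OF hx(4)] hx_fst[OF hx(5)] hx_fst[OF hx(6)]
  have notj: "fst (lb v) \<noteq> j" if "lb v \<noteq> lb v1" "lb v \<noteq> lb v5" for v
    using that l1 l5 by (cases "lb v") auto
  have nj: "fst (lb v3) \<noteq> j" "fst (lb v4) \<noteq> j" "m \<noteq> j" using notj[of v3] notj[of v4] notj[of v2] d l2 by auto
  have ij: "i \<noteq> j" "i < 3" "j < 3" "m < 3" using f l0 l1 l2 by auto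
  have l3: "fst (lb v3) = i"
  proof (rule ccontr)
    assume n: "fst (lb v3) \<noteq> i"
    note tv = three_values[OF ij(1) n[symmetric] nj(1)[symmetric] ij(2,3)]
    have "fst (lb v3) < 3" "fst (lb v2) \<noteq> fst (lb v3)" "fst (lb v4) \<noteq> fst (lb v3)" "fst (lb v4) < 3" using f by auto
    then have "fst (lb v2) = i" "fst (lb v4) = i" using tv[of "fst (lb v2)"] tv[of "fst (lb v4)"] nj ij l2 by auto
    then have "lb v2 = (i, \<not> p)" "lb v4 = (i, \<not> p)" using d l0 by (cases "lb v2"; cases "lb v4"; auto)+
    then show False using d by simp
  qed
  then have l3': "lb v3 = (i, \<not> p)" using d l0 by (cases "lb v3") auto
  have im: "i \<noteq> m" using f(5) l3 l2 by auto
  have "fst (lb v4) = m" using f(7,8) l3 nj(2,3) ij im by linarith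
  then have l4: "lb v4 = (m, \<not> r)" using d l2 by (cases "lb v4") auto
  have "pole_hexagon v0 v1 v2 v3 v4 v5 i j m p q r"
    unfolding pole_hexagon_def using hx l0 l1 l2 l3' l4 l5 ij im nj by auto
  then show ?thesis by (rule wsum_pole_le)
qed

lemma wsum_le_5:
  assumes h: "hexcycle v0 v1 v2 v3 v4 v5"
  shows "wsum v0 v1 v2 v3 v4 v5 \<le> 5"
proof -
  note h1 = hexcycle_rotate[OF h]
  note h2 = hexcycle_rotate[OF h1]
  note h3 = hexcycle_rotate[OF h2]
  note h4 = hexcycle_rotate[OF h3]
  note h5 = hexcycle_rotate[OF h4]
  note w = wsum_rotate[of v0 v1 v2 v3 v4 v5] wsum_rotate[of v1 v2 v3 v4 v5 v0] wsum_rotate[of v2 v3 v4 v5 v0 v1]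
    wsum_rotate[of v3 v4 v5 v0 v1 v2] wsum_rotate[of v4 v5 v0 v1 v2 v3]
  show ?thesis
  proof (cases "fst (lb v1) = fst (lb v5) \<or> fst (lb v2) = fst (lb v0) \<or> fst (lb v3) = fst (lb v1) \<or>
      fst (lb v4) = fst (lb v2) \<or> fst (lb v5) = fst (lb v3) \<or> fst (lb v0) = fst (lb v4)")
    case True
    then show ?thesis
      using hexcycle_pole[OF h] hexcycle_pole[OF h1] hexcycle_pole[OF h2] hexcycle_pole[OF h3]
        hexcycle_pole[OF h4] hexcycle_pole[OF h5] w by metis
  next
    case False
    have hx: "hx v0 v1" "hx v1 v2" "hx v2 v3" "hx v3 v4" "hx v4 v5" "hx v5 v0" using h by (simp_all add: hexcycle_def)
    have d: "distinct (map lb [v0, v1, v2, v3, v4, v5])" using h by (simp add: hexcycle_def)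
    have n: "fst (lb v5) \<noteq> fst (lb v1)" "fst (lb v0) \<noteq> fst (lb v2)" "fst (lb v1) \<noteq> fst (lb v3)"
      "fst (lb v2) \<noteq> fst (lb v4)" "fst (lb v3) \<noteq> fst (lb v5)" "fst (lb v4) \<noteq> fst (lb v0)" using False by auto
    have l: "lb v5 \<noteq> lb v2" "lb v0 \<noteq> lb v3" "lb v1 \<noteq> lb v4" "lb v2 \<noteq> lb v5" "lb v3 \<noteq> lb v0" "lb v4 \<noteq> lb v1" using d by auto
    show ?thesis unfolding wsum_def
      using nonpole_corner_bound[OF hx(6,1,2) l(1) n(1,2)] nonpole_corner_bound[OF hx(1,2,3) l(2) n(2,3)]
        nonpole_corner_bound[OF hx(2,3,4) l(3) n(3,4)] nonpole_corner_bound[OF hx(3,4,5) l(4) n(4,5)]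
        nonpole_corner_bound[OF hx(4,5,6) l(5) n(5,6)] nonpole_corner_bound[OF hx(5,6,1) l(6) n(6,1)] by linarith
  qed
qed

section \<open>Double counting of the weights of outer faces\<close>

text \<open>A corner at a hexagon edge is shared equally by the two ends of the edge; summed around
  a hexagon this gives \<open>wsum\<close>.\<close>

definition weight :: "'a \<Rightarrow> real" where
  "weight v = \<rho> (VF v) + (\<Sum>w | hx v w. \<rho> (EF v w)) / 2"

lemma weight_eq: "{w. hx v w} = {a, b} \<Longrightarrow> a \<noteq> b \<Longrightarrow> weight v = \<rho> (VF v) + (\<rho> (EF v a) + \<rho> (EF v b)) / 2"
  by (simp add: weight_def)

lemma wheel_weight_le:
  assumes a: "a \<in> V" "\<pi> a = None"
  shows "(\<Sum>v | {a, v} \<in> E. weight v) \<le> 5"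
proof -
  obtain h where h: "hexagon a h" using wheel[OF a] unfolding hexagon_def by auto
  have bij: "bij_betw h {..<6} {w. {a, w} \<in> E}" using h by (simp add: hexagon_def)
  then have inj: "inj_on h {..<6}" by (simp add: bij_betw_def)
  have nbs: "{w. hx (h i) w} = {h (Suc i mod 6), h ((i + 5) mod 6)}" if "i < 6" for i
    using hexagon_hx(3)[OF a h that] .
  have hn: "h i = h j \<longleftrightarrow> i = j" if "i < 6" "j < 6" for i j using inj that by (auto simp: inj_on_def)
  have w: "weight (h i) = \<rho> (VF (h i)) + (\<rho> (EF (h i) (h (Suc i mod 6))) + \<rho> (EF (h i) (h ((i + 5) mod 6)))) / 2"
    if "i < 6" for i
  proof (rule weight_eq[OF nbs[OF that]])
    have "Suc i mod 6 \<noteq> (i + 5) mod 6" using less_6_cases[OF that] by (elim disjE; simp)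
    then show "h (Suc i mod 6) \<noteq> h ((i + 5) mod 6)" using hn by simp
  qed
  have hx: "hx (h i) (h (Suc i mod 6))" if "i < 6" for i using nbs[OF that] by auto
  have lbn: "lb (h i) \<noteq> lb (h j)" if "i < 6" "j < 6" "i \<noteq> j" for i j
  proof
    assume l: "lb (h i) = lb (h j)"
    have e: "{a, h i} \<in> E" "{a, h j} \<in> E" using bij that unfolding bij_betw_def by auto
    have "h i \<in> U" "h j \<in> U" using hexagon_hx(1)[OF a h] that by simp_all
    then have "\<pi> (h i) = \<pi> (h j)" using U_label l by metis
    then have "h i = h j" using label_inj[OF e] by simp
    then show False using hn that by simp
  qed
  have "hexcycle (h 0) (h 1) (h 2) (h 3) (h 4) (h 5)"
    unfolding hexcycle_def
  proof (intro conjI)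
    show "hx (h 0) (h 1)" "hx (h 1) (h 2)" "hx (h 2) (h 3)" "hx (h 3) (h 4)" "hx (h 4) (h 5)" "hx (h 5) (h 0)"
      using hx[of 0] hx[of 1] hx[of 2] hx[of 3] hx[of 4] hx[of 5] by (simp_all add: numeral_2_eq_2[symmetric])
    show "distinct (map lb [h 0, h 1, h 2, h 3, h 4, h 5])" by (simp add: lbn)
  qed
  then have le: "wsum (h 0) (h 1) (h 2) (h 3) (h 4) (h 5) \<le> 5" by (rule wsum_le_5)
  have "(\<Sum>v | {a, v} \<in> E. weight v) = (\<Sum>i<6. weight (h i))"
    using sum.reindex_bij_betw[OF bij, of weight] by simp
  also have "\<dots> = weight (h 0) + weight (h 1) + weight (h 2) + weight (h 3) + weight (h 4) + weight (h 5)"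
    by (simp add: eval_nat_numeral lessThan_Suc)
  also have "\<dots> = wsum (h 0) (h 1) (h 2) (h 3) (h 4) (h 5)"
  proof -
    have "weight (h 0) = \<rho> (VF (h 0)) + (\<rho> (EF (h 0) (h 1)) + \<rho> (EF (h 5) (h 0))) / 2"
      using w[of 0] EF_sym[of "h 5" "h 0"] by simp
    moreover have "weight (h 1) = \<rho> (VF (h 1)) + (\<rho> (EF (h 1) (h 2)) + \<rho> (EF (h 0) (h 1))) / 2"
      using w[of 1] EF_sym[of "h 0" "h 1"] by (simp add: numeral_2_eq_2[symmetric])
    moreover have "weight (h 2) = \<rho> (VF (h 2)) + (\<rho> (EF (h 2) (h 3)) + \<rho> (EF (h 1) (h 2))) / 2"
      using w[of 2] EF_sym[of "h 1" "h 2"] by simp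
    moreover have "weight (h 3) = \<rho> (VF (h 3)) + (\<rho> (EF (h 3) (h 4)) + \<rho> (EF (h 2) (h 3))) / 2"
      using w[of 3] EF_sym[of "h 2" "h 3"] by simp
    moreover have "weight (h 4) = \<rho> (VF (h 4)) + (\<rho> (EF (h 4) (h 5)) + \<rho> (EF (h 3) (h 4))) / 2"
      using w[of 4] EF_sym[of "h 3" "h 4"] by simp
    moreover have "weight (h 5) = \<rho> (VF (h 5)) + (\<rho> (EF (h 5) (h 0)) + \<rho> (EF (h 4) (h 5))) / 2"
      using w[of 5] EF_sym[of "h 4" "h 5"] by simp
    ultimately show ?thesis unfolding wsum_def by argo
  qed
  finally show ?thesis using le by simp
qed

lemma finite_U: "finite U"
  using finV unfolding U_def by simp

lemma finite_F: "finite F"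
  using fs unfolding face_system_def by (elim conjE)

lemma finite_E: "finite E"
  using fs unfolding face_system_def by (elim conjE)

text \<open>An edge of an outer face is either external or a hexagon edge, and in the second case
  its ends carry external edges of the same face. Positivity ensures that the weight of the face is
  really distributed.\<close>

lemma k_pos: "f \<in> outer \<Longrightarrow> 0 < k f"
proof -
  assume f: "f \<in> outer"
  have "\<forall>f\<in>F. is_cycle (bd f) \<and> bd f \<subseteq> E" using fs unfolding face_system_def by (elim conjE)
  then have "is_cycle (bd f)" using outer_F[OF f] by simp
  then obtain e where e: "e \<in> bd f" using is_cycle_nonempty by auto
  then obtain v x where vx: "e = {v, x}" using edges bd_E[OF outer_F[OF f]] by blast
  obtain c where c: "{x, c} \<in> bd f" "hx x c \<or> ex x c" by (rule outer_next[OF f e[unfolded vx]])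
  show ?thesis
  proof (cases "hx x c")
    case True
    then have "f = EF x c" using EF_eqI f c(1) by simp
    then show ?thesis using k_ge_2(1)[OF True] by simp
  next
    case False
    then have "{x, c} \<in> xedges f" using c xedgesI by simp
    then show ?thesis unfolding k_def using finite_xedges[OF outer_F[OF f]] by (auto simp: card_gt_0_iff)
  qed
qed

lemma ex_faces:
  assumes "ex v x" "hx v a" "nx v a = x"
  shows "{f \<in> outer. {v, x} \<in> bd f} = {EF v a, VF v}"
proof (intro equalityI subsetI)
  fix f assume "f \<in> {f \<in> outer. {v, x} \<in> bd f}"
  then show "f \<in> {EF v a, VF v}" using nx_faces[OF assms(2) outer_F, of f] assms(3) by auto
next
  fix f assume "f \<in> {EF v a, VF v}"
  moreover have "v \<in> U" using assms(1) by (simp add: ex_def)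
  ultimately show "f \<in> {f \<in> outer. {v, x} \<in> bd f}"
    using EF_outer[OF assms(2)] VF_outer VF_bd[OF assms(1)] nx_bd[OF assms(2)] assms(3) by auto
qed

text \<open>Every outer face f distributes the weight 1 equally over the 2 k f ends of its external edges.\<close>

lemma card_outer: "real (card outer) = (\<Sum>v\<in>U. weight v)"
proof -
  let ?D = "Sigma U (\<lambda>v. {x. ex v x})"
  have finD: "finite ?D"
  proof (rule finite_SigmaI[OF finite_U])
    show "finite {x. ex v x}" for v by (rule finite_subset[OF _ finite_U]) (auto simp: ex_def)
  qed
  have fino: "finite outer" using finite_F unfolding outer_def by simp
  have darts: "(\<Sum>d\<in>{d \<in> ?D. {fst d, snd d} \<in> bd f}. \<rho> f / 2) = 1" if f: "f \<in> outer" for f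
  proof -
    have "{d \<in> ?D. {fst d, snd d} \<in> bd f} = {(v, x). {v, x} \<in> xedges f}"
    proof (intro equalityI subsetI)
      fix d assume "d \<in> {d \<in> ?D. {fst d, snd d} \<in> bd f}"
      then show "d \<in> {(v, x). {v, x} \<in> xedges f}" by (auto intro: xedgesI)
    next
      fix d assume "d \<in> {(v, x). {v, x} \<in> xedges f}"
      then obtain v x where d: "d = (v, x)" "{v, x} \<in> xedges f" by auto
      then obtain v' x' where e: "{v, x} \<in> bd f" "ex v' x'" "{v, x} = {v', x'}" unfolding xedges_def by blast
      then have "ex v x" using ex_sym[OF e(2)] by (auto simp: doubleton_eq_iff)
      then show "d \<in> {d \<in> ?D. {fst d, snd d} \<in> bd f}" using d e(1) by (simp add: ex_def)
    qed
    moreover have "card {(v, x). {v, x} \<in> xedges f} = 2 * k f"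
      unfolding k_def
    proof (rule card_darts(2)[OF finite_xedges[OF outer_F[OF f]]])
      fix e assume "e \<in> xedges f"
      then have "e \<in> E" using bd_E[OF outer_F[OF f]] unfolding xedges_def by auto
      then show "\<exists>u v. e = {u, v} \<and> u \<noteq> v" using edges by blast
    qed
    ultimately show ?thesis using k_pos[OF f] by (simp add: \<rho>_def)
  qed
  have "real (card outer) = (\<Sum>f\<in>outer. \<Sum>d\<in>{d \<in> ?D. {fst d, snd d} \<in> bd f}. \<rho> f / 2)"
    using darts by simp
  also have "\<dots> = (\<Sum>d\<in>?D. \<Sum>f\<in>{f \<in> outer. {fst d, snd d} \<in> bd f}. \<rho> f / 2)"
    by (rule sum.swap_restrict[OF fino finD])
  also have "\<dots> = (\<Sum>v\<in>U. \<Sum>x | ex v x. \<Sum>f\<in>{f \<in> outer. {v, x} \<in> bd f}. \<rho> f / 2)"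
    by (subst sum.Sigma) (use finite_U in \<open>auto simp: case_prod_beta intro: finite_subset[OF _ finite_U] simp: ex_def\<close>)
  also have "\<dots> = (\<Sum>v\<in>U. weight v)"
  proof (rule sum.cong[OF refl])
    fix v assume v: "v \<in> U"
    obtain a b where ab: "a \<noteq> b" "{w. hx v w} = {a, b}" by (rule hx_two[OF v])
    have h: "hx v a" "hx v b" using ab(2) by auto
    let ?x = "nx v a" and ?y = "nx v b"
    have xy: "ex v ?x" "ex v ?y" "?x \<noteq> ?y" using nx_ex h nx_neq[OF h ab(1)] by simp_all
    have exs: "{x. ex v x} = {?x, ?y}" using xy nx_cases[OF _ h ab(1)] by auto
    \<comment> \<open>Each external edge at \<open>v\<close> borders \<open>VF v\<close> and one
      face at a hexagon edge. So \<open>VF v\<close> is counted twice with factor 1/2 and the other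
      two faces once, as in \<open>weight\<close>.\<close>
    have x: "(\<Sum>f\<in>{f \<in> outer. {v, ?x} \<in> bd f}. \<rho> f / 2) = (\<rho> (EF v a) + \<rho> (VF v)) / 2"
      unfolding ex_faces[OF xy(1) h(1) refl] using EF_neq_VF[OF h(1)] by simp
    have y: "(\<Sum>f\<in>{f \<in> outer. {v, ?y} \<in> bd f}. \<rho> f / 2) = (\<rho> (EF v b) + \<rho> (VF v)) / 2"
      unfolding ex_faces[OF xy(2) h(2) refl] using EF_neq_VF[OF h(2)] by simp
    have two: "(\<Sum>x\<in>{?x, ?y}. g x) = g ?x + g ?y" for g :: "'a \<Rightarrow> real" using xy(3) by simp
    show "(\<Sum>x | ex v x. \<Sum>f\<in>{f \<in> outer. {v, x} \<in> bd f}. \<rho> f / 2) = weight v"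
      unfolding exs two x y weight_eq[OF ab(2,1)] by argo
  qed
  finally show ?thesis .
qed

section \<open>Numbers of vertices, edges and faces\<close>

definition apexes :: "'a set" where "apexes = {a \<in> V. \<pi> a = None}"

lemma finite_apexes: "finite apexes"
  using finV by (simp add: apexes_def)

lemma U_eq: "U = (\<Union>a\<in>apexes. {v. {a, v} \<in> E})"
proof (intro equalityI subsetI)
  fix v assume v: "v \<in> U"
  then have "hub v \<in> apexes" "{hub v, v} \<in> E" using hub[OF v] by (simp_all add: apexes_def insert_commute)
  then show "v \<in> (\<Union>a\<in>apexes. {v. {a, v} \<in> E})" by auto
next
  fix v assume "v \<in> (\<Union>a\<in>apexes. {v. {a, v} \<in> E})"
  then show "v \<in> U" using apex_nb by (auto simp: apexes_def)
qed

lemma apexes_disjoint: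
  "a \<in> apexes \<Longrightarrow> b \<in> apexes \<Longrightarrow> a \<noteq> b \<Longrightarrow> {v. {a, v} \<in> E} \<inter> {v. {b, v} \<in> E} = {}"
  using apex_nb unfolding apexes_def by blast

lemma card_apex_nbs: "a \<in> apexes \<Longrightarrow> card {v. {a, v} \<in> E} = 6"
  using wheel[of a] bij_betw_same_card[of _ "{..<6::nat}"] unfolding apexes_def by fastforce

lemma finite_nbs: "finite {v. {a, v} \<in> E}"
  by (rule finite_subset[OF _ finV]) (use edge_verts in auto)

lemma card_U: "card U = 6 * card apexes"
  unfolding U_eq using finite_apexes finite_nbs apexes_disjoint card_apex_nbs
  by (subst card_UN_disjoint) auto

lemma card_outer_le: "card outer \<le> 5 * card apexes"
proof -
  have "(\<Sum>v\<in>U. weight v) = (\<Sum>a\<in>apexes. \<Sum>v | {a, v} \<in> E. weight v)"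
    unfolding U_eq by (rule sum.UNION_disjoint) (use finite_apexes finite_nbs apexes_disjoint in auto)
  also have "\<dots> \<le> (\<Sum>a\<in>apexes. 5)" by (rule sum_mono) (simp add: apexes_def wheel_weight_le)
  finally have "real (card outer) \<le> 5 * real (card apexes)" unfolding card_outer by simp
  then show ?thesis by linarith
qed

text \<open>Every face through an apex vertex contains a hexagon edge, and the other face at that
  edge is outer. Choosing such an edge is therefore injective, and each wheel has at most six
  hexagon edges.\<close>

lemma card_inner_le: "card (F - outer) \<le> 6 * card apexes"
proof -
  let ?H = "{e. \<exists>v w. hx v w \<and> e = {v, w}}"
  have "\<forall>a\<in>apexes. \<exists>h. hexagon a h" using wheel unfolding hexagon_def apexes_def by auto
  then obtain h where h: "\<And>a. a \<in> apexes \<Longrightarrow> hexagon a (h a)" by metis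
  have sub: "?H \<subseteq> (\<Union>a\<in>apexes. (\<lambda>i. {h a i, h a (Suc i mod 6)}) ` {..<6})"
  proof
    fix e assume "e \<in> ?H"
    then obtain v w where vw: "hx v w" "e = {v, w}" by auto
    have v: "v \<in> U" using vw(1) by (simp add: hx_def)
    let ?a = "hub v"
    have a: "?a \<in> V" "\<pi> ?a = None" "?a \<in> apexes" using hub[OF v] by (simp_all add: apexes_def)
    have "{?a, v} \<in> E" using hub(1)[OF v] by (simp add: insert_commute)
    then have "v \<in> h ?a ` {..<6}" using h[OF a(3)] unfolding hexagon_def bij_betw_def by simp
    then obtain i where i: "i < 6" "v = h ?a i" by auto
    have "w \<in> {w. hx v w}" using vw(1) by simp
    then have "w = h ?a (Suc i mod 6) \<or> w = h ?a ((i + 5) mod 6)"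
      using hexagon_hx(3)[OF a(1,2) h[OF a(3)] i(1)] i(2) by auto
    then have "\<exists>j<6. e = {h ?a j, h ?a (Suc j mod 6)}"
    proof
      assume "w = h ?a (Suc i mod 6)"
      then show ?thesis using i vw(2) by (intro exI[of _ i]) simp
    next
      assume w: "w = h ?a ((i + 5) mod 6)"
      have "Suc ((i + 5) mod 6) mod 6 = i" using less_6_cases[OF i(1)] by (elim disjE; simp)
      then have "e = {h ?a ((i + 5) mod 6), h ?a (Suc ((i + 5) mod 6) mod 6)}"
        unfolding \<open>Suc ((i + 5) mod 6) mod 6 = i\<close> vw(2) w by (subst i(2)) (rule insert_commute)
      then show ?thesis by (intro exI[of _ "(i + 5) mod 6"]) simp
    qed
    then show "e \<in> (\<Union>a\<in>apexes. (\<lambda>i. {h a i, h a (Suc i mod 6)}) ` {..<6})" using a(3) by blast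
  qed
  have fin: "finite (\<Union>a\<in>apexes. (\<lambda>i. {h a i, h a (Suc i mod 6)}) ` {..<6})" using finite_apexes by simp
  have "card ?H \<le> card (\<Union>a\<in>apexes. (\<lambda>i. {h a i, h a (Suc i mod 6)}) ` {..<6})" by (rule card_mono[OF fin sub])
  also have "\<dots> \<le> (\<Sum>a\<in>apexes. card ((\<lambda>i. {h a i, h a (Suc i mod 6)}) ` {..<6}))" by (rule card_UN_le[OF finite_apexes])
  also have "\<dots> \<le> (\<Sum>a\<in>apexes. 6)" by (rule sum_mono) (use card_image_le[of "{..<6::nat}"] in simp)
  finally have cardH: "card ?H \<le> 6 * card apexes" by simp
  have ex: "\<exists>e. e \<in> ?H \<and> e \<in> bd f" if f: "f \<in> F - outer" for f
  proof -
    obtain e c where e: "e \<in> bd f" "c \<in> e" "\<pi> c = None" using f unfolding outer_def by blast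
    have "f \<in> F" using f by simp
    then obtain u w where "hx u w" "hub u = c" "bd f = {{c, u}, {c, w}, {u, w}}"
      by (rule spoke_face[OF _ e])
    then show ?thesis by (intro exI[of _ "{u, w}"]) auto
  qed
  define g where "g f = (SOME e. e \<in> ?H \<and> e \<in> bd f)" for f
  have g: "g f \<in> ?H \<and> g f \<in> bd f" if "f \<in> F - outer" for f
    unfolding g_def by (rule someI_ex[OF ex[OF that]])
  have "inj_on g (F - outer)"
  proof (rule inj_onI, rule ccontr)
    fix f f' assume f: "f \<in> F - outer" "f' \<in> F - outer" "g f = g f'" "f \<noteq> f'"
    obtain v w where vw: "hx v w" "g f = {v, w}" using g[OF f(1)] by auto
    have b: "{v, w} \<in> bd f" "{v, w} \<in> bd f'" using g[OF f(1)] g[OF f(2)] f(3) vw(2) by simp_all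
    have "{v, w} \<in> E" using vw(1) by (simp add: hx_def)
    then have "EF v w = f \<or> EF v w = f'"
      using face_system_two_faces[OF fs _ _ b(1) _ b(2) f(4) outer_F[OF EF_outer[OF vw(1)]] EF_hx[OF vw(1)]] f(1,2) by simp
    then show False using EF_outer[OF vw(1)] f(1,2) by auto
  qed
  moreover have "g ` (F - outer) \<subseteq> ?H" using g by auto
  moreover have "finite ?H" by (rule finite_subset[OF sub fin])
  ultimately have "card (F - outer) \<le> card ?H" by (rule card_inj_on_le)
  then show ?thesis using cardH by simp
qed

text \<open>Each wheel contributes one vertex of degree 6 and six of degree 5, and (6 + 30) / 2 =
  18.\<close>

lemma card_E: "card E = 18 * card apexes"
proof -
  have deg: "card {w. {v, w} \<in> E} = 5" if v: "v \<in> U" for v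
  proof -
    have "{w. {v, w} \<in> E} = insert (hub v) {w \<in> U. {v, w} \<in> E}"
      using U_edge_cases[OF _ v] hub(1)[OF v] by (auto simp: hx_def ex_def)
    moreover have "hub v \<notin> U" using hub(4)[OF v] .
    moreover have "finite {w \<in> U. {v, w} \<in> E}" using finite_U by simp
    ultimately show ?thesis using card_U_nb[OF v] by simp
  qed
  have VU: "V = U \<union> apexes" "U \<inter> apexes = {}" unfolding U_def apexes_def by auto
  have "2 * card E = card {(v, x). {v, x} \<in> E}"
    using card_darts(2)[OF finite_E] edges by (metis (no_types, lifting))
  also have "{(v, x). {v, x} \<in> E} = Sigma V (\<lambda>v. {w. {v, w} \<in> E})" using edge_verts by auto
  also have "card \<dots> = (\<Sum>v\<in>V. card {w. {v, w} \<in> E})"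
    using finV finite_nbs by (intro card_SigmaI) simp_all
  also have "\<dots> = (\<Sum>v\<in>U. card {w. {v, w} \<in> E}) + (\<Sum>v\<in>apexes. card {w. {v, w} \<in> E})"
    using sum.union_disjoint[OF finite_U finite_apexes VU(2)] VU(1) by metis
  also have "\<dots> = 5 * card U + 6 * card apexes" using deg card_apex_nbs by simp
  finally show ?thesis unfolding card_U by simp
qed

text \<open>For n wheels Euler's formula reads F + 7n = 18n + 2, but there are at most 5n outer and
  6n other faces.\<close>

theorem contradiction: False
proof -
  have VU: "V = U \<union> apexes" "U \<inter> apexes = {}" unfolding U_def apexes_def by auto
  have V: "card V = 7 * card apexes"
    using card_Un_disjoint[OF finite_U finite_apexes VU(2)] card_U VU(1)[symmetric] by simp
  have "card F + card (\<Union>E) = card E + 2" using fs unfolding face_system_def by (elim conjE)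
  then have "card F + 7 * card apexes = 18 * card apexes + 2" unfolding cover_E V card_E .
  moreover have "card F = card outer + card (F - outer)"
  proof -
    have "outer \<subseteq> F" by (auto simp: outer_def)
    then have "outer \<union> (F - outer) = F" "finite outer" using finite_F finite_subset by auto
    then show ?thesis using card_Un_disjoint[of outer "F - outer"] finite_F by simp
  qed
  ultimately show False using card_outer_le card_inner_le by linarith
qed

end

section \<open>The theorem\<close>

lemma triangle_is_cycle:
  assumes "a \<noteq> b" "a \<noteq> c" "b \<noteq> c"
  shows "is_cycle {{a, b}, {a, c}, {b, c}}"
  unfolding is_cycle_def
  by (rule exI[of _ "[a, b, c]"]) (use assms in \<open>auto simp: cycle_edges_def insert_commute\<close>)

lemma wheel_nonadjacent:
  assumes "i < (6::nat)"
  shows "\<exists>j<6. j \<noteq> i \<and> \<not> (j = Suc i mod 6 \<or> i = Suc j mod 6)"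
proof -
  have "(i + 3) mod 6 \<noteq> i \<and> \<not> ((i + 3) mod 6 = Suc i mod 6 \<or> i = Suc ((i + 3) mod 6) mod 6)"
    using less_6_cases[OF assms] by (elim disjE; simp)
  then show ?thesis by (intro exI[of _ "(i + 3) mod 6"]) simp
qed

lemma W7_arcs:
  "(None, None) \<notin> parcs W7" "(None, Some i) \<in> parcs W7 \<longleftrightarrow> i < 6"
  "(Some i, Some j) \<in> parcs W7 \<longleftrightarrow> i < 6 \<and> j < 6 \<and> (j = Suc i mod 6 \<or> i = Suc j mod 6)"
  by (auto simp: W7_def add_apex_def cycle_graph_def)

lemma W7_verts: "pverts W7 = insert None (Some ` {..<6})"
  by (auto simp: W7_def add_apex_def cycle_graph_def)

text \<open>The isomorphism sends v to the hub, the only vertex of the wheel adjacent to all others.\<close>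

lemma wheel_neighbourhood:
  assumes G: "pair_graph G" and v: "v \<in> pverts G"
    and iso: "digraph_iso (with_proj G \<restriction> closed_neighbourhood G v) (with_proj W7)"
  shows "\<exists>h::nat \<Rightarrow> 'a. bij_betw h {..<6} (neighbours G v) \<and>
    (\<forall>i<6. \<forall>j<6. (h i, h j) \<in> parcs G \<longleftrightarrow> j = Suc i mod 6 \<or> i = Suc j mod 6)"
proof -
  let ?N = "closed_neighbourhood G v" and ?G = "with_proj G \<restriction> closed_neighbourhood G v"
  have irr: "(v, v) \<notin> parcs G" using G unfolding pair_graph_iff by (auto simp: irrefl_def)
  have vN: "v \<in> ?N" "neighbours G v = ?N - {v}"
    using irr by (auto simp: closed_neighbourhood_def neighbours_def)
  obtain f where f: "pre_digraph.digraph_isomorphism ?G f" "with_proj W7 = app_iso f ?G"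
    using iso unfolding digraph_iso_def by auto
  let ?\<phi> = "iso_verts f"
  have verts: "?\<phi> ` ?N = pverts W7"
    using arg_cong[OF f(2), of verts] by (simp add: with_proj_def)
  have arcs: "iso_arcs f ` {e \<in> parcs G. fst e \<in> ?N \<and> snd e \<in> ?N} = parcs W7"
    using arg_cong[OF f(2), of arcs] by (simp add: with_proj_def)
  have ht: "iso_tail f = fst" "iso_head f = snd"
    using arg_cong[OF f(2), of tail] arg_cong[OF f(2), of head] by (simp_all add: with_proj_def)
  have inj: "inj_on ?\<phi> ?N"
    using pre_digraph.digraph_isomorphism_inj_on_verts[OF f(1)] by simp
  \<comment> \<open>The isomorphism has its own map on arcs. Since the target has \<open>fst\<close>
    and \<open>snd\<close> as tail and head, that map must be the one induced by the vertex
    map.\<close>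
  have ends: "iso_arcs f (x, y) = (?\<phi> x, ?\<phi> y)" if "(x, y) \<in> parcs G" "x \<in> ?N" "y \<in> ?N" for x y
  proof -
    have "(x, y) \<in> arcs ?G" using that by (simp add: with_proj_def)
    from pre_digraph.iso_verts_tail[OF f(1) this] pre_digraph.iso_verts_head[OF f(1) this]
    have "fst (iso_arcs f (x, y)) = ?\<phi> x" "snd (iso_arcs f (x, y)) = ?\<phi> y"
      unfolding ht by (simp_all add: with_proj_def)
    then show ?thesis by (metis prod.collapse)
  qed
  have adj: "(x, y) \<in> parcs G \<longleftrightarrow> (?\<phi> x, ?\<phi> y) \<in> parcs W7" if xy: "x \<in> ?N" "y \<in> ?N" for x y
  proof
    assume a: "(x, y) \<in> parcs G"
    then have "iso_arcs f (x, y) \<in> parcs W7" unfolding arcs[symmetric] using xy by force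
    then show "(?\<phi> x, ?\<phi> y) \<in> parcs W7" using ends[OF a xy] by simp
  next
    assume "(?\<phi> x, ?\<phi> y) \<in> parcs W7"
    then obtain a b where ab: "(a, b) \<in> parcs G" "a \<in> ?N" "b \<in> ?N" "(?\<phi> x, ?\<phi> y) = iso_arcs f (a, b)"
      unfolding arcs[symmetric] by auto
    then have "?\<phi> x = ?\<phi> a" "?\<phi> y = ?\<phi> b" using ends[OF ab(1-3)] by simp_all
    then have "x = a" "y = b" using inj xy ab(2,3) by (simp_all add: inj_on_def)
    then show "(x, y) \<in> parcs G" using ab(1) by simp
  qed
  have adjv: "(v, y) \<in> parcs G" if "y \<in> ?N" "y \<noteq> v" for y
    using that by (auto simp: closed_neighbourhood_def neighbours_def)
  have phiv: "?\<phi> v = None"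
  proof (rule ccontr)
    assume n: "?\<phi> v \<noteq> None"
    have "?\<phi> v \<in> pverts W7" using verts vN(1) by auto
    then obtain i where i: "?\<phi> v = Some i" "i < 6" using n unfolding W7_verts by auto
    obtain j where j: "j < 6" "j \<noteq> i" "\<not> (j = Suc i mod 6 \<or> i = Suc j mod 6)" using wheel_nonadjacent[OF i(2)] by auto
    have "Some j \<in> ?\<phi> ` ?N" unfolding verts W7_verts using j(1) by simp
    then obtain y where y: "y \<in> ?N" "?\<phi> y = Some j" by auto
    have "y \<noteq> v" using y(2) i(1) j(2) by auto
    then have "(Some i, Some j) \<in> parcs W7" using adj[OF vN(1) y(1)] adjv[OF y(1)] y(2) i(1) by simp
    then show False using j(3) W7_arcs(3) by simp
  qed
  have "?\<phi> ` (?N - {v}) = Some ` {..<6}"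
  proof -
    have "?\<phi> ` (?N - {v}) = ?\<phi> ` ?N - {None}"
      using inj_on_image_set_diff[OF inj, of ?N "{v}"] vN(1) phiv by simp
    then show ?thesis unfolding verts W7_verts by auto
  qed
  then have bij: "bij_betw ?\<phi> (?N - {v}) (Some ` {..<6})"
    using inj unfolding bij_betw_def by (auto intro: inj_on_subset)
  define h where "h i = inv_into (?N - {v}) ?\<phi> (Some i)" for i
  have "bij_betw (inv_into (?N - {v}) ?\<phi>) (Some ` {..<6}) (?N - {v})" by (rule bij_betw_inv_into[OF bij])
  moreover have "bij_betw Some {..<6::nat} (Some ` {..<6})" by (simp add: bij_betw_def)
  ultimately have "bij_betw (inv_into (?N - {v}) ?\<phi> \<circ> Some) {..<6} (?N - {v})" by (rule bij_betw_trans[rotated])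
  then have hb: "bij_betw h {..<6} (?N - {v})" unfolding h_def comp_def .
  have hN: "h i \<in> ?N \<and> ?\<phi> (h i) = Some i" if "i < 6" for i
  proof -
    have "h i \<in> ?N - {v}" using hb that by (auto simp: bij_betw_def)
    moreover have "?\<phi> (h i) = Some i" unfolding h_def
      by (rule bij_betw_inv_into_right[OF bij]) (use that in simp)
    ultimately show ?thesis by simp
  qed
  have "(h i, h j) \<in> parcs G \<longleftrightarrow> j = Suc i mod 6 \<or> i = Suc j mod 6" if "i < 6" "j < 6" for i j
    using adj[of "h i" "h j"] hN[OF that(1)] hN[OF that(2)] W7_arcs(3)[of i j] that by simp
  then show ?thesis using hb unfolding vN(2) by blast
qed

lemma no_planar_wheel_cover:
  fixes G :: "'a pair_pre_digraph"
  assumes G: "pair_graph G" and pl: "planar G" and cov: "covering_projection G K1222 \<pi>"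
    and wh: "\<And>v. v \<in> pverts G \<Longrightarrow> \<pi> v = None \<Longrightarrow>
       digraph_iso (with_proj G \<restriction> closed_neighbourhood G v) (with_proj W7)"
  shows False
proof -
  have G': "finite (pverts G)" "parcs G \<subseteq> pverts G \<times> pverts G" "sym (parcs G)" "irrefl (parcs G)"
    using G unfolding pair_graph_iff by simp_all
  have onto: "\<pi> ` pverts G = pverts K1222"
    and bijG: "\<And>v. v \<in> pverts G \<Longrightarrow> bij_betw \<pi> (neighbours G v) (neighbours K1222 (\<pi> v))"
    using cov unfolding covering_projection_def by simp_all
  obtain p \<gamma> where dr: "plane_drawing G p \<gamma>" using pl unfolding planar_def by auto
  \<comment> \<open>Surjectivity of the projection enters here: it provides an apex vertex, so there
    is at least one wheel.\<close>
  have "None \<in> \<pi> ` pverts G" unfolding onto pverts_K1222 by simp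
  then obtain v0 where v0: "v0 \<in> pverts G" "\<pi> v0 = None" by auto
  \<comment> \<open>The component of \<open>v0\<close>. The covering and wheel conditions concern
    only neighbourhoods and are inherited by it. Edges become unordered pairs to match the indexing
    of the arcs in the drawing.\<close>
  define V where "V = {w. (v0, w) \<in> (parcs G)\<^sup>*}"
  define E where "E = {{u, w} | u w. (u, w) \<in> parcs G \<and> u \<in> V}"
  have VG: "V \<subseteq> pverts G"
  proof
    fix w assume "w \<in> V"
    then have "(v0, w) \<in> (parcs G)\<^sup>*" by (simp add: V_def)
    then show "w \<in> pverts G" by (induction rule: rtrancl_induct) (use v0 G'(2) in auto)
  qed
  have Vstep: "w \<in> V" if "u \<in> V" "(u, w) \<in> parcs G" for u w
    using that unfolding V_def by (simp add: rtrancl.rtrancl_into_rtrancl)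
  have sym: "(w, u) \<in> parcs G" if "(u, w) \<in> parcs G" for u w using G'(3) that by (rule symD)
  have E_iff: "{u, w} \<in> E \<longleftrightarrow> u \<in> V \<and> (u, w) \<in> parcs G" for u w
  proof
    assume "{u, w} \<in> E"
    then obtain a b where ab: "{u, w} = {a, b}" "(a, b) \<in> parcs G" "a \<in> V" unfolding E_def by blast
    then show "u \<in> V \<and> (u, w) \<in> parcs G" using Vstep[OF ab(3,2)] sym[OF ab(2)] by (auto simp: doubleton_eq_iff)
  qed (auto simp: E_def)
  have edge: "\<exists>u v. e = {u, v} \<and> u \<in> V \<and> v \<in> V \<and> u \<noteq> v" if "e \<in> E" for e
  proof -
    from that obtain a b where ab: "e = {a, b}" "(a, b) \<in> parcs G" "a \<in> V" unfolding E_def by blast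
    moreover have "a \<noteq> b" using ab(2) G'(4) by (auto simp: irrefl_def)
    ultimately show ?thesis using Vstep[OF ab(3,2)] by blast
  qed
  have EG: "\<exists>u v. e = {u, v} \<and> (u, v) \<in> parcs G" if "e \<in> E" for e using that unfolding E_def by blast
  have nbE: "{w. {v, w} \<in> E} = neighbours G v" if "v \<in> V" for v
    unfolding neighbours_def using E_iff that by simp
  have finV: "finite V" using VG G'(1) by (rule finite_subset)
  interpret label_cover V E \<pi>
  proof
    show "bij_betw \<pi> {w. {v, w} \<in> E} (neighbours K1222 (\<pi> v))" if "v \<in> V" for v
      using bijG nbE[OF that] that VG by (metis subsetD)
    show "\<pi> v \<in> pverts K1222" if "v \<in> V" for v using onto that VG by blast
  qed (use finV edge in blast)+
  have D: "inj_on p (pverts G)"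
    "\<And>u v. (u, v) \<in> parcs G \<Longrightarrow> arc (\<gamma> {u, v}) \<and> {pathstart (\<gamma> {u, v}), pathfinish (\<gamma> {u, v})} = {p u, p v} \<and>
        arc_interior (\<gamma> {u, v}) \<inter> p ` pverts G = {}"
    "\<And>u v x y. (u, v) \<in> parcs G \<Longrightarrow> (x, y) \<in> parcs G \<Longrightarrow> {x, y} \<noteq> {u, v} \<Longrightarrow>
        arc_interior (\<gamma> {u, v}) \<inter> path_image (\<gamma> {x, y}) = {}"
    using dr unfolding plane_drawing_def by (simp, fast, fast)
  interpret plane_graph V E p \<gamma>
  proof
    show "finite V" by (rule finV)
    show "inj_on p V" using D(1) VG by (rule inj_on_subset)
    fix e assume e: "e \<in> E"
    show "\<exists>u v. e = {u, v} \<and> u \<in> V \<and> v \<in> V \<and> u \<noteq> v" by (rule edge[OF e])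
    obtain u v where uv: "e = {u, v}" "(u, v) \<in> parcs G" using EG[OF e] by auto
    show "arc (\<gamma> e)" "{pathstart (\<gamma> e), pathfinish (\<gamma> e)} = p ` e" using D(2)[OF uv(2)] uv(1) by simp_all
    have "arc_interior (\<gamma> e) \<inter> p ` pverts G = {}" using D(2)[OF uv(2)] uv(1) by simp
    then show "arc_interior (\<gamma> e) \<inter> p ` V = {}" using image_mono[OF VG, of p] by blast
    fix f assume f: "f \<in> E" "f \<noteq> e"
    obtain x y where xy: "f = {x, y}" "(x, y) \<in> parcs G" using EG[OF f(1)] by auto
    show "arc_interior (\<gamma> e) \<inter> path_image (\<gamma> f) = {}"
      using D(3)[OF uv(2) xy(2)] f(2) unfolding uv(1) xy(1) by simp
  qed
  have conn: "connected_on E V" unfolding connected_on_def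
  proof (intro allI impI)
    fix S assume S: "S \<subseteq> V" "S \<noteq> {}" "\<forall>x\<in>S. \<forall>y\<in>V. {x, y} \<in> E \<longrightarrow> y \<in> S"
    have step: "y \<in> S" if "x \<in> S" "(x, y) \<in> parcs G" for x y
      using S(1,3) that Vstep E_iff by (metis subsetD)
    obtain s where s: "s \<in> S" using S(2) by auto
    have "(v0, s) \<in> (parcs G)\<^sup>*" using s S(1) by (auto simp: V_def)
    then have "(s, v0) \<in> (parcs G)\<^sup>*" using sym_rtrancl[OF G'(3)] by (simp add: symD)
    then have "v0 \<in> S" by (induction rule: rtrancl_induct) (use s step in auto)
    have "w \<in> S" if "w \<in> V" for w
    proof -
      have "(v0, w) \<in> (parcs G)\<^sup>*" using that by (simp add: V_def)
      then show ?thesis by (induction rule: rtrancl_induct) (use \<open>v0 \<in> S\<close> step in auto)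
    qed
    then show "S = V" using S(1) by auto
  qed
  have v0V: "v0 \<in> V" by (simp add: V_def)
  have wheel: "\<exists>h::nat \<Rightarrow> 'a. bij_betw h {..<6} {w. {a, w} \<in> E} \<and>
      (\<forall>i<6. \<forall>j<6. {h i, h j} \<in> E \<longleftrightarrow> j = Suc i mod 6 \<or> i = Suc j mod 6)" if a: "a \<in> V" "\<pi> a = None" for a
  proof -
    have aG: "a \<in> pverts G" using a(1) VG by auto
    obtain h :: "nat \<Rightarrow> 'a" where h: "bij_betw h {..<6} (neighbours G a)"
      "\<And>i j. i < 6 \<Longrightarrow> j < 6 \<Longrightarrow> (h i, h j) \<in> parcs G \<longleftrightarrow> j = Suc i mod 6 \<or> i = Suc j mod 6"
      using wheel_neighbourhood[OF G aG wh[OF aG a(2)]] by auto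
    have hV: "h i \<in> V" if "i < 6" for i
    proof -
      have "h i \<in> neighbours G a" using h(1) that by (auto simp: bij_betw_def)
      then show ?thesis using Vstep[OF a(1)] by (simp add: neighbours_def)
    qed
    have "{h i, h j} \<in> E \<longleftrightarrow> j = Suc i mod 6 \<or> i = Suc j mod 6" if "i < 6" "j < 6" for i j
      using h(2)[OF that] hV[OF that(1)] E_iff by simp
    then show ?thesis using h(1) nbE[OF a(1)] by (intro exI[of _ h]) simp
  qed
  \<comment> \<open>Guarantees that a vertex remains when a triangle is deleted, as
    \<open>facial_cycle\<close> requires.\<close>
  have card_V: "6 \<le> card V"
  proof -
    obtain h :: "nat \<Rightarrow> 'a" where h: "bij_betw h {..<6} {w. {v0, w} \<in> E}" using wheel[OF v0V v0(2)] by auto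
    have c: "card {w. {v0, w} \<in> E} = 6" using bij_betw_same_card[OF h] by simp
    have "{w. {v0, w} \<in> E} \<subseteq> V" using edge_verts by auto
    then have "card {w. {v0, w} \<in> E} \<le> card V" using finV by (intro card_mono) auto
    then show ?thesis using c by simp
  qed
  have conn1: "connected_on E (V - {c})" if "c \<in> V" for c
    by (rule connected_minus_clique[OF conn]) (use that in auto)
  have tri_cycle: "is_cycle {{a, v}, {a, w}, {v, w}}" if "{a, v} \<in> E" "{a, w} \<in> E" "{v, w} \<in> E" for a v w
    using that edge_verts by (intro triangle_is_cycle) auto
  have tri_ex: "\<exists>v w. {v0, v} \<in> E \<and> {v0, w} \<in> E \<and> {v, w} \<in> E"
  proof -
    obtain h :: "nat \<Rightarrow> 'a" where h: "bij_betw h {..<6} {w. {v0, w} \<in> E}"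
      "\<And>i j. i < 6 \<Longrightarrow> j < 6 \<Longrightarrow> {h i, h j} \<in> E \<longleftrightarrow> j = Suc i mod 6 \<or> i = Suc j mod 6"
      using wheel[OF v0V v0(2)] by auto
    have "h 0 \<in> {w. {v0, w} \<in> E}" "h 1 \<in> {w. {v0, w} \<in> E}" using h(1) by (auto simp: bij_betw_def)
    moreover have "{h 0, h 1} \<in> E" using h(2)[of 0 1] by simp
    ultimately show ?thesis by blast
  qed
  have "good E"
  proof -
    obtain v w where vw: "{v0, v} \<in> E" "{v0, w} \<in> E" "{v, w} \<in> E" using tri_ex by blast
    have "{{v0, v}, {v0, w}, {v, w}} \<subseteq> E" using vw by simp
    from good_E[OF tri_cycle[OF vw] this conn conn1] show ?thesis .
  qed
  then obtain bd where fs: "face_system E (components (- drawing E)) bd"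
    and fr: "\<And>C. C \<in> components (- drawing E) \<Longrightarrow> frontier C = drawing (bd C)"
    unfolding good_def by blast
  have bdE: "bd C \<subseteq> E" if "C \<in> components (- drawing E)" for C
  proof -
    have "\<forall>f\<in>components (- drawing E). is_cycle (bd f) \<and> bd f \<subseteq> E" using fs unfolding face_system_def by (elim conjE)
    then show ?thesis using that by simp
  qed
  interpret wheel_faces V E \<pi> "components (- drawing E)" bd
  proof
    show "face_system E (components (- drawing E)) bd" by (rule fs)
    show "\<Union>E = V"
    proof (intro equalityI subsetI)
      fix x assume "x \<in> \<Union>E"
      then show "x \<in> V" using edge by blast
    next
      fix x assume x: "x \<in> V"
      have "neighbours K1222 (\<pi> x) \<noteq> {}"
        using labels[OF x] by (cases "\<pi> x") (auto simp: pverts_K1222 neighbours_K1222_None neighbours_K1222_Some intro: exI[of _ "0::nat"])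
      then obtain y where "y \<in> neighbours K1222 (\<pi> x)" by auto
      from nb(1)[OF x this] show "x \<in> \<Union>E" by blast
    qed
    show "\<exists>h::nat \<Rightarrow> 'a. bij_betw h {..<6} {w. {a, w} \<in> E} \<and>
      (\<forall>i<6. \<forall>j<6. {h i, h j} \<in> E \<longleftrightarrow> j = Suc i mod 6 \<or> i = Suc j mod 6)" if "a \<in> V" "\<pi> a = None" for a
      by (rule wheel[OF that])
    fix a v w assume a: "\<pi> a = None" "{a, v} \<in> E" "{a, w} \<in> E" "{v, w} \<in> E"
    let ?Z = "{{a, v}, {a, w}, {v, w}}"
    have ZE: "?Z \<subseteq> E" using a by simp
    have UZ: "\<Union>?Z = {a, v, w}" by auto
    have d: "a \<noteq> v" "a \<noteq> w" "v \<noteq> w" "a \<in> V" "v \<in> V" "w \<in> V" using a edge_verts by blast+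
    have "connected_on E (V - {a, v, w})"
      by (rule connected_minus_clique[OF conn]) (use d a in \<open>auto simp: insert_commute\<close>)
    moreover have "V - {a, v, w} \<noteq> {}"
    proof
      assume "V - {a, v, w} = {}"
      then have "V \<subseteq> {a, v, w}" by simp
      then have "card V \<le> card {a, v, w}" by (intro card_mono) simp_all
      then show False using card_V d by simp
    qed
    moreover have "e \<in> ?Z" if e: "e \<in> E" "e \<subseteq> \<Union>?Z" for e
    proof -
      obtain x y where xy: "e = {x, y}" "x \<noteq> y" using edge[OF e(1)] by auto
      then show ?thesis using e(2) unfolding UZ by auto
    qed
    ultimately obtain C where C: "C \<in> components (- drawing E)" "frontier C = drawing ?Z"
      using facial_cycle[OF tri_cycle[OF a(2-4)] ZE] unfolding UZ by metis
    have "drawing (bd C) = drawing ?Z" using fr[OF C(1)] C(2) by simp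
    then have "bd C = ?Z" using drawing_inj[OF bdE[OF C(1)] ZE] drawing_inj[OF ZE bdE[OF C(1)]] by (intro equalityI) simp_all
    then show "\<exists>f\<in>components (- drawing E). bd f = ?Z" using C(1) by blast
  qed
  show False by (rule contradiction)
qed

theorem theorem2:
  shows "\<nexists>(G :: 'a pair_pre_digraph) \<pi>.
    pair_graph G \<and> planar G \<and> covering_projection G K1222 \<pi> \<and>
    (\<forall>v\<in>pverts G. \<pi> v = None \<longrightarrow>
       digraph_iso (with_proj G \<restriction> closed_neighbourhood G v) (with_proj W7))"
  using no_planar_wheel_cover by blast

end
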